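(* Let $H$ be a Hilbert space, let $(T_t)_{t\ge0}$ be a bounded $C_0$-semigroup on $H$ with infinitesimal generator $-A$, and let $C=\sup_{t\ge0}\|T_t\|$. Then there exists a unique bounded algebra homomorphism $\rho_{0,A}\colon\mathcal{A}_0(\mathbb{C}_+)\to B(H)$ such that $$\rho_{0,A}(L_b)=\int_0^\infty b(t)T_t\,dt\qquad\text{for all } b\in L^1(0,\infty).$$ Moreover $\|\rho_{0,A}\|\le C^2$.
   Context: $\mathbb{C}_+=\{z:\mathrm{Re}\,z>0\}$. $H^1(\mathbb{R})=\{h\in L^1(\mathbb{R}):\widehat h(u)=0\ \forall u\le0\}$, $\widehat h(u)=\int h(t)e^{-itu}dt$. $\mathcal{A}_0(\mathbb{R})$ is the set of $F\colon\mathbb{R}\to\mathbb{C}$ with $F=\sum_kf_k\star h_k$ pointwise for some $(f_k)\subset C_0(\mathbb{R})$, $(h_k)\subset H^1(\mathbb{R})$, $\sum_k\|f_k\|_\infty\|h_k\|_1<\infty$, with norm $\|F\|_{\mathcal{A}_0}=\inf\sum_k\|f_k\|_\infty\|h_k\|_1$; such $F$ lie in $H^\infty(\mathbb{R})$ (bounded functions with analytic Poisson extension $\mathcal{P}[F]$ to the upper half-plane). For such $F$ set $\widetilde F(z)=\mathcal{P}[F](iz)$, $z\in\mathbb{C}_+$, and $\mathcal{A}_0(\mathbb{C}_+)=\{\widetilde F:F\in\mathcal{A}_0(\mathbb{R})\}$ with $\|\widetilde F\|_{\mathcal{A}_0}=\|F\|_{\mathcal{A}_0}$; it is a Banach algebra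 under pointwise multiplication. For $b\in L^1(0,\infty)$, $L_b(z)=\int_0^\infty e^{-tz}b(t)dt$ ($z\in\mathbb{C}_+$) is the Laplace transform; $L_b=\widetilde F$ with $F(u)=\widehat b(-u)$, and $L_b\in\mathcal{A}_0(\mathbb{C}_+)$. The integral $\int_0^\infty b(t)T_tdt$ is in the strong sense. *)

theory Defs
  imports "HOL-Analysis.Analysis"
begin

text \<open>A complex Hilbert space is a real Hilbert space (type class real_inner + complete_space)
  together with an orthogonal operator J with J o J = -id (multiplication by i).
  The complex inner product is recovered as inner x y + i * inner x (J y).\<close>

definition cplx_struct :: "('h::{real_inner,complete_space} \<Rightarrow> 'h) \<Rightarrow> bool" where
  "cplx_struct J \<longleftrightarrow> bounded_linear J \<and> (\<forall>x. J (J x) = - x) \<and>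
     (\<forall>x y. inner (J x) (J y) = inner x y)"

definition cscale :: "('h::real_normed_vector \<Rightarrow> 'h) \<Rightarrow> complex \<Rightarrow> 'h \<Rightarrow> 'h" where
  "cscale J c x = Re c *\<^sub>R x + Im c *\<^sub>R J x"

text \<open>B(H): bounded complex-linear operators = bounded real-linear operators commuting with J\<close>
definition BH :: "('h::real_normed_vector \<Rightarrow> 'h) \<Rightarrow> ('h \<Rightarrow>\<^sub>L 'h) set" where
  "BH J = {X. \<forall>x. blinfun_apply X (J x) = J (blinfun_apply X x)}"

definition bounded_C0_semigroup :: "('h::real_normed_vector \<Rightarrow> 'h) \<Rightarrow> (real \<Rightarrow> 'h \<Rightarrow>\<^sub>L 'h) \<Rightarrow> bool" where
  "bounded_C0_semigroup J T \<longleftrightarrow>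
     (\<forall>t\<ge>0. T t \<in> BH J) \<and>
     T 0 = id_blinfun \<and>
     (\<forall>s\<ge>0. \<forall>t\<ge>0. T (s + t) = T s o\<^sub>L T t) \<and>
     (\<forall>x. continuous_on {0..} (\<lambda>t. blinfun_apply (T t) x)) \<and>
     (\<exists>M. \<forall>t\<ge>0. norm (T t) \<le> M)"

definition C0fun :: "(real \<Rightarrow> complex) \<Rightarrow> bool" where
  "C0fun f \<longleftrightarrow> continuous_on UNIV f \<and> (f \<longlongrightarrow> 0) at_infinity"

definition supnorm :: "(real \<Rightarrow> complex) \<Rightarrow> real" where
  "supnorm f = (SUP t. norm (f t))"

definition fourier :: "(real \<Rightarrow> complex) \<Rightarrow> real \<Rightarrow> complex" where
  "fourier h u = integral UNIV (\<lambda>t. h t * exp (- (\<i> * complex_of_real (t * u))))"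

definition H1fun :: "(real \<Rightarrow> complex) \<Rightarrow> bool" where
  "H1fun h \<longleftrightarrow> h absolutely_integrable_on UNIV \<and> (\<forall>u\<le>0. fourier h u = 0)"

definition L1norm :: "(real \<Rightarrow> complex) \<Rightarrow> real" where
  "L1norm h = integral UNIV (\<lambda>t. norm (h t))"

definition conv :: "(real \<Rightarrow> complex) \<Rightarrow> (real \<Rightarrow> complex) \<Rightarrow> real \<Rightarrow> complex" where
  "conv f h t = integral UNIV (\<lambda>s. f (t - s) * h s)"

definition A0R_rep :: "(real \<Rightarrow> complex) \<Rightarrow> (nat \<Rightarrow> real \<Rightarrow> complex) \<Rightarrow> (nat \<Rightarrow> real \<Rightarrow> complex) \<Rightarrow> bool" where
  "A0R_rep F fs hs \<longleftrightarrow> (\<forall>k. C0fun (fs k) \<and> H1fun (hs k)) \<and>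
     summable (\<lambda>k. supnorm (fs k) * L1norm (hs k)) \<and>
     (\<forall>t. (\<lambda>k. conv (fs k) (hs k) t) sums F t)"

definition A0R :: "(real \<Rightarrow> complex) set" where
  "A0R = {F. \<exists>fs hs. A0R_rep F fs hs}"

definition A0R_norm :: "(real \<Rightarrow> complex) \<Rightarrow> real" where
  "A0R_norm F = Inf {(\<Sum>k. supnorm (fs k) * L1norm (hs k)) | fs hs. A0R_rep F fs hs}"

definition poisson :: "(real \<Rightarrow> complex) \<Rightarrow> complex \<Rightarrow> complex" where
  "poisson F w = integral UNIV
     (\<lambda>t. complex_of_real (Im w / (pi * ((Re w - t)\<^sup>2 + (Im w)\<^sup>2))) * F t)"

definition tildeF :: "(real \<Rightarrow> complex) \<Rightarrow> complex \<Rightarrow> complex" where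
  "tildeF F z = (if 0 < Re z then poisson F (\<i> * z) else 0)"

definition A0C :: "(complex \<Rightarrow> complex) set" where
  "A0C = tildeF ` A0R"

definition A0C_norm :: "(complex \<Rightarrow> complex) \<Rightarrow> real" where
  "A0C_norm \<phi> = Inf {A0R_norm F | F. F \<in> A0R \<and> tildeF F = \<phi>}"

definition laplace :: "(real \<Rightarrow> complex) \<Rightarrow> complex \<Rightarrow> complex" where
  "laplace b z = (if 0 < Re z then integral {0..} (\<lambda>t. exp (- (complex_of_real t * z)) * b t) else 0)"

definition A0C_bounded_hom :: "('h::real_normed_vector \<Rightarrow> 'h) \<Rightarrow> ((complex \<Rightarrow> complex) \<Rightarrow> ('h \<Rightarrow>\<^sub>L 'h)) \<Rightarrow> bool" where
  "A0C_bounded_hom J \<rho> \<longleftrightarrow>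
     (\<forall>\<phi>\<in>A0C. \<rho> \<phi> \<in> BH J) \<and>
     (\<forall>\<phi>\<in>A0C. \<forall>\<psi>\<in>A0C. \<rho> (\<lambda>z. \<phi> z + \<psi> z) = \<rho> \<phi> + \<rho> \<psi>) \<and>
     (\<forall>\<phi>\<in>A0C. \<forall>c x. blinfun_apply (\<rho> (\<lambda>z. c * \<phi> z)) x = cscale J c (blinfun_apply (\<rho> \<phi>) x)) \<and>
     (\<forall>\<phi>\<in>A0C. \<forall>\<psi>\<in>A0C. \<rho> (\<lambda>z. \<phi> z * \<psi> z) = \<rho> \<phi> o\<^sub>L \<rho> \<psi>) \<and>
     (\<exists>K. \<forall>\<phi>\<in>A0C. norm (\<rho> \<phi>) \<le> K * A0C_norm \<phi>)"

end

theory Submission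
  imports Defs "HOL-Probability.Probability"
begin

text \<open>For \<open>f \<in> C\<^sub>0\<close> with integrable Fourier transform \<open>c\<close> and \<open>h \<in> H\<^sup>1\<close>, the function \<open>f \<star> h\<close> is the
  transform of \<open>b = c \<cdot> hft h\<close>, which lives on the half-line, and everything rests on the estimate
  \<open>\<parallel>\<integral> b(t) T\<^sub>t dt\<parallel> \<le> C\<^sup>2 \<parallel>f\<parallel>\<^sub>\<infinity> \<parallel>h\<parallel>\<^sub>1\<close>. Sampling \<open>t\<close> at multiples of a small step and smoothing with
  a Fejer kernel reduces it to analytic trigonometric polynomials \<open>p\<close>; if \<open>p\<close> is factored as \<open>w v\<close> with
  \<open>\<bar>w\<bar>\<^sup>2 = \<bar>v\<bar>\<^sup>2 = \<bar>p\<bar>\<close> on the circle, the semigroup law turns the sum into a Hankel form in the vectors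
  \<open>v\<^sub>k T\<^sub>k x\<close> and \<open>w\<^sub>m T\<^sub>m\<^sup>* y\<close>, and Parseval together with Cauchy--Schwarz gives the bound. Approximate
  factorizations suffice, and these come from exponentials of polynomials.

  The homomorphism is obtained by closing the Hille--Phillips calculus \<open>L\<^sub>b \<mapsto> \<integral> b(t) T\<^sub>t dt\<close> in the
  supremum norm of the symbol together with the operator norm, uniformly over the damped semigroups
  \<open>e\<^sup>-\<^sup>\<delta>\<^sup>t T\<^sub>t\<close>, \<open>\<delta> \<ge> 0\<close>. Fourier inversion shows that this closure is single-valued.\<close>

text \<open>The constant is a square because the Hankel form pairs two families of vectors,
  \<open>T\<^sub>k x\<close> and \<open>T\<^sub>m\<^sup>* y\<close>, each of which costs one factor
  \<open>C\<close>; f enters only as a multiplier, h only through the mean of |p|.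

  The main obstacle is that the estimate speaks of one representation at a time, while a function in
  A_0 has many. That two representations give the same operator is not automatic: a small L_b on the
  half-plane says nothing about the L^1 norm of b, and so nothing direct about the integral of b(t)
  T_t. Smoothing and damping bridge the gap. Convolution with a fixed kernel whose transform is
  integrable turns smallness of L_b into uniform smallness of the smoothed density, and the factor
  exp (- \<delta> t) turns uniform into L^1 smallness. Approximation that is uniform in \<delta>
  then permits the return to \<delta> = 0.

  Operators are built weakly, from their matrix coefficients, so that scalar integration theory
  carries almost all the analysis; the weak integral is identified with the strong one
  separately.\<close>

section \<open>Hilbert space\<close>

text \<open>Variational proof: the functional |x|^2 / 2 - l x is bounded below, a minimising
  sequence converges by completeness, and the vanishing first variation at the minimiser
  \<open>y\<close> is the equation \<open>l x = inner x y\<close>.\<close>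

lemma riesz_representation:
  fixes l :: "'h::{real_inner,complete_space} \<Rightarrow> real"
  assumes "bounded_linear l"
  shows "\<exists>y. \<forall>x. l x = inner x y"
proof -
  interpret l: bounded_linear l by fact
  obtain K where K: "K \<ge> 0" "\<And>x. \<bar>l x\<bar> \<le> norm x * K"
    using l.nonneg_bounded by auto
  let ?q = "\<lambda>x. (norm x)\<^sup>2 / 2 - l x"
  have qbound: "?q x \<ge> - K\<^sup>2 / 2" for x
  proof -
    have "0 \<le> (norm x - K)\<^sup>2 / 2" by simp
    also have "\<dots> = (norm x)\<^sup>2 / 2 - norm x * K + K\<^sup>2 / 2"
      by (simp add: power2_eq_square field_simps)
    finally show ?thesis using K(2)[of x] by linarith
  qed
  define m where "m = (INF x. ?q x)"
  have bdd: "bdd_below (range ?q)"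
    using qbound by (meson bdd_below.I2)
  have m_le: "m \<le> ?q x" for x
    unfolding m_def by (rule cINF_lower[OF bdd]) simp
  have ex: "\<exists>x. ?q x < m + e" if "e > 0" for e
    using cINF_less_iff[OF _ bdd, of "m + e"] that unfolding m_def by auto
  have "\<forall>n. \<exists>x. ?q x < m + 1 / real (Suc n)"
    by (intro allI ex) simp
  then obtain X where X: "\<And>n. ?q (X n) < m + 1 / real (Suc n)" by metis
  \<comment> \<open>Parallelogram law: minimising sequences of the quadratic functional are Cauchy.\<close>
  have par: "(norm (x - y))\<^sup>2 / 4 \<le> ?q x + ?q y - 2 * m" for x y
  proof -
    have "?q ((1/2) *\<^sub>R (x + y)) = (norm (x+y))\<^sup>2 / 8 - (l x + l y) / 2"
      by (simp add: l.scaleR l.add power_mult_distrib power2_eq_square)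
    moreover have "(norm (x+y))\<^sup>2 + (norm (x-y))\<^sup>2 = 2 * (norm x)\<^sup>2 + 2 * (norm y)\<^sup>2"
      by (simp add: power2_norm_eq_inner inner_add inner_diff inner_commute)
    moreover have "m \<le> ?q ((1/2) *\<^sub>R (x + y))" by (rule m_le)
    ultimately show ?thesis by (simp add: field_simps)
  qed
  have "Cauchy X"
  proof (rule metric_CauchyI)
    fix e :: real assume e: "e > 0"
    obtain N where N: "8 / real (Suc N) < e\<^sup>2"
    proof -
      have "0 < e\<^sup>2 / 8" using e by simp
      then obtain N where "inverse (real (Suc N)) < e\<^sup>2 / 8"
        using reals_Archimedean by blast
      then show ?thesis by (intro that[of N]) (simp add: field_simps)
    qed
    have "dist (X i) (X j) < e" if "i \<ge> N" "j \<ge> N" for i j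
    proof -
      have "1 / real (Suc i) \<le> 1 / real (Suc N)" "1 / real (Suc j) \<le> 1 / real (Suc N)"
        using that by (auto simp: field_simps)
      then have "(norm (X i - X j))\<^sup>2 / 4 \<le> 2 / real (Suc N)"
        using par[of "X i" "X j"] X[of i] X[of j] by linarith
      then have "(norm (X i - X j))\<^sup>2 \<le> 8 / real (Suc N)" by simp
      then have "(norm (X i - X j))\<^sup>2 < e\<^sup>2" using N by linarith
      then show ?thesis using e by (simp add: dist_norm power2_less_imp_less)
    qed
    then show "\<exists>N. \<forall>i\<ge>N. \<forall>j\<ge>N. dist (X i) (X j) < e" by blast
  qed
  then obtain y where y: "X \<longlonglongrightarrow> y"
    using Cauchy_convergent_iff convergent_def by blast
  have "(\<lambda>n. ?q (X n)) \<longlonglongrightarrow> ?q y"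
    by (intro tendsto_intros y l.tendsto) simp
  moreover have "(\<lambda>n. m + 1 / real (Suc n)) \<longlonglongrightarrow> m + 0"
    using LIMSEQ_inverse_real_of_nat by (intro tendsto_intros) (simp add: inverse_eq_divide)
  ultimately have "?q y \<le> m + 0"
    by (rule LIMSEQ_le) (use X in \<open>auto intro: less_imp_le\<close>)
  then have ymin: "?q y \<le> ?q x" for x using m_le[of x] by linarith
  have "l x = inner x y" for x
  proof -
    define d where "d = inner x y - l x"
    have q: "0 \<le> t * d + t\<^sup>2 * (norm x)\<^sup>2 / 2" for t
    proof -
      have "?q (y + t *\<^sub>R x) = ?q y + t * d + t\<^sup>2 * (norm x)\<^sup>2 / 2"
        unfolding d_def
        by (simp add: power2_norm_eq_inner inner_add inner_commute l.add l.scaleR)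
           (simp add: power2_eq_square field_simps)
      then show ?thesis using ymin[of "y + t *\<^sub>R x"] by linarith
    qed
    have "d = 0"
    proof (rule ccontr)
      assume "d \<noteq> 0"
      \<comment> \<open>The variation t d + t^2 |x|^2 / 2 is lowest at t = - d / |x|^2; adding 1 to
        the denominator covers x = 0 and keeps the value negative.\<close>
      define n where "n = (norm x)\<^sup>2 + 1"
      have n: "n > 0" unfolding n_def by (simp add: add_nonneg_pos)
      have "0 \<le> (- d / n) * d + (- d / n)\<^sup>2 * (norm x)\<^sup>2 / 2" by (rule q)
      also have "\<dots> \<le> (- d / n) * d + (- d / n)\<^sup>2 * n / 2"
        unfolding n_def by (intro add_left_mono divide_right_mono mult_left_mono) auto
      also have "\<dots> = - (d\<^sup>2 / (2 * n))" using n by (simp add: field_simps power2_eq_square)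
      also have "\<dots> < 0" using n \<open>d \<noteq> 0\<close> by simp
      finally show False by simp
    qed
    then show ?thesis by (simp add: d_def)
  qed
  then show ?thesis by blast
qed

text \<open>Builds an operator from its real matrix coefficients. It yields both the limit of a
  Cauchy sequence of operators and the weak integral behind \<open>hp\<close>.\<close>

lemma bounded_bilinear_form_operator:
  fixes B :: "'h::{real_inner,complete_space} \<Rightarrow> 'h \<Rightarrow> real"
  assumes lin1: "\<And>y. linear (\<lambda>x. B x y)" and lin2: "\<And>x. linear (B x)"
    and bnd: "\<And>x y. \<bar>B x y\<bar> \<le> K * norm x * norm y"
  shows "\<exists>S :: 'h \<Rightarrow>\<^sub>L 'h. \<forall>x y. inner (blinfun_apply S x) y = B x y"
proof -
  have "\<exists>s. \<forall>y. B x y = inner y s" for x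
  proof (rule riesz_representation)
    show "bounded_linear (B x)"
      using bnd[of x] lin2[of x]
      by (intro bounded_linear_intro[where K = "K * norm x"])
         (auto simp: linear_add linear_scale mult_ac)
  qed
  then obtain s where s: "\<And>x y. B x y = inner y (s x)" by metis
  have "bounded_linear s"
  proof (rule bounded_linear_intro[where K = K])
    show "s (x + x') = s x + s x'" for x x'
    proof -
      have "inner y (s (x + x')) = inner y (s x + s x')" for y
        using linear_add[OF lin1[of y], of x x'] by (simp add: s inner_add)
      then show ?thesis by (metis vector_eq_rdot inner_commute)
    qed
    show "s (r *\<^sub>R x) = r *\<^sub>R s x" for r x
    proof -
      have "inner y (s (r *\<^sub>R x)) = inner y (r *\<^sub>R s x)" for y
        using linear_scale[OF lin1[of y], of r x] by (simp add: s)
      then show ?thesis by (metis vector_eq_rdot inner_commute)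
    qed
    show "norm (s x) \<le> norm x * K" for x
    proof (cases "s x = 0")
      case True
      have "0 \<le> K * norm x * norm x" using bnd[of x x] by (smt (verit))
      then have "0 \<le> norm x * K"
        by (metis mult.commute mult_eq_0_iff norm_ge_zero zero_le_mult_iff order.refl)
      then show ?thesis using True by simp
    next
      case False
      have "norm (s x) * norm (s x) \<le> (K * norm x) * norm (s x)"
        using bnd[of x "s x"] by (simp add: s dot_square_norm power2_eq_square)
      then show ?thesis using False by (simp add: mult.commute)
    qed
  qed
  then show ?thesis
    by (intro exI[of _ "Blinfun s"]) (simp add: bounded_linear_Blinfun_apply s inner_commute)
qed

lemma norm_blinfun_le_of_inner:
  fixes S :: "'h::real_inner \<Rightarrow>\<^sub>L 'h"
  assumes "K \<ge> 0" and "\<And>x y. \<bar>inner (blinfun_apply S x) y\<bar> \<le> K * norm x * norm y"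
  shows "norm S \<le> K"
proof (rule norm_blinfun_bound[OF assms(1)])
  fix x
  show "norm (blinfun_apply S x) \<le> K * norm x"
  proof (cases "blinfun_apply S x = 0")
    case False
    have "norm (S x) * norm (S x) \<le> (K * norm x) * norm (S x)"
      using assms(2)[of x "S x"] by (simp add: dot_square_norm power2_eq_square)
    then show ?thesis using False by simp
  qed (use assms(1) in simp)
qed

lemma inner_blinfun_le:
  fixes S :: "'h::real_inner \<Rightarrow>\<^sub>L 'h"
  shows "\<bar>inner (blinfun_apply S x) y\<bar> \<le> norm S * norm x * norm y"
  using Cauchy_Schwarz_ineq2[of "S x" y] norm_blinfun[of S x]
  by (meson mult_right_mono norm_ge_zero order_trans)

text \<open>By homogeneity \<open>x\<close> and \<open>y\<close> may be normalised to length 1,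
  where the mean of the squares equals the product of the norms. The key estimate delivers its bound
  in this additive form.\<close>

lemma norm_blinfun_le_of_quadratic:
  fixes S :: "'h::real_inner \<Rightarrow>\<^sub>L 'h"
  assumes K: "K \<ge> 0" and q: "\<And>x y. inner (blinfun_apply S x) y \<le> K * ((norm x)\<^sup>2 + (norm y)\<^sup>2) / 2"
  shows "norm S \<le> K"
proof (rule norm_blinfun_le_of_inner[OF K])
  have main: "inner (S x) y \<le> K * norm x * norm y" for x y
  proof (cases "x = 0 \<or> y = 0")
    case False
    then have n: "norm x > 0" "norm y > 0" by auto
    have "inner (S x) y / (norm x * norm y) = inner (S ((1 / norm x) *\<^sub>R x)) ((1 / norm y) *\<^sub>R y)"
      by (simp add: blinfun.scaleR_right divide_inverse mult_ac)
    also have "\<dots> \<le> K * ((norm ((1 / norm x) *\<^sub>R x))\<^sup>2 + (norm ((1 / norm y) *\<^sub>R y))\<^sup>2) / 2"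
      by (rule q)
    also have "\<dots> = K" using n by simp
    finally show ?thesis using n by (simp add: divide_le_eq mult_ac)
  qed auto
  show "\<bar>inner (S x) y\<bar> \<le> K * norm x * norm y" for x y
    using main[of x y] main[of "-x" y] by (simp add: blinfun.minus_right abs_le_iff)
qed

text \<open>The vector \<open>S\<^sup>* y\<close>, obtained from Riesz representation for one
  \<open>y\<close> at a time together with its norm bound.\<close>

lemma blinfun_adjoint_exists:
  fixes S :: "'h::{real_inner,complete_space} \<Rightarrow>\<^sub>L 'h"
  shows "\<exists>z. (\<forall>x. inner (blinfun_apply S x) y = inner x z) \<and> norm z \<le> norm S * norm y"
proof -
  have "bounded_linear (\<lambda>x. inner (S x) y)"
    by (intro bounded_linear_intros)
  from riesz_representation[OF this] obtain z where z: "\<And>x. inner (S x) y = inner x z" by blast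
  have "norm z * norm z \<le> (norm S * norm y) * norm z"
    using inner_blinfun_le[of S z y] z[of z]
    by (simp add: dot_square_norm power2_eq_square mult_ac)
  then have "norm z \<le> norm S * norm y"
    by (cases "z = 0") auto
  then show ?thesis using z by blast
qed

text \<open>The sort \<open>{real_inner,complete_space}\<close> is not an instance of \<open>banach\<close>, so the limit is built weakly.\<close>

lemma blinfun_Cauchy_limit:
  fixes S :: "nat \<Rightarrow> 'h::{real_inner,complete_space} \<Rightarrow>\<^sub>L 'h"
  assumes e: "e \<longlonglongrightarrow> 0" and S: "\<And>i j. i \<le> j \<Longrightarrow> norm (S i - S j) \<le> e i"
  shows "\<exists>L. \<forall>i. norm (S i - L) \<le> e i"
proof -
  have d: "\<bar>inner (S i x) y - inner (S j x) y\<bar> \<le> e i * norm x * norm y" if "i \<le> j" for i j x y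
  proof -
    have "\<bar>inner (S i x) y - inner (S j x) y\<bar> = \<bar>inner ((S i - S j) x) y\<bar>"
      by (simp add: blinfun.diff_left inner_diff_left)
    also have "\<dots> \<le> norm (S i - S j) * norm x * norm y" by (rule inner_blinfun_le)
    also have "\<dots> \<le> e i * norm x * norm y"
      using S[OF that] by (intro mult_right_mono) auto
    finally show ?thesis .
  qed
  have "Cauchy (\<lambda>i. inner (S i x) y)" for x y
  proof (rule metric_CauchyI)
    fix r :: real assume r: "r > 0"
    have "(\<lambda>i. e i * norm x * norm y) \<longlonglongrightarrow> 0 * norm x * norm y"
      by (intro tendsto_intros e)
    then have "\<forall>\<^sub>F i in sequentially. e i * norm x * norm y < r / 2"
      using r by (intro order_tendstoD(2)[where y = "0"]) auto
    then obtain N where N: "e N * norm x * norm y < r / 2"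
      by (auto simp: eventually_sequentially)
    have "dist (inner (S i x) y) (inner (S j x) y) < r" if "i \<ge> N" "j \<ge> N" for i j
      using d[OF that(1), of x y] d[OF that(2), of x y] N unfolding dist_real_def by linarith
    then show "\<exists>M. \<forall>i\<ge>M. \<forall>j\<ge>M. dist (inner (S i x) y) (inner (S j x) y) < r" by blast
  qed
  then obtain B where B: "\<And>x y. (\<lambda>i. inner (S i x) y) \<longlonglongrightarrow> B x y"
    unfolding Cauchy_convergent_iff convergent_def by metis
  have dB: "\<bar>inner (S i x) y - B x y\<bar> \<le> e i * norm x * norm y" for i x y
  proof (rule tendsto_upperbound)
    show "(\<lambda>j. \<bar>inner (S i x) y - inner (S j x) y\<bar>) \<longlonglongrightarrow> \<bar>inner (S i x) y - B x y\<bar>"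
      by (intro tendsto_intros B)
    show "\<forall>\<^sub>F j in sequentially. \<bar>inner (S i x) y - inner (S j x) y\<bar> \<le> e i * norm x * norm y"
      using eventually_ge_at_top[of i] by eventually_elim (rule d)
  qed simp
  have "\<exists>L :: 'h \<Rightarrow>\<^sub>L 'h. \<forall>x y. inner (blinfun_apply L x) y = B x y"
  proof (rule bounded_bilinear_form_operator[where K = "norm (S 0) + e 0"])
    show "linear (\<lambda>x. B x y)" for y
    proof (rule linearI)
      show "B (x + x') y = B x y + B x' y" for x x'
        using tendsto_add[OF B[of x y] B[of x' y]] B[of "x + x'" y]
        by (intro LIMSEQ_unique[of "\<lambda>i. inner (S i (x + x')) y"]) (auto simp: blinfun.add_right inner_add_left)
      show "B (r *\<^sub>R x) y = r *\<^sub>R B x y" for r x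
        using tendsto_mult_left[OF B[of x y], of r] B[of "r *\<^sub>R x" y]
        by (intro LIMSEQ_unique[of "\<lambda>i. inner (S i (r *\<^sub>R x)) y"]) (auto simp: blinfun.scaleR_right)
    qed
    show "linear (B x)" for x
    proof (rule linearI)
      show "B x (y + y') = B x y + B x y'" for y y'
        using tendsto_add[OF B[of x y] B[of x y']] B[of x "y + y'"]
        by (intro LIMSEQ_unique[of "\<lambda>i. inner (S i x) (y + y')"]) (auto simp: inner_add_right)
      show "B x (r *\<^sub>R y) = r *\<^sub>R B x y" for r y
        using tendsto_mult_left[OF B[of x y], of r] B[of x "r *\<^sub>R y"]
        by (intro LIMSEQ_unique[of "\<lambda>i. inner (S i x) (r *\<^sub>R y)"]) auto
    qed
    show "\<bar>B x y\<bar> \<le> (norm (S 0) + e 0) * norm x * norm y" for x y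
      using dB[of 0 x y] inner_blinfun_le[of "S 0" x y] by (simp add: distrib_right)
  qed
  then obtain L :: "'h \<Rightarrow>\<^sub>L 'h" where L: "\<And>x y. inner (blinfun_apply L x) y = B x y" by blast
  have "norm (S i - L) \<le> e i" for i
  proof (rule norm_blinfun_le_of_inner)
    show "0 \<le> e i" using S[of i i] by simp
    show "\<bar>inner ((S i - L) x) y\<bar> \<le> e i * norm x * norm y" for x y
      using dB[of i x y] by (simp add: blinfun.diff_left inner_diff_left L)
  qed
  then show ?thesis by blast
qed

section \<open>The complex inner product and scalar multiplication on a real Hilbert space with
  \<open>J\<close>\<close>

lemma complex_eqI_Re_mult: "(\<And>a. Re (a * u) = Re (a * v)) \<Longrightarrow> u = v"
proof -
  assume *: "\<And>a. Re (a * u) = Re (a * v)"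
  from *[of 1] *[of \<i>] show "u = v" by (simp add: complex_eq_iff)
qed

text \<open>Because \<open>inner (J x) y = - inner x (J y)\<close>, the imaginary part is
  \<open>inner x (J y)\<close>. The form is complex-linear in the first argument and
  conjugate-linear in the second.\<close>

definition cinner :: "('h::real_inner \<Rightarrow> 'h) \<Rightarrow> 'h \<Rightarrow> 'h \<Rightarrow> complex" where
  "cinner J x y = Complex (inner x y) (- inner (J x) y)"

locale cplx_hilbert =
  fixes J :: "'h::{real_inner,complete_space} \<Rightarrow> 'h"
  assumes J: "cplx_struct J"
begin

sublocale J: bounded_linear J
  using J by (simp add: cplx_struct_def)

lemma J_J [simp]: "J (J x) = - x"
  and inner_J_J [simp]: "inner (J x) (J y) = inner x y"
  using J by (simp_all add: cplx_struct_def)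

lemma norm_J [simp]: "norm (J x) = norm x"
  by (simp add: norm_eq_sqrt_inner)

lemma inner_J_swap: "inner (J x) y = - inner x (J y)"
  by (metis J_J inner_J_J inner_minus_left)

lemma inner_J_self [simp]: "inner (J x) x = 0" "inner x (J x) = 0"
  using inner_J_swap[of x x] by (auto simp: inner_commute)

text \<open>The bridge between the two scalar fields: complex identities reduce to real inner
  products after multiplication by an arbitrary \<open>a\<close>, by
  \<open>complex_eqI_Re_mult\<close>.\<close>

lemma Re_mult_cinner: "Re (a * cinner J x y) = inner (cscale J a x) y"
  by (simp add: cinner_def cscale_def inner_add_left)

lemma cscale_cscale: "cscale J a (cscale J b x) = cscale J (a * b) x"
  by (simp add: cscale_def J.add J.scaleR scaleR_add_right scaleR_add_left algebra_simps)

lemma cscale_add_left: "cscale J (a + b) x = cscale J a x + cscale J b x"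
  by (simp add: cscale_def scaleR_add_left)

lemma cscale_add_right: "cscale J a (x + y) = cscale J a x + cscale J a y"
  by (simp add: cscale_def J.add scaleR_add_right)

lemma norm_cscale: "norm (cscale J a x) = norm a * norm x"
proof -
  have "(norm (cscale J a x))\<^sup>2 = (norm a * norm x)\<^sup>2"
    unfolding power_mult_distrib cmod_power2
    by (simp add: cscale_def power2_norm_eq_inner inner_add inner_commute)
       (simp add: power2_eq_square algebra_simps)
  then show ?thesis by (simp add: power2_eq_iff_nonneg)
qed

lemma bounded_linear_cscale: "bounded_linear (cscale J a)"
  by (rule bounded_linear_intro[where K = "norm a"])
     (simp_all add: cscale_add_right norm_cscale mult.commute, simp add: cscale_def J.scaleR scaleR_add_right mult.commute)

lemma cinner_cscale: "cinner J (cscale J a x) y = a * cinner J x y"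
  by (rule complex_eqI_Re_mult) (simp only: Re_mult_cinner cscale_cscale flip: mult.assoc)

lemma cinner_add: "cinner J (x + x') y = cinner J x y + cinner J x' y"
  "cinner J x (y + y') = cinner J x y + cinner J x y'"
  by (simp_all add: cinner_def complex_eq_iff J.add inner_add)

lemma cinner_scaleR: "cinner J (r *\<^sub>R x) y = r *\<^sub>R cinner J x y"
  "cinner J x (r *\<^sub>R y) = r *\<^sub>R cinner J x y"
  by (simp_all add: cinner_def complex_eq_iff J.scaleR)

lemma cinner_J: "cinner J (J x) y = \<i> * cinner J x y"
  using cinner_cscale[of \<i> x y] by (simp add: cscale_def)

lemma norm_cinner_le: "norm (cinner J x y) \<le> norm x * norm y"
proof (cases "cinner J x y = 0")
  case False
  \<comment> \<open>Multiplying \<open>x\<close> by this scalar makes the pairing real and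
    nonnegative, so that the real Cauchy-Schwarz inequality applies.\<close>
  define a where "a = cnj (cinner J x y)"
  have "norm (cinner J x y) * norm (cinner J x y) = Re (a * cinner J x y)"
    unfolding a_def by (metis cmod_power2 complex_norm_square mult.commute power2_eq_square Re_complex_of_real of_real_mult)
  also have "\<dots> \<le> norm (cscale J a x) * norm y"
    unfolding Re_mult_cinner by (rule norm_cauchy_schwarz)
  also have "\<dots> = norm (cinner J x y) * (norm x * norm y)"
    by (simp add: norm_cscale a_def)
  finally show ?thesis using False by simp
qed simp

lemma inner_cscale_right: "inner x (cscale J a y) = inner (cscale J (cnj a) x) y"
  by (simp add: cscale_def inner_add inner_diff inner_J_swap[of x y])

lemma BH_cscale: "S \<in> BH J \<Longrightarrow> blinfun_apply S (cscale J a x) = cscale J a (blinfun_apply S x)"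
  by (simp add: BH_def cscale_def blinfun.add_right blinfun.scaleR_right)

lemma BH_eqI:
  assumes "\<And>x y. cinner J (blinfun_apply S x) y = cinner J (blinfun_apply S' x) y"
  shows "S = S'"
proof (rule blinfun_eqI)
  fix x
  have "inner (S x) y = inner (S' x) y" for y
    using assms[of x y] by (simp add: cinner_def)
  then show "S x = S' x" by (metis vector_eq_rdot inner_commute)
qed

end

section \<open>Trigonometric polynomials\<close>

lemma cis_integral:
  "integral {-pi..pi} (\<lambda>t. cis (of_int k * t)) = (if k = 0 then 2 * pi else 0)"
proof (cases "k = 0")
  case False
  have "((\<lambda>t. cis (of_int k * t)) has_integral
      (cis (of_int k * pi) / (\<i> * of_int k) - cis (of_int k * (-pi)) / (\<i> * of_int k))) {-pi..pi}"
    using False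
    by (intro fundamental_theorem_of_calculus)
       (auto intro!: derivative_eq_intros has_vector_derivative_real_field
          simp: has_real_derivative_iff_has_vector_derivative[symmetric] cis_conv_exp
            of_real_def[symmetric] field_simps)
  moreover have "cis (of_int k * pi) = cis (of_int k * (-pi))"
    using sin_zero_iff_int2 by (auto simp: complex_eq_iff)
  ultimately show ?thesis using False by (simp add: integral_unique)
qed (simp add: scaleR_conv_of_real)

lemma continuous_on_poly_cis [continuous_intros]:
  "continuous_on S (\<lambda>t. poly p (cis t))"
  by (intro continuous_intros)

context cplx_hilbert
begin

lemma continuous_on_cscale [continuous_intros]:
  "continuous_on S a \<Longrightarrow> continuous_on S f \<Longrightarrow> continuous_on S (\<lambda>t. cscale J (a t) (f t))"
  unfolding cscale_def by (intro continuous_intros J.continuous_on)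

lemma inner_cscale_cis:
  "inner (cscale J (cis (- (real k * t))) x) (cscale J (cis (- (real l * t))) y)
     = Re (cis (of_int (int l - int k) * t) * cinner J x y)"
  by (simp only: inner_cscale_right cscale_cscale Re_mult_cinner cis_cnj cis_mult)
     (simp add: algebra_simps)

text \<open>Expanding the square, \<open>cis_integral\<close> removes every cross term. The
  coefficients are vectors, because the orbit points \<open>T\<^sub>k x\<close> will be the
  coefficients.\<close>

lemma parseval:
  fixes a :: "nat \<Rightarrow> 'h"
  shows "integral {-pi..pi} (\<lambda>t. (norm (\<Sum>k<n. cscale J (cis (- (real k * t))) (a k)))\<^sup>2)
    = 2 * pi * (\<Sum>k<n. (norm (a k))\<^sup>2)"
proof -
  have "integral {-pi..pi} (\<lambda>t. (norm (\<Sum>k<n. cscale J (cis (- (real k * t))) (a k)))\<^sup>2)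
    = integral {-pi..pi} (\<lambda>t. \<Sum>k<n. \<Sum>l<n. Re (cis (of_int (int l - int k) * t) * cinner J (a k) (a l)))"
    by (simp only: power2_norm_eq_inner inner_sum_left inner_sum_right inner_cscale_cis)
       (subst sum.swap, rule refl)
  also have "\<dots> = (\<Sum>k<n. \<Sum>l<n. integral {-pi..pi} (\<lambda>t. Re (cis (of_int (int l - int k) * t) * cinner J (a k) (a l))))"
    by (subst integral_sum, simp, intro integrable_continuous_real continuous_intros,
        intro sum.cong refl, subst integral_sum, simp, intro integrable_continuous_real continuous_intros)
       simp
  also have "\<dots> = (\<Sum>k<n. \<Sum>l<n. if k = l then 2 * pi * (norm (a k))\<^sup>2 else 0)"
  proof (intro sum.cong refl)
    fix k l
    have int: "(\<lambda>t. cis (of_int (int l - int k) * t)) integrable_on {-pi..pi}"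
      by (intro integrable_continuous_real continuous_intros)
    have "integral {-pi..pi} (\<lambda>t. Re (cis (of_int (int l - int k) * t) * cinner J (a k) (a l)))
      = Re (integral {-pi..pi} (\<lambda>t. cis (of_int (int l - int k) * t) * cinner J (a k) (a l)))"
      by (rule integral_linear[OF integrable_on_mult_left[OF int] bounded_linear_Re, unfolded o_def])
    also have "\<dots> = Re (integral {-pi..pi} (\<lambda>t. cis (of_int (int l - int k) * t)) * cinner J (a k) (a l))"
      by (simp only: integral_mult_left)
    also have "\<dots> = (if k = l then 2 * pi * (norm (a k))\<^sup>2 else 0)"
      unfolding cis_integral by (auto simp: cinner_def power2_norm_eq_inner)
    finally show "integral {-pi..pi} (\<lambda>t. Re (cis (of_int (int l - int k) * t) * cinner J (a k) (a l)))
      = (if k = l then 2 * pi * (norm (a k))\<^sup>2 else 0)" .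
  qed
  also have "\<dots> = 2 * pi * (\<Sum>k<n. (norm (a k))\<^sup>2)"
    by (simp add: sum_distrib_left)
  finally show ?thesis .
qed

end

text \<open>The scalars are themselves an instance of \<open>cplx_hilbert\<close>, with
  multiplication by i as \<open>J\<close>. Conjugation preserves the modulus and turns the
  frequencies k of \<open>poly p (cis t)\<close> into the frequencies - k of
  \<open>parseval\<close>.\<close>

lemma parseval_poly:
  fixes p :: "complex poly"
  assumes "\<And>k. k \<ge> n \<Longrightarrow> coeff p k = 0"
  shows "integral {-pi..pi} (\<lambda>t. (norm (poly p (cis t)))\<^sup>2) = 2 * pi * (\<Sum>k<n. (norm (coeff p k))\<^sup>2)"
proof -
  interpret cplx_hilbert "\<lambda>z :: complex. \<i> * z"
    by unfold_locales (auto simp: cplx_struct_def inner_complex_def bounded_linear_mult_right simp flip: mult.assoc)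
  have cs: "cscale (\<lambda>z :: complex. \<i> * z) a z = a * z" for a z
    by (simp add: cscale_def complex_eq_iff)
  have "norm (poly p (cis t)) = norm (\<Sum>k<n. cscale (\<lambda>z. \<i> * z) (cis (- (real k * t))) (cnj (coeff p k)))" for t
  proof -
    have "poly p (cis t) = (\<Sum>k<n. coeff p k * cis (real k * t))"
      unfolding poly_altdef Complex.DeMoivre
    proof (rule sum.mono_neutral_cong)
      show "coeff p i * cis (real i * t) = 0" if "i \<in> {..<n} - {..degree p}" for i
        using that by (simp add: coeff_eq_0)
      show "coeff p i * cis (real i * t) = 0" if "i \<in> {..degree p} - {..<n}" for i
        using that assms by simp
    qed auto
    then have "norm (poly p (cis t)) = norm (cnj (\<Sum>k<n. coeff p k * cis (real k * t)))"
      by (simp only: complex_mod_cnj)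
    also have "cnj (\<Sum>k<n. coeff p k * cis (real k * t)) = (\<Sum>k<n. cis (- (real k * t)) * cnj (coeff p k))"
      by (simp add: cis_cnj[symmetric] mult.commute)
    finally show ?thesis by (simp add: cs)
  qed
  then show ?thesis using parseval[where n = n and a = "\<lambda>k. cnj (coeff p k)"] by simp
qed

section \<open>The Wiener norm of polynomials and uniform approximation on the circle\<close>

definition coeff_l1 :: "complex poly \<Rightarrow> real" where
  "coeff_l1 p = (\<Sum>k\<le>degree p. norm (coeff p k))"

lemma coeff_l1_eq:
  assumes "degree p \<le> n"
  shows "coeff_l1 p = (\<Sum>k\<le>n. norm (coeff p k))"
  unfolding coeff_l1_def
  by (rule sum.mono_neutral_left) (use assms in \<open>auto simp: coeff_eq_0\<close>)

lemma coeff_l1_nonneg [simp]: "0 \<le> coeff_l1 p"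
  by (simp add: coeff_l1_def sum_nonneg)

lemma coeff_l1_add: "coeff_l1 (p + q) \<le> coeff_l1 p + coeff_l1 q"
proof -
  define n where "n = max (degree p) (degree q)"
  have "coeff_l1 (p + q) = (\<Sum>k\<le>n. norm (coeff p k + coeff q k))"
    by (subst coeff_l1_eq[of _ n]) (auto simp: n_def degree_add_le_max)
  also have "\<dots> \<le> (\<Sum>k\<le>n. norm (coeff p k) + norm (coeff q k))"
    by (intro sum_mono norm_triangle_ineq)
  also have "\<dots> = coeff_l1 p + coeff_l1 q"
    by (simp add: sum.distrib coeff_l1_eq[of p n] coeff_l1_eq[of q n] n_def)
  finally show ?thesis .
qed

lemma coeff_l1_smult: "coeff_l1 (smult c p) = norm c * coeff_l1 p"
  by (subst coeff_l1_eq[of _ "degree p"]) (auto simp: coeff_l1_def norm_mult sum_distrib_left degree_smult_le)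

lemma coeff_l1_pCons: "coeff_l1 (pCons a p) = norm a + coeff_l1 p"
  by (subst coeff_l1_eq[of _ "Suc (degree p)"])
     (simp_all add: coeff_l1_def degree_pCons_le sum.atMost_Suc_shift del: sum.atMost_Suc)

lemma coeff_l1_0 [simp]: "coeff_l1 0 = 0"
  by (simp add: coeff_l1_def)

lemma coeff_l1_mult: "coeff_l1 (p * q) \<le> coeff_l1 p * coeff_l1 q"
proof (induction p)
  case (pCons a p)
  have "coeff_l1 (pCons a p * q) \<le> coeff_l1 (smult a q) + coeff_l1 (pCons 0 (p * q))"
    by (simp add: coeff_l1_add)
  also have "\<dots> \<le> norm a * coeff_l1 q + coeff_l1 p * coeff_l1 q"
    using pCons by (simp add: coeff_l1_smult coeff_l1_pCons)
  finally show ?case by (simp add: coeff_l1_pCons distrib_right)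
qed simp

text \<open>A power near 1 is compared with the same power of real numbers, because the coefficient
  norm is subadditive and submultiplicative. It measures how far (1 + g/N)^N (1 - g/N)^N is from 1
  in \<open>approx_factorization\<close>.\<close>

lemma coeff_l1_power_minus_1:
  "coeff_l1 ((1 + h) ^ n - 1) \<le> (1 + coeff_l1 h) ^ n - 1"
proof (induction n)
  case (Suc n)
  have one: "coeff_l1 1 = 1" by (simp add: coeff_l1_def)
  have "(1 + h) ^ Suc n - 1 = (1 + h) * ((1 + h) ^ n - 1) + h"
    by (simp add: algebra_simps)
  also have "coeff_l1 \<dots> \<le> coeff_l1 ((1 + h) * ((1 + h) ^ n - 1)) + coeff_l1 h"
    by (rule coeff_l1_add)
  also have "coeff_l1 ((1 + h) * ((1 + h) ^ n - 1)) \<le> coeff_l1 (1 + h) * coeff_l1 ((1 + h) ^ n - 1)"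
    by (rule coeff_l1_mult)
  also have "\<dots> \<le> (1 + coeff_l1 h) * ((1 + coeff_l1 h) ^ n - 1)"
    using coeff_l1_add[of 1 h] Suc one by (intro mult_mono) auto
  finally show ?case by (simp add: algebra_simps)
qed simp

lemma norm_poly_le_coeff_l1:
  assumes "norm z = 1"
  shows "norm (poly p z) \<le> coeff_l1 p"
  unfolding poly_altdef coeff_l1_def
  by (rule sum_norm_le) (simp add: norm_mult norm_power assms)

text \<open>Real polynomials in \<open>Re z\<close> and \<open>Im z\<close> restrict on the unit circle to real parts of
  holomorphic polynomials, because \<open>2 Re a Re b = Re (a b) + Re (a (cnj b))\<close> and \<open>cnj z = 1 / z\<close>.\<close>

lemma Re_monom_mult_circle:
  "\<exists>r. \<forall>z. norm z = 1 \<longrightarrow> Re (a * z ^ j) * Re (b * z ^ k) = Re (poly r z)"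
proof -
  \<comment> \<open>On the circle a z^j cnj (b z^k) has degree j - k. For j < k its conjugate is
    taken instead, which has degree k - j and the same real part.\<close>
  define q where "q = (if k \<le> j then monom (a * cnj b / 2) (j - k) else monom (cnj a * b / 2) (k - j))"
  have "Re (a * z ^ j) * Re (b * z ^ k) = Re (poly (monom (a * b / 2) (j + k) + q) z)"
    if z: "norm z = 1" for z
  proof -
    have zc: "z * cnj z = 1" using z by (simp add: complex_norm_square[symmetric])
    have 1: "Re u * Re v = (Re (u * v) + Re (u * cnj v)) / 2" for u v
      by simp
    have "Re (a * z ^ j * cnj (b * z ^ k)) / 2 = Re (poly q z)"
    proof (cases "k \<le> j")
      case True
      have "z ^ j * cnj (z ^ k) = z ^ (j - k) * (z * cnj z) ^ k"
        using True by (simp add: power_mult_distrib mult.assoc[symmetric] flip: power_add)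
      then have "a * z ^ j * cnj (b * z ^ k) / 2 = poly q z"
        using True zc by (simp add: q_def poly_monom mult_ac)
      then show ?thesis by (metis Re_divide_numeral)
    next
      case False
      have "cnj (z ^ j) * z ^ k = z ^ (k - j) * (z * cnj z) ^ j"
        using False by (simp add: power_mult_distrib mult_ac flip: power_add)
      then have "cnj (a * z ^ j * cnj (b * z ^ k)) / 2 = poly q z"
        using False zc by (simp add: q_def poly_monom mult_ac)
      then show ?thesis by (metis Re_divide_numeral cnj.sel(1))
    qed
    moreover have "Re (a * z ^ j * (b * z ^ k)) / 2 = Re (poly (monom (a * b / 2) (j + k)) z)"
      by (simp add: poly_monom power_add mult_ac flip: Re_divide_numeral)
    ultimately show ?thesis unfolding 1 by (simp add: add_divide_distrib)
  qed
  then show ?thesis by blast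
qed

lemma Re_poly_sum_circle:
  assumes "finite A" "\<And>i. i \<in> A \<Longrightarrow> \<exists>r. \<forall>z. norm z = 1 \<longrightarrow> f i z = Re (poly r z)"
  shows "\<exists>r. \<forall>z. norm z = 1 \<longrightarrow> (\<Sum>i\<in>A. f i z) = Re (poly r z)"
proof -
  obtain r where r: "\<And>i z. i \<in> A \<Longrightarrow> norm z = 1 \<Longrightarrow> f i z = Re (poly (r i) z)"
    using assms(2) by metis
  then show ?thesis
    by (intro exI[of _ "\<Sum>i\<in>A. r i"]) (simp add: poly_sum)
qed

lemma real_polynomial_function_circle:
  fixes g :: "complex \<Rightarrow> real"
  assumes "real_polynomial_function g"
  shows "\<exists>r. \<forall>z. norm z = 1 \<longrightarrow> g z = Re (poly r z)"
  using assms
proof induction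
  case (linear f)
  \<comment> \<open>A real-linear functional on the plane is the real part of multiplication by the
    complex number with real part f 1 and imaginary part - f i.\<close>
  have "f z = Re (poly [:0, Complex (f 1) (- f \<i>):] z)" for z
  proof -
    have "f z = f (Re z *\<^sub>R 1 + Im z *\<^sub>R \<i>)"
      by (metis complex_eq scaleR_conv_of_real mult.right_neutral mult.commute)
    also have "\<dots> = Re z * f 1 + Im z * f \<i>"
      using linear by (simp add: linear_simps)
    finally show ?thesis by simp
  qed
  then show ?case by blast
next
  case (const c)
  show ?case by (intro exI[of _ "[:of_real c:]"]) simp
next
  case (add f g)
  then obtain r s where "\<forall>z. norm z = 1 \<longrightarrow> f z = Re (poly r z)" "\<forall>z. norm z = 1 \<longrightarrow> g z = Re (poly s z)"
    by blast
  then show ?case by (intro exI[of _ "r + s"]) simp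
next
  case (mult f g)
  then obtain r s where rs: "\<And>z. norm z = 1 \<Longrightarrow> f z = Re (poly r z)" "\<And>z. norm z = 1 \<Longrightarrow> g z = Re (poly s z)"
    by blast
  have "\<exists>q. \<forall>z. norm z = 1 \<longrightarrow>
      (\<Sum>i\<le>degree r. \<Sum>j\<le>degree s. Re (coeff r i * z ^ i) * Re (coeff s j * z ^ j)) = Re (poly q z)"
    by (intro Re_poly_sum_circle Re_monom_mult_circle) auto
  moreover have "f z * g z = (\<Sum>i\<le>degree r. \<Sum>j\<le>degree s. Re (coeff r i * z ^ i) * Re (coeff s j * z ^ j))"
    if "norm z = 1" for z
    by (simp only: rs[OF that] poly_altdef Re_sum sum_product)
  ultimately show ?case by (metis (no_types, lifting))
qed

text \<open>Stone-Weierstrass for real polynomials in the plane. Applied to a logarithm it produces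
  the exponent of an approximate outer function, the polynomial taking the place of a harmonic
  conjugate.\<close>

lemma approx_Re_poly_circle:
  fixes u :: "complex \<Rightarrow> real"
  assumes "continuous_on {z. norm z = 1} u" "e > 0"
  shows "\<exists>r. \<forall>z. norm z = 1 \<longrightarrow> \<bar>u z - Re (poly r z)\<bar> < e"
proof -
  have "compact {z :: complex. norm z = 1}"
    using compact_sphere[of "0 :: complex" 1] by (simp add: sphere_def)
  from Stone_Weierstrass_real_polynomial_function[OF this assms]
  obtain g where g: "real_polynomial_function g" "\<And>x. norm x = 1 \<Longrightarrow> \<bar>u x - g x\<bar> < e"
    by auto
  from real_polynomial_function_circle[OF g(1)] g(2) show ?thesis by fastforce
qed

section \<open>Hankel forms\<close>

definition coeff_pairing :: "(nat \<Rightarrow> complex) \<Rightarrow> complex poly \<Rightarrow> complex" where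
  "coeff_pairing \<phi> p = (\<Sum>n\<le>degree p. coeff p n * \<phi> n)"

lemma coeff_pairing_eq:
  assumes "degree p \<le> n"
  shows "coeff_pairing \<phi> p = (\<Sum>k\<le>n. coeff p k * \<phi> k)"
  unfolding coeff_pairing_def
  by (rule sum.mono_neutral_left) (use assms in \<open>auto simp: coeff_eq_0\<close>)

lemma coeff_pairing_add: "coeff_pairing \<phi> (p + q) = coeff_pairing \<phi> p + coeff_pairing \<phi> q"
proof -
  define n where "n = max (degree p) (degree q)"
  have "degree (p + q) \<le> n" "degree p \<le> n" "degree q \<le> n"
    by (auto simp: n_def degree_add_le_max)
  then show ?thesis by (simp add: coeff_pairing_eq[of _ n] sum.distrib distrib_right)
qed

lemma coeff_pairing_smult: "coeff_pairing \<phi> (smult c p) = c * coeff_pairing \<phi> p"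
  by (subst coeff_pairing_eq[of _ "degree p"])
     (auto simp: coeff_pairing_def sum_distrib_left degree_smult_le mult_ac)

lemma coeff_pairing_pCons:
  "coeff_pairing \<phi> (pCons a p) = a * \<phi> 0 + coeff_pairing (\<lambda>n. \<phi> (Suc n)) p"
  by (subst coeff_pairing_eq[of _ "Suc (degree p)"])
     (simp_all add: coeff_pairing_def degree_pCons_le sum.atMost_Suc_shift del: sum.atMost_Suc)

text \<open>Coefficients of a product are convolutions, so the functional becomes a Hankel form: its
  kernel depends on m + k only, which is what the semigroup law can exploit.\<close>

lemma coeff_pairing_mult:
  "coeff_pairing \<phi> (p * q) = coeff_pairing (\<lambda>m. coeff_pairing (\<lambda>k. \<phi> (m + k)) q) p"
proof (induction p arbitrary: \<phi>)
  case 0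
  show ?case by (simp add: coeff_pairing_def)
next
  case (pCons a p)
  have "coeff_pairing \<phi> (pCons a p * q) = a * coeff_pairing \<phi> q + coeff_pairing (\<lambda>n. \<phi> (Suc n)) (p * q)"
    by (simp only: mult_pCons_left coeff_pairing_add coeff_pairing_smult coeff_pairing_pCons) simp
  then show ?case
    by (simp only: coeff_pairing_pCons pCons.IH add_0 add_Suc)
qed

lemma norm_coeff_pairing_le:
  assumes "\<And>n. norm (\<phi> n) \<le> K"
  shows "norm (coeff_pairing \<phi> p) \<le> K * coeff_l1 p"
proof -
  have "norm (coeff_pairing \<phi> p) \<le> (\<Sum>k\<le>degree p. norm (coeff p k) * K)"
    unfolding coeff_pairing_def
    by (rule sum_norm_le) (auto simp: norm_mult intro!: mult_left_mono assms)
  then show ?thesis by (simp add: coeff_l1_def sum_distrib_left mult.commute)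
qed

definition fcoeff :: "(real \<Rightarrow> complex) \<Rightarrow> nat \<Rightarrow> complex" where
  "fcoeff g n = integral {-pi..pi} (\<lambda>t. g t * cis (- (real n * t))) / (2 * pi)"

lemma norm_fcoeff_le:
  assumes g: "continuous_on {-pi..pi} g" and F: "\<And>t. norm (g t) \<le> F"
  shows "norm (fcoeff g n) \<le> F"
proof -
  have "norm (integral {-pi..pi} (\<lambda>t. g t * cis (- (real n * t)))) \<le> integral {-pi..pi} (\<lambda>t. F)"
    by (rule integral_norm_bound_integral)
       (auto intro!: integrable_continuous_real continuous_intros g simp: norm_mult F)
  then show ?thesis unfolding fcoeff_def by (simp add: norm_divide divide_le_eq mult_ac)
qed

abbreviation circ_mean :: "(real \<Rightarrow> real) \<Rightarrow> real" where
  "circ_mean u \<equiv> integral {-pi..pi} u / (2 * pi)"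

context cplx_hilbert
begin

text \<open>The Hankel form \<open>\<Sum> c (m + k) w m v k \<langle>S (m + k) x, y\<rangle>\<close> is the integral of
  \<open>g (t) \<langle>\<Sum> v k e\<^bsup>-ikt\<^esup> S k x, \<Sum> cnj (w m e\<^bsup>-imt\<^esup>) (S m)\<^sup>* y\<rangle>\<close>, to which Parseval applies.\<close>

lemma hankel_form_bound:
  fixes S :: "nat \<Rightarrow> 'h \<Rightarrow>\<^sub>L 'h" and w v :: "complex poly"
  assumes S: "\<And>n. S n \<in> BH J" "\<And>m k. S (m + k) = S m o\<^sub>L S k" "\<And>n. norm (S n) \<le> C"
    and g: "continuous_on {-pi..pi} g" "\<And>t. norm (g t) \<le> F"
  shows "Re (coeff_pairing (\<lambda>n. fcoeff g n * cinner J (S n x) y) (w * v))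
    \<le> F * C\<^sup>2 * (circ_mean (\<lambda>t. (norm (poly v (cis t)))\<^sup>2) * (norm x)\<^sup>2
              + circ_mean (\<lambda>t. (norm (poly w (cis t)))\<^sup>2) * (norm y)\<^sup>2) / 2"
proof -
  have C: "C \<ge> 0" using S(3)[of 0] norm_ge_zero order_trans by blast
  have F: "F \<ge> 0" using g(2)[of 0] norm_ge_zero order_trans by blast
  have "\<exists>z. \<forall>n. (\<forall>x. inner (S n x) y = inner x (z n)) \<and> norm (z n) \<le> norm (S n) * norm y"
    using blinfun_adjoint_exists[of "S _" y] by metis
  then obtain z where z: "\<And>n x. inner (S n x) y = inner x (z n)"
    and nz: "\<And>n. norm (z n) \<le> norm (S n) * norm y" by blast
  define a where "a = Suc (degree w)"
  define b where "b = Suc (degree v)"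
  define X where "X = (\<lambda>t. \<Sum>k<b. cscale J (cis (- (real k * t))) (cscale J (coeff v k) (S k x)))"
  \<comment> \<open>\<open>parseval\<close> is stated for the frequencies - m, while the pairing
    needs + m. \<open>Y\<close> is therefore evaluated at - t, a reflection that preserves the mean
    over the circle.\<close>
  define Y where "Y = (\<lambda>t. \<Sum>m<a. cscale J (cis (- (real m * t))) (cscale J (cnj (coeff w m)) (z m)))"
  let ?\<Theta> = "\<lambda>n. cinner J (S n x) y"
  have contX: "continuous_on {-pi..pi} X" unfolding X_def by (intro continuous_intros)
  have contY: "continuous_on {-pi..pi} Y" unfolding Y_def by (intro continuous_intros)
  have contYm: "continuous_on {-pi..pi} (\<lambda>t. Y (-t))" unfolding Y_def by (intro continuous_intros)
  have meanX: "circ_mean (\<lambda>t. (norm (X t))\<^sup>2) \<le> C\<^sup>2 * circ_mean (\<lambda>t. (norm (poly v (cis t)))\<^sup>2) * (norm x)\<^sup>2"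
  proof -
    have "circ_mean (\<lambda>t. (norm (X t))\<^sup>2) = (\<Sum>k<b. (norm (cscale J (coeff v k) (S k x)))\<^sup>2)"
      unfolding X_def parseval by simp
    also have "\<dots> \<le> (\<Sum>k<b. (norm (coeff v k) * (C * norm x))\<^sup>2)"
      unfolding norm_cscale
      by (intro sum_mono power_mono mult_left_mono order_trans[OF norm_blinfun] mult_right_mono S) auto
    also have "\<dots> = C\<^sup>2 * circ_mean (\<lambda>t. (norm (poly v (cis t)))\<^sup>2) * (norm x)\<^sup>2"
    proof -
      have "integral {-pi..pi} (\<lambda>t. (norm (poly v (cis t)))\<^sup>2) = 2 * pi * (\<Sum>k<b. (norm (coeff v k))\<^sup>2)"
        by (rule parseval_poly) (simp add: b_def coeff_eq_0)
      then have "circ_mean (\<lambda>t. (norm (poly v (cis t)))\<^sup>2) = (\<Sum>k<b. (norm (coeff v k))\<^sup>2)" by simp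
      then show ?thesis by (simp only: power_mult_distrib sum_distrib_left sum_distrib_right mult_ac)
    qed
    finally show ?thesis .
  qed
  have "circ_mean (\<lambda>t. (norm (Y (-t)))\<^sup>2) = circ_mean (\<lambda>t. (norm (Y t))\<^sup>2)"
    using Henstock_Kurzweil_Integration.integral_reflect_real[of pi "-pi" "\<lambda>t. (norm (Y t))\<^sup>2"] by simp
  also have "\<dots> \<le> C\<^sup>2 * circ_mean (\<lambda>t. (norm (poly w (cis t)))\<^sup>2) * (norm y)\<^sup>2"
  proof -
    have "circ_mean (\<lambda>t. (norm (Y t))\<^sup>2) = (\<Sum>k<a. (norm (cscale J (cnj (coeff w k)) (z k)))\<^sup>2)"
      unfolding Y_def parseval by simp
    also have "\<dots> \<le> (\<Sum>k<a. (norm (coeff w k) * (C * norm y))\<^sup>2)"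
      unfolding norm_cscale complex_mod_cnj
      by (intro sum_mono power_mono mult_left_mono order_trans[OF nz] mult_right_mono S) auto
    also have "\<dots> = C\<^sup>2 * circ_mean (\<lambda>t. (norm (poly w (cis t)))\<^sup>2) * (norm y)\<^sup>2"
    proof -
      have "integral {-pi..pi} (\<lambda>t. (norm (poly w (cis t)))\<^sup>2) = 2 * pi * (\<Sum>k<a. (norm (coeff w k))\<^sup>2)"
        by (rule parseval_poly) (simp add: a_def coeff_eq_0)
      then have "circ_mean (\<lambda>t. (norm (poly w (cis t)))\<^sup>2) = (\<Sum>k<a. (norm (coeff w k))\<^sup>2)" by simp
      then show ?thesis by (simp only: power_mult_distrib sum_distrib_left sum_distrib_right mult_ac)
    qed
    finally show ?thesis .
  qed
  finally have meanY: "circ_mean (\<lambda>t. (norm (Y (-t)))\<^sup>2) \<le> C\<^sup>2 * circ_mean (\<lambda>t. (norm (poly w (cis t)))\<^sup>2) * (norm y)\<^sup>2" .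
  have expand: "inner (cscale J (g t) (X t)) (Y (-t))
      = (\<Sum>m<a. \<Sum>k<b. Re (g t * cis (- (real (m + k) * t)) * (coeff w m * coeff v k * ?\<Theta> (m + k))))" for t
  proof -
    have "inner (cscale J (g t) (cscale J (cis (- (real k * t))) (cscale J (coeff v k) (S k x))))
         (cscale J (cis (- (real m * (-t)))) (cscale J (cnj (coeff w m)) (z m)))
        = Re (g t * cis (- (real (m + k) * t)) * (coeff w m * coeff v k * ?\<Theta> (m + k)))" for m k
    proof -
      define \<alpha> where "\<alpha> = coeff w m * cis (- (real m * t)) * (g t * (cis (- (real k * t)) * coeff v k))"
      have "inner (cscale J (g t) (cscale J (cis (- (real k * t))) (cscale J (coeff v k) (S k x))))
           (cscale J (cis (- (real m * (-t)))) (cscale J (cnj (coeff w m)) (z m)))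
          = inner (cscale J \<alpha> (S k x)) (z m)"
        unfolding \<alpha>_def by (simp add: inner_cscale_right cscale_cscale cis_cnj mult_ac)
      also have "\<dots> = Re (\<alpha> * ?\<Theta> (m + k))"
        by (simp only: z[symmetric] BH_cscale[OF S(1)] Re_mult_cinner S(2) blinfun_apply_blinfun_compose)
      also have "\<alpha> = g t * cis (- (real (m + k) * t)) * (coeff w m * coeff v k)"
      proof -
        have "cis (- (real (m + k) * t)) = cis (- (real m * t)) * cis (- (real k * t))"
          by (simp add: cis_mult algebra_simps)
        then show ?thesis unfolding \<alpha>_def by (simp only: mult_ac)
      qed
      finally show ?thesis by (simp add: mult.assoc)
    qed
    then show ?thesis
      unfolding X_def Y_def
      by (simp only: linear_sum[OF bounded_linear.linear[OF bounded_linear_cscale]]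
          inner_sum_left inner_sum_right)
  qed
  have int1: "(\<lambda>t. g t * cis (- (real n * t)) * d) integrable_on {-pi..pi}" for n d
    by (intro integrable_continuous_real continuous_intros g)
  have "integral {-pi..pi} (\<lambda>t. inner (cscale J (g t) (X t)) (Y (-t)))
    = (\<Sum>m<a. \<Sum>k<b. integral {-pi..pi} (\<lambda>t. Re (g t * cis (- (real (m + k) * t)) * (coeff w m * coeff v k * ?\<Theta> (m + k)))))"
    unfolding expand
    by (subst integral_sum, simp, intro integrable_continuous_real continuous_intros g,
        intro sum.cong refl, subst integral_sum, simp, intro integrable_continuous_real continuous_intros g)
       simp
  also have "\<dots> = (\<Sum>m<a. \<Sum>k<b. 2 * pi * Re (coeff w m * (coeff v k * (fcoeff g (m + k) * ?\<Theta> (m + k)))))"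
  proof (intro sum.cong refl)
    fix m k
    have "integral {-pi..pi} (\<lambda>t. Re (g t * cis (- (real (m + k) * t)) * (coeff w m * coeff v k * ?\<Theta> (m + k))))
      = Re (integral {-pi..pi} (\<lambda>t. g t * cis (- (real (m + k) * t)) * (coeff w m * coeff v k * ?\<Theta> (m + k))))"
      by (rule integral_linear[OF int1 bounded_linear_Re, unfolded o_def])
    also have "\<dots> = Re ((2 * pi) *\<^sub>R (coeff w m * (coeff v k * (fcoeff g (m + k) * ?\<Theta> (m + k)))))"
      by (simp only: integral_mult_left) (simp add: fcoeff_def scaleR_conv_of_real mult_ac)
    finally show "integral {-pi..pi} (\<lambda>t. Re (g t * cis (- (real (m + k) * t)) * (coeff w m * coeff v k * ?\<Theta> (m + k))))
      = 2 * pi * Re (coeff w m * (coeff v k * (fcoeff g (m + k) * ?\<Theta> (m + k))))" by simp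
  qed
  also have "\<dots> = 2 * pi * Re (coeff_pairing (\<lambda>n. fcoeff g n * ?\<Theta> n) (w * v))"
    unfolding coeff_pairing_mult unfolding coeff_pairing_def
    by (simp only: a_def b_def lessThan_Suc_atMost sum_distrib_left Re_sum)
  finally have "Re (coeff_pairing (\<lambda>n. fcoeff g n * ?\<Theta> n) (w * v))
    = circ_mean (\<lambda>t. inner (cscale J (g t) (X t)) (Y (-t)))" by simp
  \<comment> \<open>Cauchy-Schwarz in the Hilbert space at each t, followed by the inequality of the
    means. The contributions of \<open>v\<close> and \<open>w\<close> stay additive and can be
    estimated separately.\<close>
  also have "\<dots> \<le> circ_mean (\<lambda>t. F / 2 * ((norm (X t))\<^sup>2 + (norm (Y (-t)))\<^sup>2))"
  proof (intro divide_right_mono integral_le)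
    show "inner (cscale J (g t) (X t)) (Y (-t)) \<le> F / 2 * ((norm (X t))\<^sup>2 + (norm (Y (-t)))\<^sup>2)" for t
    proof -
      have "inner (cscale J (g t) (X t)) (Y (-t)) \<le> norm (g t) * norm (X t) * norm (Y (-t))"
        using norm_cauchy_schwarz[of "cscale J (g t) (X t)" "Y (-t)"] by (simp add: norm_cscale)
      also have "\<dots> \<le> F * (norm (X t) * norm (Y (-t)))"
        using g(2)[of t] by (simp add: mult.assoc mult_right_mono)
      also have "\<dots> \<le> F * (((norm (X t))\<^sup>2 + (norm (Y (-t)))\<^sup>2) / 2)"
        using sum_squares_bound[of "norm (X t)" "norm (Y (-t))"] by (intro mult_left_mono F) simp
      finally show ?thesis by simp
    qed
  qed (auto intro!: integrable_continuous_real continuous_intros g contX contYm)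
  also have "\<dots> = F / 2 * (circ_mean (\<lambda>t. (norm (X t))\<^sup>2) + circ_mean (\<lambda>t. (norm (Y (-t)))\<^sup>2))"
  proof -
    have "integral {-pi..pi} (\<lambda>t. (norm (X t))\<^sup>2 + (norm (Y (-t)))\<^sup>2)
      = integral {-pi..pi} (\<lambda>t. (norm (X t))\<^sup>2) + integral {-pi..pi} (\<lambda>t. (norm (Y (-t)))\<^sup>2)"
      by (rule Henstock_Kurzweil_Integration.integral_add)
         (auto intro!: integrable_continuous_real continuous_intros contX contYm)
    then show ?thesis by (simp only: integral_mult_right add_divide_distrib[symmetric] times_divide_eq_right)
  qed
  also have "\<dots> \<le> F / 2 * (C\<^sup>2 * circ_mean (\<lambda>t. (norm (poly v (cis t)))\<^sup>2) * (norm x)\<^sup>2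
      + C\<^sup>2 * circ_mean (\<lambda>t. (norm (poly w (cis t)))\<^sup>2) * (norm y)\<^sup>2)"
    by (intro mult_left_mono add_mono meanX meanY) (use F in simp)
  also have "\<dots> = F * C\<^sup>2 * (circ_mean (\<lambda>t. (norm (poly v (cis t)))\<^sup>2) * (norm x)\<^sup>2
              + circ_mean (\<lambda>t. (norm (poly w (cis t)))\<^sup>2) * (norm y)\<^sup>2) / 2"
    by (simp only: distrib_left add_divide_distrib mult_ac times_divide_eq_left times_divide_eq_right divide_divide_eq_left)
  finally show ?thesis .
qed

end

text \<open>An approximate Riesz factorization: with \<open>2 Re g\<close> close to \<open>ln (\<bar>p\<bar> + e)\<close> on the circle, the
  polynomials \<open>w = (1 + g/N)\<^sup>N \<approx> e\<^sup>g\<close> and \<open>v = p (1 - g/N)\<^sup>N \<approx> p e\<^sup>-\<^sup>g\<close> have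
  \<open>\<bar>w\<bar>\<^sup>2 \<approx> \<bar>p\<bar> + e\<close> and \<open>\<bar>v\<bar>\<^sup>2 \<approx> \<bar>p\<bar>\<^sup>2 / (\<bar>p\<bar> + e) \<le> \<bar>p\<bar>\<close>.\<close>

lemma one_plus_power_bound:
  fixes z :: complex
  assumes "N > 0"
  shows "(norm ((1 + z / of_nat N) ^ N))\<^sup>2 \<le> exp (2 * Re z + (norm z)\<^sup>2 / N)"
proof -
  have "(norm (1 + z / of_nat N))\<^sup>2 = 1 + (2 * Re z / N + (norm z)\<^sup>2 / N\<^sup>2)"
    using assms unfolding cmod_power2 by (simp add: field_simps power2_eq_square)
  also have "\<dots> \<le> exp (2 * Re z / N + (norm z)\<^sup>2 / N\<^sup>2)" by (rule exp_ge_add_one_self)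
  finally have "((norm (1 + z / of_nat N))\<^sup>2) ^ N \<le> exp (2 * Re z / N + (norm z)\<^sup>2 / N\<^sup>2) ^ N"
    by (intro power_mono) auto
  also have "\<dots> = exp (2 * Re z + (norm z)\<^sup>2 / N)"
  proof -
    have "real N * (2 * Re z / N + (norm z)\<^sup>2 / N\<^sup>2) = 2 * Re z + (norm z)\<^sup>2 / N"
      using assms by (simp add: field_simps power2_eq_square)
    then show ?thesis by (metis exp_of_nat_mult)
  qed
  finally show ?thesis by (simp add: norm_power power_mult[symmetric] mult.commute)
qed

lemma approx_factorization:
  fixes p :: "complex poly"
  assumes e: "e > 0"
  shows "\<exists>w v. coeff_l1 (p - w * v) \<le> e \<and>
    (\<forall>t. (norm (poly w (cis t)))\<^sup>2 \<le> norm (poly p (cis t)) + e) \<and>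
    (\<forall>t. (norm (poly v (cis t)))\<^sup>2 \<le> norm (poly p (cis t)) + e)"
proof -
  define P where "P = coeff_l1 p"
  have P: "P \<ge> 0" "\<And>z. norm z = 1 \<Longrightarrow> norm (poly p z) \<le> P"
    by (auto simp: P_def norm_poly_le_coeff_l1)
  \<comment> \<open>The logarithm below is taken of |p| + e/2, and the other e/2 pays for a factor
    exp (2 d): one d for the uniform approximation of the logarithm, one for the finite N. This
    choice makes (r + e/2) exp (2 d) at most r + e for all r up to \<open>P\<close>.\<close>
  define d where "d = ln (1 + e / (2 * (P + e))) / 2"
  have d: "d > 0" using e P by (auto simp: d_def intro!: ln_gt_zero)
  have ed: "exp (2 * d) = 1 + e / (2 * (P + e))"
    using e P by (simp add: d_def add_pos_nonneg)
  have small: "(r + e / 2) * exp (2 * d) \<le> r + e" if "0 \<le> r" "r \<le> P" for r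
  proof -
    have "(r + e / 2) * (e / (2 * (P + e))) \<le> (P + e) * (e / (2 * (P + e)))"
      using that e P by (intro mult_right_mono) auto
    also have "\<dots> = e / 2" using e P by (simp add: field_simps)
    finally show ?thesis unfolding ed by (simp only: distrib_left mult_1_right)
  qed
  have "\<exists>r. \<forall>z. norm z = 1 \<longrightarrow> \<bar>ln (norm (poly p z) + e / 2) - Re (poly r z)\<bar> < d"
  proof (intro approx_Re_poly_circle d continuous_intros ballI)
    show "norm (poly p z) + e / 2 \<noteq> 0" for z
      using e norm_ge_zero[of "poly p z"] by linarith
  qed
  then obtain r where r: "\<And>z. norm z = 1 \<Longrightarrow> \<bar>ln (norm (poly p z) + e / 2) - Re (poly r z)\<bar> < d"
    by blast
  define g where "g = smult (1/2) r"
  have g: "\<bar>ln (norm (poly p z) + e / 2) - 2 * Re (poly g z)\<bar> < d" if "norm z = 1" for z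
    using r[OF that] by (simp add: g_def)
  define G where "G = coeff_l1 g"
  have G: "G \<ge> 0" "\<And>z. norm z = 1 \<Longrightarrow> norm (poly g z) \<le> G"
    by (auto simp: G_def norm_poly_le_coeff_l1)
  have "(\<lambda>N. G\<^sup>2 / real N) \<longlonglongrightarrow> 0" "(\<lambda>N. P * (exp (G\<^sup>2 / real N) - 1)) \<longlonglongrightarrow> P * (exp 0 - 1)"
    by (intro tendsto_intros lim_const_over_n)+
  then have "\<forall>\<^sub>F N in sequentially. G\<^sup>2 / real N < d \<and> P * (exp (G\<^sup>2 / real N) - 1) < e \<and> N > 0"
    using d e by (intro eventually_conj order_tendstoD(2)[of _ "0"] eventually_gt_at_top) auto
  then obtain N where N: "G\<^sup>2 / real N < d" "P * (exp (G\<^sup>2 / real N) - 1) < e" "N > 0"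
    by (metis (no_types, lifting) eventually_sequentially order.refl)
  define w where "w = (1 + smult (1 / of_nat N) g) ^ N"
  define v where "v = p * (1 + smult (1 / of_nat N) (- g)) ^ N"
  show ?thesis
  proof (intro exI conjI allI)
    \<comment> \<open>(1 + g/N) (1 - g/N) = 1 + h with \<open>h\<close> of order 1/N^2, so its N-th
      power differs from 1 only by order 1/N, even in the coefficient norm.\<close>
    define h where "h = - (smult (1 / of_nat N) g * smult (1 / of_nat N) g)"
    have h: "coeff_l1 h \<le> G\<^sup>2 / (real N)\<^sup>2"
    proof -
      have "coeff_l1 h = coeff_l1 (smult (-1) (smult (1 / of_nat N) g * smult (1 / of_nat N) g))"
        by (simp add: h_def)
      also have "\<dots> = coeff_l1 (smult (1 / of_nat N) g * smult (1 / of_nat N) g)"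
        unfolding coeff_l1_smult by simp
      also have "\<dots> \<le> coeff_l1 (smult (1 / of_nat N) g) * coeff_l1 (smult (1 / of_nat N) g)"
        by (rule coeff_l1_mult)
      also have "\<dots> = G\<^sup>2 / (real N)\<^sup>2"
        unfolding coeff_l1_smult G_def by (simp add: norm_divide power2_eq_square)
      finally show ?thesis .
    qed
    have "p - w * v = smult (-1) (p * ((1 + h) ^ N - 1))"
    proof -
      have "(1 + smult (1 / of_nat N) g) * (1 + smult (1 / of_nat N) (- g)) = 1 + h"
        unfolding h_def by (simp only: distrib_right distrib_left mult_1 mult_1_right smult_minus_right mult_minus_right) simp
      then have "w * v = p * (1 + h) ^ N"
        unfolding w_def v_def by (metis power_mult_distrib mult.left_commute)
      then show ?thesis by (simp add: algebra_simps)
    qed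
    then have "coeff_l1 (p - w * v) = coeff_l1 (p * ((1 + h) ^ N - 1))"
      by (simp only: coeff_l1_smult) simp
    also have "\<dots> \<le> P * coeff_l1 ((1 + h) ^ N - 1)"
      unfolding P_def by (rule coeff_l1_mult)
    also have "\<dots> \<le> P * ((1 + coeff_l1 h) ^ N - 1)"
      by (intro mult_left_mono coeff_l1_power_minus_1 P)
    also have "\<dots> \<le> P * (exp (G\<^sup>2 / real N) - 1)"
    proof -
      have "(1 + coeff_l1 h) ^ N \<le> exp (G\<^sup>2 / (real N)\<^sup>2) ^ N"
      proof (rule power_mono)
        show "1 + coeff_l1 h \<le> exp (G\<^sup>2 / (real N)\<^sup>2)"
          using exp_ge_add_one_self[of "G\<^sup>2 / (real N)\<^sup>2"] h by linarith
      qed simp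
      also have "\<dots> = exp (G\<^sup>2 / real N)"
      proof -
        have "real N * (G\<^sup>2 / (real N)\<^sup>2) = G\<^sup>2 / real N"
          using N by (simp add: field_simps power2_eq_square)
        then show ?thesis by (metis exp_of_nat_mult)
      qed
      finally show ?thesis using P by (intro mult_left_mono) auto
    qed
    also have "\<dots> \<le> e" using N by simp
    finally show "coeff_l1 (p - w * v) \<le> e" .
  next
    fix t
    let ?r = "norm (poly p (cis t))"
    have r: "0 \<le> ?r" "?r \<le> P" "?r + e / 2 > 0" using P(2) e by (auto intro: add_nonneg_pos)
    have Gz: "(norm (poly g (cis t)))\<^sup>2 / N \<le> d"
    proof -
      have "(norm (poly g (cis t)))\<^sup>2 / N \<le> G\<^sup>2 / N"
        using G(2)[of "cis t"] by (intro divide_right_mono power_mono) auto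
      then show ?thesis using N by linarith
    qed
    have gz: "\<bar>ln (?r + e / 2) - 2 * Re (poly g (cis t))\<bar> < d" by (rule g) simp
    have "poly w (cis t) = (1 + poly g (cis t) / of_nat N) ^ N"
      by (simp add: w_def)
    then have "(norm (poly w (cis t)))\<^sup>2 \<le> exp (2 * Re (poly g (cis t)) + (norm (poly g (cis t)))\<^sup>2 / N)"
      using one_plus_power_bound[OF N(3)] by simp
    also have "\<dots> \<le> exp (ln (?r + e / 2) + 2 * d)" using gz Gz by simp
    also have "\<dots> = (?r + e / 2) * exp (2 * d)" using r by (simp add: exp_add)
    also have "\<dots> \<le> ?r + e" using r by (intro small) auto
    finally show "(norm (poly w (cis t)))\<^sup>2 \<le> ?r + e" .
    have "poly v (cis t) = poly p (cis t) * (1 + (- poly g (cis t)) / of_nat N) ^ N"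
      by (simp add: v_def)
    then have "(norm (poly v (cis t)))\<^sup>2 \<le> ?r\<^sup>2 * exp (2 * Re (- poly g (cis t)) + (norm (- poly g (cis t)))\<^sup>2 / N)"
      using one_plus_power_bound[OF N(3), of "- poly g (cis t)"]
      by (simp only: norm_mult power_mult_distrib) (intro mult_left_mono, auto)
    also have "\<dots> \<le> ?r\<^sup>2 * exp (2 * d - ln (?r + e / 2))"
      using gz Gz by (intro mult_left_mono) auto
    also have "\<dots> = (?r\<^sup>2 / (?r + e / 2)) * exp (2 * d)"
      using r by (simp add: exp_diff)
    also have "\<dots> \<le> (?r + e / 2) * exp (2 * d)"
    proof (intro mult_right_mono)
      have "?r * ?r \<le> (?r + e / 2) * (?r + e / 2)" using e by (intro mult_mono) auto
      then show "?r\<^sup>2 / (?r + e / 2) \<le> ?r + e / 2"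
        using r by (simp add: divide_le_eq power2_eq_square)
    qed simp
    also have "\<dots> \<le> ?r + e" using r by (intro small) auto
    finally show "(norm (poly v (cis t)))\<^sup>2 \<le> ?r + e" .
  qed
qed

text \<open>Both approximate factors have square mean at most the mean of |p| plus e, which bounds
  the main term by \<open>hankel_form_bound\<close>. The remainder is small in
  \<open>coeff_l1\<close> and is paired with a bounded sequence; then e tends to 0.\<close>

lemma (in cplx_hilbert) hankel_bound:
  fixes S :: "nat \<Rightarrow> 'h \<Rightarrow>\<^sub>L 'h" and p :: "complex poly"
  assumes S: "\<And>n. S n \<in> BH J" "\<And>m k. S (m + k) = S m o\<^sub>L S k" "\<And>n. norm (S n) \<le> C"
    and g: "continuous_on {-pi..pi} g" "\<And>t. norm (g t) \<le> F"
  shows "Re (coeff_pairing (\<lambda>n. fcoeff g n * cinner J (S n x) y) p)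
    \<le> F * C\<^sup>2 * circ_mean (\<lambda>t. norm (poly p (cis t))) * ((norm x)\<^sup>2 + (norm y)\<^sup>2) / 2"
    (is "?L \<le> ?R")
proof -
  have C: "C \<ge> 0" using S(3)[of 0] norm_ge_zero order_trans by blast
  have F: "F \<ge> 0" using g(2)[of 0] norm_ge_zero order_trans by blast
  let ?\<phi> = "\<lambda>n. fcoeff g n * cinner J (S n x) y"
  define K where "K = F * C * norm x * norm y"
  have \<phi>: "norm (?\<phi> n) \<le> K" for n
  proof -
    have "norm (?\<phi> n) \<le> F * (norm (S n x) * norm y)"
      unfolding norm_mult by (intro mult_mono norm_fcoeff_le g norm_cinner_le F) auto
    also have "\<dots> \<le> F * (C * norm x * norm y)"
      by (intro mult_left_mono mult_right_mono order_trans[OF norm_blinfun] S F) auto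
    finally show ?thesis by (simp add: K_def mult_ac)
  qed
  let ?q = "(norm x)\<^sup>2 + (norm y)\<^sup>2"
  have bound: "?L \<le> ?R + e * (F * C\<^sup>2 * ?q / 2 + K)" if e: "e > 0" for e
  proof -
    obtain w v where wv: "coeff_l1 (p - w * v) \<le> e"
      "\<And>t. (norm (poly w (cis t)))\<^sup>2 \<le> norm (poly p (cis t)) + e"
      "\<And>t. (norm (poly v (cis t)))\<^sup>2 \<le> norm (poly p (cis t)) + e"
      using approx_factorization[OF e] by blast
    have mean: "circ_mean (\<lambda>t. (norm (poly u (cis t)))\<^sup>2) \<le> circ_mean (\<lambda>t. norm (poly p (cis t))) + e"
      if "\<And>t. (norm (poly u (cis t)))\<^sup>2 \<le> norm (poly p (cis t)) + e" for u
    proof -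
      have "integral {-pi..pi} (\<lambda>t. (norm (poly u (cis t)))\<^sup>2) \<le> integral {-pi..pi} (\<lambda>t. norm (poly p (cis t)) + e)"
        by (intro integral_le integrable_continuous_real continuous_intros that)
      also have "\<dots> = integral {-pi..pi} (\<lambda>t. norm (poly p (cis t))) + 2 * pi * e"
        by (subst Henstock_Kurzweil_Integration.integral_add)
           (auto intro!: integrable_continuous_real continuous_intros)
      finally have "circ_mean (\<lambda>t. (norm (poly u (cis t)))\<^sup>2)
          \<le> (integral {-pi..pi} (\<lambda>t. norm (poly p (cis t))) + 2 * pi * e) / (2 * pi)"
        by (intro divide_right_mono) auto
      then show ?thesis by (simp add: add_divide_distrib)
    qed
    have split: "?L = Re (coeff_pairing ?\<phi> (w * v)) + Re (coeff_pairing ?\<phi> (p - w * v))"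
      using coeff_pairing_add[of ?\<phi> "w * v" "p - w * v"] by simp
    have "Re (coeff_pairing ?\<phi> (p - w * v)) \<le> K * coeff_l1 (p - w * v)"
      by (rule order_trans[OF complex_Re_le_cmod norm_coeff_pairing_le[OF \<phi>]])
    also have "\<dots> \<le> K * e" using wv(1) C F by (intro mult_left_mono) (auto simp: K_def)
    finally have rest: "Re (coeff_pairing ?\<phi> (p - w * v)) \<le> K * e" .
    have "Re (coeff_pairing ?\<phi> (w * v)) \<le>
       F * C\<^sup>2 * (circ_mean (\<lambda>t. (norm (poly v (cis t)))\<^sup>2) * (norm x)\<^sup>2
              + circ_mean (\<lambda>t. (norm (poly w (cis t)))\<^sup>2) * (norm y)\<^sup>2) / 2"
      by (rule hankel_form_bound[OF S g])
    also have "\<dots> \<le> F * C\<^sup>2 * ((circ_mean (\<lambda>t. norm (poly p (cis t))) + e) * (norm x)\<^sup>2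
              + (circ_mean (\<lambda>t. norm (poly p (cis t))) + e) * (norm y)\<^sup>2) / 2"
      by (intro divide_right_mono mult_left_mono add_mono mult_right_mono mean wv) (use F in auto)
    also have "\<dots> = ?R + e * (F * C\<^sup>2 * ?q / 2)"
      by (simp only: distrib_left distrib_right add_divide_distrib mult_ac times_divide_eq_left times_divide_eq_right)
    finally have "?L \<le> ?R + e * (F * C\<^sup>2 * ?q / 2) + K * e"
      unfolding split using rest by (rule add_mono)
    also have "\<dots> = ?R + e * (F * C\<^sup>2 * ?q / 2 + K)"
      by (simp only: distrib_left add.assoc mult.commute)
    finally show ?thesis .
  qed
  have "(\<lambda>n. ?R + 1 / real (Suc n) * (F * C\<^sup>2 * ?q / 2 + K)) \<longlonglongrightarrow> ?R + 0 * (F * C\<^sup>2 * ?q / 2 + K)"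
    using LIMSEQ_inverse_real_of_nat by (intro tendsto_intros) (simp add: inverse_eq_divide)
  then have "?L \<le> ?R + 0 * (F * C\<^sup>2 * ?q / 2 + K)"
    by (rule LIMSEQ_le_const) (intro exI allI impI bound, simp)
  then show ?thesis by simp
qed

section \<open>Fourier analysis on the line\<close>

text \<open>A Tonelli criterion: the dominating kernel has inner integrals proportional to an
  integrable function. Product kernels and convolution kernels both have this shape, and they
  justify the later exchanges of integrals.\<close>

lemma integrable_pair_bound:
  fixes f :: "real \<times> real \<Rightarrow> complex" and k :: "real \<Rightarrow> real \<Rightarrow> real"
  assumes f: "f \<in> borel_measurable (lborel \<Otimes>\<^sub>M lborel)"
    and le: "\<And>s r. norm (f (s, r)) \<le> k s r"
    and k: "\<And>s. integrable lborel (k s)" "\<And>s. (LINT r|lborel. k s r) = K * a s"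
    and a: "integrable lborel a"
  shows "integrable (lborel \<Otimes>\<^sub>M lborel) f"
proof (rule lborel_pair.Fubini_integrable[OF f])
  note [measurable] = f
  have i: "integrable lborel (\<lambda>r. f (s, r))" for s
    by (rule Bochner_Integration.integrable_bound[OF k(1)[of s]])
       (use le in \<open>auto intro: order_trans[OF _ abs_ge_self]\<close>)
  show "AE s in lborel. integrable lborel (\<lambda>r. f (s, r))" using i by simp
  show "integrable lborel (\<lambda>s. LINT r|lborel. norm (f (s, r)))"
  proof (rule Bochner_Integration.integrable_bound)
    show "integrable lborel (\<lambda>s. K * a s)" using a by simp
    show "AE s in lborel. norm (LINT r|lborel. norm (f (s, r))) \<le> norm (K * a s)"
    proof (rule AE_I2)
      fix s
      have "(LINT r|lborel. norm (f (s, r))) \<le> (LINT r|lborel. k s r)"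
        by (intro integral_mono integrable_norm i k le)
      moreover have "0 \<le> (LINT r|lborel. norm (f (s, r)))" by simp
      ultimately show "norm (LINT r|lborel. norm (f (s, r))) \<le> norm (K * a s)"
        unfolding k(2) by simp
    qed
  qed measurable
qed

lemma integrable_pair_mult:
  fixes w :: "real \<times> real \<Rightarrow> complex" and a b :: "real \<Rightarrow> complex"
  assumes a: "integrable lborel a" and b: "integrable lborel b"
    and w[measurable]: "w \<in> borel_measurable (lborel \<Otimes>\<^sub>M lborel)" and le: "\<And>s r. norm (w (s, r)) \<le> B"
  shows "integrable (lborel \<Otimes>\<^sub>M lborel) (\<lambda>(s, r). a s * b r * w (s, r))"
proof (rule integrable_pair_bound)
  have [measurable]: "a \<in> borel_measurable borel" "b \<in> borel_measurable borel"
    using a b by (auto dest: borel_measurable_integrable)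
  show "(\<lambda>(s, r). a s * b r * w (s, r)) \<in> borel_measurable (lborel \<Otimes>\<^sub>M lborel)" by measurable
  show "norm (case (s, r) of (s, r) \<Rightarrow> a s * b r * w (s, r)) \<le> norm (a s) * norm (b r) * B" for s r
    by (simp add: norm_mult mult_left_mono le)
  show "integrable lborel (\<lambda>r. norm (a s) * norm (b r) * B)" for s using b by simp
  show "(LINT r|lborel. norm (a s) * norm (b r) * B) = ((LINT r|lborel. norm (b r)) * B) * norm (a s)" for s
    by simp
  show "integrable lborel (\<lambda>s. norm (a s))" using a by simp
qed

lemma integrable_pair_conv:
  fixes w :: "real \<times> real \<Rightarrow> complex" and a b :: "real \<Rightarrow> complex"
  assumes a: "integrable lborel a" and b: "integrable lborel b"
    and w[measurable]: "w \<in> borel_measurable (lborel \<Otimes>\<^sub>M lborel)" and le: "\<And>s r. norm (w (s, r)) \<le> B"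
  shows "integrable (lborel \<Otimes>\<^sub>M lborel) (\<lambda>(s, r). a s * b (r - s) * w (s, r))"
proof (rule integrable_pair_bound)
  have [measurable]: "a \<in> borel_measurable borel" "b \<in> borel_measurable borel"
    using a b by (auto dest: borel_measurable_integrable)
  show "(\<lambda>(s, r). a s * b (r - s) * w (s, r)) \<in> borel_measurable (lborel \<Otimes>\<^sub>M lborel)" by measurable
  show "norm (case (s, r) of (s, r) \<Rightarrow> a s * b (r - s) * w (s, r)) \<le> norm (a s) * norm (b (r - s)) * B" for s r
    by (simp add: norm_mult mult_left_mono le)
  have "integrable lborel (\<lambda>r. norm (b (r - s)))" for s
    using lborel_integrable_real_affine[OF integrable_norm[OF b], of 1 "-s"] by simp
  then show "integrable lborel (\<lambda>r. norm (a s) * norm (b (r - s)) * B)" for s by simp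
  show "(LINT r|lborel. norm (a s) * norm (b (r - s)) * B) = ((LINT r|lborel. norm (b r)) * B) * norm (a s)" for s
    using lborel_integral_real_affine[of 1 "\<lambda>r. norm (b r)" "-s"] by simp
  show "integrable lborel (\<lambda>s. norm (a s))" using a by simp
qed

lemma integrable_mult_bounded:
  fixes f w :: "real \<Rightarrow> complex"
  assumes f: "integrable lborel f" and w[measurable]: "w \<in> borel_measurable borel" and le: "\<And>t. norm (w t) \<le> B"
  shows "integrable lborel (\<lambda>t. f t * w t)"
proof (rule Bochner_Integration.integrable_bound)
  have [measurable]: "f \<in> borel_measurable borel" using f by (auto dest: borel_measurable_integrable)
  show "integrable lborel (\<lambda>t. norm (f t) * B)" using f by simp
  show "(\<lambda>t. f t * w t) \<in> borel_measurable lborel" by measurable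
  show "AE t in lborel. norm (f t * w t) \<le> norm (norm (f t) * B)"
    using le by (intro AE_I2) (auto simp: norm_mult abs_mult intro!: mult_left_mono intro: order_trans[OF _ abs_ge_self])
qed

lemma norm_integral_mult_le:
  fixes f w :: "real \<Rightarrow> complex"
  assumes f: "integrable lborel f" and w: "w \<in> borel_measurable borel" and le: "\<And>t. norm (w t) \<le> B"
  shows "norm (LINT t|lborel. f t * w t) \<le> (LINT t|lborel. norm (f t)) * B"
proof -
  have "norm (LINT t|lborel. f t * w t) \<le> (LINT t|lborel. norm (f t * w t))"
    by (rule integral_norm_bound)
  also have "\<dots> \<le> (LINT t|lborel. norm (f t) * B)"
    by (intro integral_mono integrable_norm integrable_mult_bounded[OF assms] integrable_mult_left)
       (auto simp: f norm_mult le intro!: mult_left_mono integrable_norm)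
  finally show ?thesis by simp
qed

section \<open>Fourier inversion, convolution and approximation in C_0\<close>

lemma cis_measurable [measurable]: "cis \<in> borel_measurable borel"
  by (intro borel_measurable_continuous_onI continuous_intros)

lemma gaussian_fourier:
  "(LINT v|lborel. of_real (std_normal_density v) * cis (u * v)) = of_real (exp (- u\<^sup>2 / 2))"
proof -
  have "char std_normal_distribution u = (LINT v|lborel. std_normal_density v *\<^sub>R iexp (u * v))"
    unfolding char_def by (subst integral_density) (auto simp: normal_density_nonneg)
  then show ?thesis
    unfolding char_std_normal_distribution by (simp add: scaleR_conv_of_real cis_conv_exp)
qed

lemma integrable_std_normal: "integrable lborel (\<lambda>v. complex_of_real (std_normal_density v))"
  using integrable_std_normal_moment[of 0] by (auto intro: integrable_of_real)

lemma integral_std_normal: "(LINT v|lborel. std_normal_density v) = 1"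
  using integral_std_normal_moment_even[of 0] by simp

lemma integral_affine:
  fixes f :: "real \<Rightarrow> complex"
  assumes "c > 0"
  shows "(LINT x|lborel. f x) = c *\<^sub>R (LINT x|lborel. f (t + c * x))"
  using lborel_integral_real_affine[of c f t] assms by simp

text \<open>Gaussian regularisation. Inserting the density at scale \<sigma> permits Fubini, and s =
  t + \<sigma> x turns the other side into an average of g near t; both sides converge by dominated
  convergence as \<sigma> tends to 0. One factor sqrt (2 pi) comes from the density at 0, the other
  from rewriting exp (- x^2 / 2) as a density.\<close>

lemma fourier_inversion:
  fixes g G :: "real \<Rightarrow> complex"
  assumes cont: "continuous_on UNIV g" and g: "integrable lborel g" and B: "\<And>t. norm (g t) \<le> B"
    and G_def: "\<And>u. G u = (LINT t|lborel. g t * cis (u * t))" and G: "integrable lborel G"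
  shows "(LINT u|lborel. G u * cis (- (u * t))) = 2 * pi * g t"
proof -
  let ?n = std_normal_density
  have [measurable]: "g \<in> borel_measurable borel" "G \<in> borel_measurable borel"
    using g G by (auto dest: borel_measurable_integrable)
  have n: "?n x = exp (- x\<^sup>2 / 2) / sqrt (2 * pi)" for x by (simp add: std_normal_density_def)
  have n_le: "norm (complex_of_real (?n x)) \<le> 1 / sqrt (2 * pi)" for x
    unfolding n norm_of_real by (simp add: divide_right_mono)
  have eq: "(LINT u|lborel. G u * cis (- (u * t)) * ?n (\<sigma> * u)) = sqrt (2 * pi) * (LINT x|lborel. ?n x * g (t + \<sigma> * x))"
    if \<sigma>: "\<sigma> > 0" for \<sigma>
  proof -
    have n\<sigma>: "integrable lborel (\<lambda>u. complex_of_real (?n (\<sigma> * u)))"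
      using lborel_integrable_real_affine[OF integrable_std_normal, of \<sigma> 0] \<sigma> by simp
    have "(LINT u|lborel. G u * cis (- (u * t)) * ?n (\<sigma> * u))
        = (LINT u|lborel. LINT s|lborel. g s * ?n (\<sigma> * u) * cis (u * (s - t)))"
    proof (rule Bochner_Integration.integral_cong[OF refl])
      fix u
      have cis_ust: "cis (u * (s - t)) = cis (u * s) * cis (- (u * t))" for s
        by (simp add: cis_mult right_diff_distrib)
      have "G u * cis (- (u * t)) * ?n (\<sigma> * u) = (LINT s|lborel. g s * cis (u * s)) * (cis (- (u * t)) * ?n (\<sigma> * u))"
        by (simp add: G_def mult.assoc)
      also have "\<dots> = (LINT s|lborel. g s * cis (u * s) * (cis (- (u * t)) * ?n (\<sigma> * u)))"
        by simp
      also have "\<dots> = (LINT s|lborel. g s * ?n (\<sigma> * u) * cis (u * (s - t)))"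
        by (rule Bochner_Integration.integral_cong[OF refl])
           (simp add: cis_ust mult_ac)
      finally show "G u * cis (- (u * t)) * ?n (\<sigma> * u) = (LINT s|lborel. g s * ?n (\<sigma> * u) * cis (u * (s - t)))" .
    qed
    also have "\<dots> = (LINT s|lborel. LINT u|lborel. g s * ?n (\<sigma> * u) * cis (u * (s - t)))"
    proof (rule lborel_pair.Fubini_integral)
      show "integrable (lborel \<Otimes>\<^sub>M lborel) (\<lambda>(s, u). g s * ?n (\<sigma> * u) * cis (u * (s - t)))"
        using integrable_pair_mult[OF g n\<sigma>, of "\<lambda>(s, u). cis (u * (s - t))" 1] by simp
    qed
    also have "\<dots> = (LINT s|lborel. g s * (exp (- ((s - t) / \<sigma>)\<^sup>2 / 2) / \<sigma>))"
    proof (rule Bochner_Integration.integral_cong[OF refl])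
      fix s
      have "(LINT u|lborel. ?n (\<sigma> * u) * cis (u * (s - t)))
         = (LINT v|lborel. ?n v * cis ((s - t) / \<sigma> * v)) / \<sigma>"
        using integral_affine[OF \<sigma>, of "\<lambda>v. ?n v * cis ((s - t) / \<sigma> * v)" 0] \<sigma>
        by (simp add: scaleR_conv_of_real mult.commute)
      then show "(LINT u|lborel. g s * ?n (\<sigma> * u) * cis (u * (s - t))) = g s * (exp (- ((s - t) / \<sigma>)\<^sup>2 / 2) / \<sigma>)"
        unfolding gaussian_fourier by (simp add: mult.assoc)
    qed
    also have "\<dots> = \<sigma> *\<^sub>R (LINT x|lborel. g (t + \<sigma> * x) * (exp (- ((t + \<sigma> * x - t) / \<sigma>)\<^sup>2 / 2) / \<sigma>))"
      by (rule integral_affine[OF \<sigma>])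
    also have "\<dots> = (LINT x|lborel. \<sigma> *\<^sub>R (g (t + \<sigma> * x) * (exp (- ((t + \<sigma> * x - t) / \<sigma>)\<^sup>2 / 2) / \<sigma>)))"
      by simp
    also have "\<dots> = (LINT x|lborel. sqrt (2 * pi) * (?n x * g (t + \<sigma> * x)))"
      by (rule Bochner_Integration.integral_cong[OF refl])
         (use \<sigma> in \<open>simp add: n scaleR_conv_of_real real_sqrt_mult\<close>)
    finally show ?thesis by simp
  qed
  define \<sigma> where "\<sigma> k = 1 / real (Suc k)" for k
  have \<sigma>0: "\<sigma> \<longlonglongrightarrow> 0"
    using LIMSEQ_inverse_real_of_nat by (simp add: \<sigma>_def[abs_def] inverse_eq_divide)
  have lhs: "(\<lambda>k. LINT u|lborel. G u * cis (- (u * t)) * ?n (\<sigma> k * u)) \<longlonglongrightarrow> (LINT u|lborel. G u * cis (- (u * t)) * ?n 0)"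
  proof (rule integral_dominated_convergence)
    show "integrable lborel (\<lambda>u. norm (G u) * (1 / sqrt (2 * pi)))" using G by simp
    show "AE u in lborel. (\<lambda>k. G u * cis (- (u * t)) * ?n (\<sigma> k * u)) \<longlonglongrightarrow> G u * cis (- (u * t)) * ?n 0"
    proof (rule AE_I2)
      fix u
      have "(\<lambda>k. G u * cis (- (u * t)) * ?n (\<sigma> k * u)) \<longlonglongrightarrow> G u * cis (- (u * t)) * ?n (0 * u)"
        unfolding n by (intro tendsto_intros \<sigma>0) auto
      then show "(\<lambda>k. G u * cis (- (u * t)) * ?n (\<sigma> k * u)) \<longlonglongrightarrow> G u * cis (- (u * t)) * ?n 0" by simp
    qed
    show "AE u in lborel. norm (G u * cis (- (u * t)) * ?n (\<sigma> k * u)) \<le> norm (G u) * (1 / sqrt (2 * pi))" for k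
      by (intro AE_I2) (simp only: norm_mult norm_cis mult_1_right mult_left_mono[OF n_le] norm_ge_zero)
  qed measurable
  have rhs: "(\<lambda>k. LINT x|lborel. ?n x * g (t + \<sigma> k * x)) \<longlonglongrightarrow> (LINT x|lborel. ?n x * g t)"
  proof (rule integral_dominated_convergence)
    show "integrable lborel (\<lambda>x. ?n x * B)" using integrable_std_normal_moment[of 0] by simp
    show "AE x in lborel. (\<lambda>k. ?n x * g (t + \<sigma> k * x)) \<longlonglongrightarrow> ?n x * g t"
    proof (rule AE_I2)
      fix x
      have "(\<lambda>k. t + \<sigma> k * x) \<longlonglongrightarrow> t + 0 * x" by (intro tendsto_intros \<sigma>0)
      then have "(\<lambda>k. g (t + \<sigma> k * x)) \<longlonglongrightarrow> g t"
        using cont by (intro continuous_on_tendsto_compose[where s = UNIV and f = g]) auto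
      then show "(\<lambda>k. ?n x * g (t + \<sigma> k * x)) \<longlonglongrightarrow> ?n x * g t" by (intro tendsto_intros)
    qed
    show "AE x in lborel. norm (?n x * g (t + \<sigma> k * x)) \<le> ?n x * B" for k
      by (intro AE_I2) (simp add: norm_mult normal_density_nonneg mult_left_mono B)
  qed measurable
  have "(LINT u|lborel. G u * cis (- (u * t)) * ?n 0) = sqrt (2 * pi) * (LINT x|lborel. ?n x * g t)"
    by (rule LIMSEQ_unique[OF lhs]) (subst eq, simp add: \<sigma>_def, intro tendsto_intros rhs)
  moreover have "(LINT x|lborel. ?n x * g t) = g t"
    using integral_std_normal by (simp add: integral_complex_of_real)
  ultimately have "(LINT u|lborel. G u * cis (- (u * t)) * ?n 0) = sqrt (2 * pi) * g t"
    by (simp only:)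
  moreover have "?n 0 = 1 / sqrt (2 * pi)" by (simp add: n)
  ultimately have "(LINT u|lborel. G u * cis (- (u * t))) / sqrt (2 * pi) = sqrt (2 * pi) * g t"
    by simp
  then have "(LINT u|lborel. G u * cis (- (u * t))) = complex_of_real (sqrt (2 * pi) * sqrt (2 * pi)) * g t"
    by (simp add: field_simps del: real_sqrt_mult_self)
  then show ?thesis by simp
qed

text \<open>Convolution of Borel functions, as opposed to \<^const>\<open>conv\<close>, which uses the gauge integral.\<close>

definition bconv :: "(real \<Rightarrow> complex) \<Rightarrow> (real \<Rightarrow> complex) \<Rightarrow> real \<Rightarrow> complex" where
  "bconv a b r = (LINT s|lborel. a s * b (r - s))"

text \<open>Fubini and the translation r = s + v. With \<open>\<Phi>\<close> a matrix coefficient or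
  an exponential, the addition law of \<open>\<Phi>\<close> makes the calculus and the Laplace
  transform multiplicative.\<close>

lemma
  assumes a: "integrable lborel a" and b: "integrable lborel b"
  shows integrable_bconv: "integrable lborel (bconv a b)"
    and bconv_pairing: "\<And>\<Phi> B. \<Phi> \<in> borel_measurable borel \<Longrightarrow> (\<And>t. norm (\<Phi> t) \<le> B) \<Longrightarrow>
      (LINT r|lborel. bconv a b r * \<Phi> r) = (LINT s|lborel. LINT v|lborel. a s * b v * \<Phi> (s + v))"
proof -
  have "integrable (lborel \<Otimes>\<^sub>M lborel) (\<lambda>(s, r). a s * b (r - s))"
    using integrable_pair_conv[OF a b, of "\<lambda>_. 1" 1] by simp
  from lborel_pair.integrable_snd[OF this] show "integrable lborel (bconv a b)"
    by (simp add: bconv_def[abs_def])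
  fix \<Phi> :: "real \<Rightarrow> complex" and B
  assume \<Phi>[measurable]: "\<Phi> \<in> borel_measurable borel" and B: "\<And>t. norm (\<Phi> t) \<le> B"
  have i: "integrable (lborel \<Otimes>\<^sub>M lborel) (\<lambda>(s, r). a s * b (r - s) * \<Phi> r)"
    using integrable_pair_conv[OF a b, of "\<lambda>(s, r). \<Phi> r" B] B by simp
  have "(LINT r|lborel. bconv a b r * \<Phi> r) = (LINT r|lborel. LINT s|lborel. a s * b (r - s) * \<Phi> r)"
    by (simp add: bconv_def)
  also have "\<dots> = (LINT s|lborel. LINT r|lborel. a s * b (r - s) * \<Phi> r)"
    by (rule lborel_pair.Fubini_integral[OF i])
  also have "\<dots> = (LINT s|lborel. LINT v|lborel. a s * b v * \<Phi> (s + v))"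
  proof (rule Bochner_Integration.integral_cong[OF refl])
    fix s
    show "(LINT r|lborel. a s * b (r - s) * \<Phi> r) = (LINT v|lborel. a s * b v * \<Phi> (s + v))"
      using lborel_integral_real_affine[of 1 "\<lambda>r. a s * b (r - s) * \<Phi> r" s] by simp
  qed
  finally show "(LINT r|lborel. bconv a b r * \<Phi> r) = (LINT s|lborel. LINT v|lborel. a s * b v * \<Phi> (s + v))" .
qed

lemma continuous_on_integral_param:
  fixes k :: "real \<Rightarrow> real \<Rightarrow> complex"
  assumes [measurable]: "\<And>u. k u \<in> borel_measurable borel"
    and cont: "\<And>v. continuous_on UNIV (\<lambda>u. k u v)"
    and le: "\<And>u v. norm (k u v) \<le> w v" and w: "integrable lborel w"
  shows "continuous_on UNIV (\<lambda>u. LINT v|lborel. k u v)"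
proof (rule continuous_on_sequentiallyI)
  fix U :: "nat \<Rightarrow> real" and l
  assume U: "U \<longlonglongrightarrow> l"
  show "(\<lambda>n. LINT v|lborel. k (U n) v) \<longlonglongrightarrow> (LINT v|lborel. k l v)"
  proof (rule integral_dominated_convergence[OF _ _ w])
    show "AE v in lborel. (\<lambda>n. k (U n) v) \<longlonglongrightarrow> k l v"
      using continuous_on_tendsto_compose[OF cont U] by simp
  qed (use le in auto)
qed

lemma continuous_on_fourier_integral:
  assumes c: "integrable lborel c"
  shows "continuous_on UNIV (\<lambda>u. LINT t|lborel. c t * cis (a * (u * t)))"
proof (rule continuous_on_integral_param)
  have [measurable]: "c \<in> borel_measurable borel" using c by (auto dest: borel_measurable_integrable)
  show "(\<lambda>t. c t * cis (a * (u * t))) \<in> borel_measurable borel" for u by measurable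
  show "continuous_on UNIV (\<lambda>u. c t * cis (a * (u * t)))" for t by (intro continuous_intros)
  show "norm (c t * cis (a * (u * t))) \<le> norm (c t)" for u t by (simp add: norm_mult)
  show "integrable lborel (\<lambda>t. norm (c t))" using c by simp
qed

text \<open>Both directions of inversion are recorded: the first represents the convolution with h
  by \<open>c\<close> times \<open>hft h\<close>, the second supplies the sampled coefficients in
  the key estimate.\<close>

definition fourier_pair :: "(real \<Rightarrow> complex) \<Rightarrow> (real \<Rightarrow> complex) \<Rightarrow> bool" where
  "fourier_pair f c \<longleftrightarrow> C0fun f \<and> integrable lborel f \<and> integrable lborel c \<and> continuous_on UNIV c \<and>
     (\<forall>u. f u = (LINT t|lborel. c t * cis (u * t))) \<and>
     (\<forall>t. (LINT u|lborel. f u * cis (- (u * t))) = 2 * complex_of_real pi * c t)"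

lemma C0fun_bounded:
  assumes "C0fun f"
  shows "\<exists>B. \<forall>t. norm (f t) \<le> B"
proof -
  from assms have c: "continuous_on UNIV f" and "(f \<longlongrightarrow> 0) at_infinity"
    by (auto simp: C0fun_def)
  then have "\<forall>\<^sub>F t in at_infinity. norm (f t) < 1"
    by (intro order_tendstoD(2)[where y = 0]) (auto intro!: tendsto_norm_zero)
  then obtain R where R: "\<And>t. R \<le> norm t \<Longrightarrow> norm (f t) < 1"
    by (auto simp: eventually_at_infinity)
  have "compact (f ` {-R..R})"
    by (intro compact_continuous_image continuous_on_subset[OF c]) auto
  then obtain B where B: "\<And>t. t \<in> {-R..R} \<Longrightarrow> norm (f t) \<le> B"
    using bounded_iff compact_imp_bounded by (metis imageI)
  have "norm (f t) \<le> max B 1" for t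
  proof (cases "R \<le> norm t")
    case False
    then have "t \<in> {-R..R}" by auto
    then show ?thesis using B[of t] by (simp add: le_max_iff_disj)
  qed (use R[of t] in auto)
  then show ?thesis by blast
qed

lemma C0fun_cutoff:
  assumes f: "C0fun f" and e: "e > 0"
  shows "\<exists>f0 R. continuous_on UNIV f0 \<and> (\<forall>t. \<bar>t\<bar> \<ge> R \<longrightarrow> f0 t = 0) \<and> (\<forall>t. norm (f t - f0 t) \<le> e)"
proof -
  have c: "continuous_on UNIV f" and "(f \<longlongrightarrow> 0) at_infinity"
    using f by (auto simp: C0fun_def)
  then have "\<forall>\<^sub>F t in at_infinity. norm (f t) < e"
    using e by (intro order_tendstoD(2)[where y = 0]) (auto intro!: tendsto_norm_zero)
  then obtain R where R: "\<And>t. R \<le> norm t \<Longrightarrow> norm (f t) < e"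
    by (auto simp: eventually_at_infinity)
  define ct where "ct t = max 0 (min 1 (R + 1 - \<bar>t\<bar>))" for t
  show ?thesis
  proof (intro exI conjI allI impI)
    show "continuous_on UNIV (\<lambda>t. of_real (ct t) * f t)"
      unfolding ct_def by (intro continuous_intros c)
    show "of_real (ct t) * f t = 0" if "R + 1 \<le> \<bar>t\<bar>" for t
      using that by (simp add: ct_def)
    show "norm (f t - of_real (ct t) * f t) \<le> e" for t
    proof (cases "R \<le> \<bar>t\<bar>")
      case True
      have "norm (f t - of_real (ct t) * f t) = norm (of_real (1 - ct t) * f t)"
        by (simp add: algebra_simps)
      also have "\<dots> \<le> 1 * norm (f t)"
        unfolding norm_mult norm_of_real by (intro mult_right_mono) (auto simp: ct_def)
      also have "\<dots> \<le> e" using R[of t] True by simp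
      finally show ?thesis .
    next
      case False
      then show ?thesis using e by (simp add: ct_def)
    qed
  qed
qed

lemma uniformly_continuous_compact_support:
  fixes f0 :: "real \<Rightarrow> complex"
  assumes c: "continuous_on UNIV f0" and R: "\<And>t. \<bar>t\<bar> \<ge> R \<Longrightarrow> f0 t = 0" and e: "e > 0"
  shows "\<exists>d>0. \<forall>s t. \<bar>s - t\<bar> < d \<longrightarrow> norm (f0 s - f0 t) < e"
proof -
  have "uniformly_continuous_on {-(R+1)..R+1} f0"
    by (intro compact_uniformly_continuous continuous_on_subset[OF c]) auto
  then obtain d where d: "d > 0"
    "\<And>s t. s \<in> {-(R+1)..R+1} \<Longrightarrow> t \<in> {-(R+1)..R+1} \<Longrightarrow> dist s t < d \<Longrightarrow> dist (f0 s) (f0 t) < e"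
    using e unfolding uniformly_continuous_on_def by metis
  \<comment> \<open>Two points closer than 1 either both lie in the enlarged interval or both have
    modulus at least \<open>R\<close>, where \<open>f0\<close> vanishes.\<close>
  show ?thesis
  proof (intro exI[of _ "min d 1"] conjI allI impI)
    fix s t assume st: "\<bar>s - t\<bar> < min d 1"
    show "norm (f0 s - f0 t) < e"
    proof (cases "s \<in> {-(R+1)..R+1} \<and> t \<in> {-(R+1)..R+1}")
      case True
      then show ?thesis using d(2)[of s t] st by (auto simp: dist_norm)
    next
      case False
      then have "\<bar>s\<bar> \<ge> R" "\<bar>t\<bar> \<ge> R" using st by auto
      then show ?thesis using R e by simp
    qed
  qed (use d in auto)
qed

text \<open>Cut off, then convolve with a narrow Gaussian: the transform becomes a bounded function
  times a Gaussian, hence integrable. The uniform error consists of a near part, small by uniform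
  continuity, and a far part, small by the second moment.\<close>

lemma C0fun_nice_approx:
  assumes f: "C0fun f" and e: "e > 0"
  shows "\<exists>f' c. fourier_pair f' c \<and> (\<forall>t. norm (f t - f' t) \<le> e)"
proof -
  let ?n = std_normal_density
  obtain f0 R where c0: "continuous_on UNIV f0" and R: "\<And>t. \<bar>t\<bar> \<ge> R \<Longrightarrow> f0 t = 0"
    and f0: "\<And>t. norm (f t - f0 t) \<le> e / 3"
    using C0fun_cutoff[OF f, of "e / 3"] e by auto
  obtain \<eta> where \<eta>: "\<eta> > 0" "\<And>s t. \<bar>s - t\<bar> < \<eta> \<Longrightarrow> norm (f0 s - f0 t) < e / 3"
    using uniformly_continuous_compact_support[where R = R and e = "e / 3", OF c0 R] e by (auto simp del: less_divide_eq_numeral1)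
  obtain B1 where "\<And>t. norm (f t) \<le> B1" using C0fun_bounded[OF f] by blast
  then have B': "norm (f0 t) \<le> B1 + e / 3" for t
    using f0[of t] norm_triangle_sub[of "f0 t" "f t"] by (smt (verit) norm_minus_commute)
  define B where "B = B1 + e / 3"
  have B: "norm (f0 t) \<le> B" for t using B' by (simp add: B_def)
  then have B0: "B \<ge> 0" using norm_ge_zero order_trans by blast
  have [measurable]: "f0 \<in> borel_measurable borel"
    using c0 by (rule borel_measurable_continuous_onI)
  have if0: "integrable lborel f0"
  proof (rule Bochner_Integration.integrable_bound)
    show "integrable lborel (\<lambda>t. indicator {-R..R} t * B)"
      by (intro integrable_mult_left integrable_real_indicator) (auto simp: emeasure_lborel_Icc_eq)
    show "AE t in lborel. norm (f0 t) \<le> norm (indicator {-R..R} t * B)"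
      using B R B0 by (intro AE_I2) (auto simp: indicator_def)
  qed simp
  \<comment> \<open>Chosen so that the far part 2 B \<sigma>^2 / \<eta>^2 is at most e / 3; the
    summand 1 keeps the quotient meaningful for B = 0.\<close>
  define \<sigma> where "\<sigma> = \<eta> * sqrt (e / (3 * (2 * B + 1)))"
  have \<sigma>: "\<sigma> > 0" using \<eta> e B0 by (simp add: \<sigma>_def)
  have \<sigma>2: "2 * B * \<sigma>\<^sup>2 / \<eta>\<^sup>2 \<le> e / 3"
  proof -
    have "2 * B * \<sigma>\<^sup>2 / \<eta>\<^sup>2 = (e / 3) * (2 * B / (2 * B + 1))"
      using \<eta> e B0 by (simp add: \<sigma>_def power_mult_distrib)
    also have "\<dots> \<le> (e / 3) * 1" using e B0 by (intro mult_left_mono) auto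
    finally show ?thesis by simp
  qed
  define k where "k x = complex_of_real (?n (x / \<sigma>) / \<sigma>)" for x
  have ik: "integrable lborel k"
    using lborel_integrable_real_affine[OF integrable_std_normal, of "1 / \<sigma>" 0] \<sigma>
    by (simp add: k_def[abs_def] mult.commute[of _ "1 / \<sigma>"])
  define f' where "f' = bconv f0 k"
  have f'_eq: "f' u = (LINT v|lborel. ?n v * f0 (u - \<sigma> * v))" for u
    using lborel_integral_real_affine[of "- \<sigma>" "\<lambda>s. f0 s * k (u - s)" u] \<sigma>
    by (simp add: f'_def bconv_def k_def scaleR_conv_of_real mult.commute)
  have in0: "integrable lborel ?n" using integrable_std_normal_moment[of 0] by simp
  have n0: "?n v \<ge> 0" for v by (simp add: normal_density_nonneg)
  have if': "integrable lborel f'" unfolding f'_def by (rule integrable_bconv[OF if0 ik])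
  have cf': "continuous_on UNIV f'"
    unfolding f'_eq[abs_def]
  proof (rule continuous_on_integral_param)
    show "integrable lborel (\<lambda>v. ?n v * B)" using in0 by simp
    show "norm (?n v * f0 (u - \<sigma> * v)) \<le> ?n v * B" for u v
      using n0[of v] B by (simp add: norm_mult mult_left_mono)
    show "continuous_on UNIV (\<lambda>u. ?n v * f0 (u - \<sigma> * v))" for v
      by (intro continuous_intros continuous_on_compose2[OF c0]) auto
  qed measurable
  \<comment> \<open>For each fixed v the argument U j - \<sigma> v eventually leaves the support of
    \<open>f0\<close>, so the integrand is eventually 0 and dominated convergence applies.\<close>
  have lim: "(\<lambda>j. f' (U j)) \<longlonglongrightarrow> 0" if U: "\<And>v. \<forall>\<^sub>F j in sequentially. \<bar>U j - v\<bar> \<ge> R" for U :: "nat \<Rightarrow> real"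
  proof -
    have "(\<lambda>j. LINT v|lborel. ?n v * f0 (U j - \<sigma> * v)) \<longlonglongrightarrow> integral\<^sup>L lborel (\<lambda>v :: real. 0 :: complex)"
    proof (rule integral_dominated_convergence[where w = "\<lambda>v. ?n v * B"])
      show "integrable lborel (\<lambda>v. ?n v * B)" using in0 by simp
      show "AE v in lborel. norm (?n v * f0 (U j - \<sigma> * v)) \<le> ?n v * B" for j
        using n0 B by (intro AE_I2) (simp add: norm_mult mult_left_mono)
      show "AE v in lborel. (\<lambda>j. ?n v * f0 (U j - \<sigma> * v)) \<longlonglongrightarrow> 0"
      proof (rule AE_I2)
        fix v
        have "\<forall>\<^sub>F j in sequentially. ?n v * f0 (U j - \<sigma> * v) = 0"
          using U[of "\<sigma> * v"] by eventually_elim (simp add: R)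
        then show "(\<lambda>j. ?n v * f0 (U j - \<sigma> * v)) \<longlonglongrightarrow> 0" by (rule tendsto_eventually)
      qed
    qed measurable
    then show ?thesis by (simp add: f'_eq)
  qed
  have C0: "C0fun f'"
    unfolding C0fun_def at_infinity_eq_at_top_bot
  proof (intro conjI cf' filterlim_sup)
    show "(f' \<longlongrightarrow> 0) at_top"
    proof (rule tendsto_at_topI_sequentially)
      fix U :: "nat \<Rightarrow> real" assume U: "filterlim U at_top sequentially"
      show "(\<lambda>j. f' (U j)) \<longlonglongrightarrow> 0"
      proof (rule lim)
        fix v
        have "\<forall>\<^sub>F j in sequentially. U j \<ge> v + R" using U by (auto simp: filterlim_at_top)
        then show "\<forall>\<^sub>F j in sequentially. R \<le> \<bar>U j - v\<bar>" by eventually_elim auto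
      qed
    qed
    show "(f' \<longlongrightarrow> 0) at_bot"
    proof (rule tendsto_at_botI_sequentially)
      fix U :: "nat \<Rightarrow> real" assume U: "filterlim U at_bot sequentially"
      show "(\<lambda>j. f' (U j)) \<longlonglongrightarrow> 0"
      proof (rule lim)
        fix v
        have "\<forall>\<^sub>F j in sequentially. U j \<le> v - R" using U by (auto simp: filterlim_at_bot)
        then show "\<forall>\<^sub>F j in sequentially. R \<le> \<bar>U j - v\<bar>" by eventually_elim auto
      qed
    qed
  qed
  define F0 where "F0 t = (LINT s|lborel. f0 s * cis (- 1 * (t * s)))" for t
  \<comment> \<open>Turns the density at \<sigma> t into exp (- (\<sigma> t)^2 / 2) / (2 pi), the
    normalisation demanded by \<open>fourier_pair\<close>.\<close>
  define \<kappa> where "\<kappa> = complex_of_real (sqrt (2 * pi) / (2 * pi))"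
  define c where "c = (\<lambda>t. complex_of_real (?n (\<sigma> * t)) * (F0 t * \<kappa>))"
  have c_eq: "2 * pi * c t = F0 t * exp (- (\<sigma> * t)\<^sup>2 / 2)" for t
  proof -
    have "?n (\<sigma> * t) * (sqrt (2 * pi) / (2 * pi)) * (2 * pi) = exp (- (\<sigma> * t)\<^sup>2 / 2)"
      by (simp add: std_normal_density_def)
    then have "complex_of_real (?n (\<sigma> * t)) * \<kappa> * complex_of_real (2 * pi) = complex_of_real (exp (- (\<sigma> * t)\<^sup>2 / 2))"
      unfolding \<kappa>_def of_real_mult[symmetric] by simp
    moreover have "2 * pi * c t = F0 t * (complex_of_real (?n (\<sigma> * t)) * \<kappa> * complex_of_real (2 * pi))"
      by (simp add: c_def mult_ac)
    ultimately show ?thesis by simp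
  qed
  have F0c: "continuous_on UNIV F0"
    unfolding F0_def[abs_def] by (rule continuous_on_fourier_integral[OF if0])
  have F0b: "norm (F0 t) \<le> (LINT s|lborel. norm (f0 s)) * 1" for t
    unfolding F0_def by (rule norm_integral_mult_le[OF if0]) auto
  have khat: "(LINT v|lborel. k v * cis (- (v * t))) = exp (- (\<sigma> * t)\<^sup>2 / 2)" for t
  proof -
    have "(LINT v|lborel. k v * cis (- (v * t))) = \<sigma> *\<^sub>R (LINT v|lborel. k (0 + \<sigma> * v) * cis (- ((0 + \<sigma> * v) * t)))"
      by (rule integral_affine[OF \<sigma>])
    also have "\<dots> = (LINT v|lborel. \<sigma> *\<^sub>R (k (0 + \<sigma> * v) * cis (- ((0 + \<sigma> * v) * t))))"
      by simp
    also have "\<dots> = (LINT v|lborel. ?n v * cis ((- (\<sigma> * t)) * v))"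
      using \<sigma> by (intro Bochner_Integration.integral_cong refl) (simp add: k_def scaleR_conv_of_real mult_ac)
    also have "\<dots> = exp (- (\<sigma> * t)\<^sup>2 / 2)" by (subst gaussian_fourier) simp
    finally show ?thesis .
  qed
  have f'hat: "(LINT u|lborel. f' u * cis (- (u * t))) = 2 * pi * c t" for t
  proof -
    have "(LINT u|lborel. f' u * cis (- (u * t))) = (LINT s|lborel. LINT v|lborel. f0 s * k v * cis (- ((s + v) * t)))"
      unfolding f'_def by (rule bconv_pairing[OF if0 ik, where B = 1]) auto
    also have "\<dots> = (LINT s|lborel. f0 s * cis (- 1 * (t * s)) * (LINT v|lborel. k v * cis (- (v * t))))"
    proof (rule Bochner_Integration.integral_cong[OF refl])
      fix s
      have "(LINT v|lborel. f0 s * k v * cis (- ((s + v) * t)))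
         = (LINT v|lborel. f0 s * cis (- 1 * (t * s)) * (k v * cis (- (v * t))))"
      proof (rule Bochner_Integration.integral_cong[OF refl])
        fix v
        have "cis (- ((s + v) * t)) = cis (- 1 * (t * s)) * cis (- (v * t))"
          by (simp add: cis_mult algebra_simps)
        then show "f0 s * k v * cis (- ((s + v) * t)) = f0 s * cis (- 1 * (t * s)) * (k v * cis (- (v * t)))"
          by (simp only: mult_ac)
      qed
      then show "(LINT v|lborel. f0 s * k v * cis (- ((s + v) * t)))
         = f0 s * cis (- 1 * (t * s)) * (LINT v|lborel. k v * cis (- (v * t)))" by simp
    qed
    also have "\<dots> = 2 * pi * c t"
      by (simp only: khat integral_mult_left_zero c_eq F0_def)
    finally show ?thesis .
  qed
  have cc: "continuous_on UNIV c"
    unfolding c_def std_normal_density_def by (intro continuous_intros F0c) auto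
  have ic: "integrable lborel c"
    unfolding c_def
  proof (rule integrable_mult_bounded)
    show "integrable lborel (\<lambda>t. complex_of_real (?n (\<sigma> * t)))"
      using lborel_integrable_real_affine[OF integrable_std_normal, of \<sigma> 0] \<sigma> by simp
    show "(\<lambda>t. F0 t * \<kappa>) \<in> borel_measurable borel"
      by (intro borel_measurable_continuous_onI continuous_intros F0c)
    show "norm (F0 t * \<kappa>) \<le> (LINT s|lborel. norm (f0 s)) * 1 * norm \<kappa>" for t
      unfolding norm_mult by (intro mult_right_mono F0b) simp
  qed
  have f'inv: "f' u = (LINT t|lborel. c t * cis (u * t))" for u
  proof -
    obtain Bf where Bf: "\<And>t. norm (f' t) \<le> Bf" using C0fun_bounded[OF C0] by blast
    \<comment> \<open>\<open>fourier_inversion\<close> starts from the transform with the positive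
      sign, hence the reflected density c (- w).\<close>
    have "(LINT w|lborel. (2 * pi * c (- w)) * cis (- (w * u))) = 2 * pi * f' u"
    proof (rule fourier_inversion[OF cf' if' Bf])
      show "2 * pi * c (- w) = (LINT t|lborel. f' t * cis (w * t))" for w
        using f'hat[of "-w"] by (simp add: mult.commute)
      show "integrable lborel (\<lambda>w. 2 * pi * c (- w))"
        using lborel_integrable_real_affine[OF ic, of "-1" 0] by simp
    qed
    moreover have "(LINT w|lborel. (2 * pi * c (- w)) * cis (- (w * u))) = (LINT w|lborel. (2 * pi * c w) * cis (w * u))"
      using lborel_integral_real_affine[of "-1" "\<lambda>w. (2 * pi * c w) * cis (w * u)" 0] by simp
    ultimately show ?thesis by (simp add: mult.assoc mult.commute[of u])
  qed
  have close: "norm (f0 u - f' u) \<le> 2 * e / 3" for u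
  proof -
    have in2: "integrable lborel (\<lambda>v. ?n v * v\<^sup>2)" using integrable_std_normal_moment[of 2] by simp
    have i1: "integrable lborel (\<lambda>v. complex_of_real (?n v) * (f0 u - f0 (u - \<sigma> * v)))"
    proof (rule integrable_mult_bounded[OF integrable_std_normal, where B = "2 * B"])
      show "norm (f0 u - f0 (u - \<sigma> * v)) \<le> 2 * B" for v
        using norm_triangle_ineq4[of "f0 u" "f0 (u - \<sigma> * v)"] B[of u] B[of "u - \<sigma> * v"] by linarith
    qed measurable
    have i2: "integrable lborel (\<lambda>v. complex_of_real (?n v) * f0 (u - \<sigma> * v))"
      by (rule integrable_mult_bounded[OF integrable_std_normal, where B = B]) (use B in auto)
    have "(LINT v|lborel. ?n v * f0 u) = f0 u"
      using integral_std_normal by (simp add: integral_complex_of_real)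
    then have "f0 u - f' u = (LINT v|lborel. ?n v * f0 u) - (LINT v|lborel. ?n v * f0 (u - \<sigma> * v))"
      by (simp add: f'_eq)
    also have "\<dots> = (LINT v|lborel. ?n v * f0 u - ?n v * f0 (u - \<sigma> * v))"
      by (rule Bochner_Integration.integral_diff[symmetric, OF integrable_mult_left[OF integrable_std_normal] i2])
    also have "\<dots> = (LINT v|lborel. ?n v * (f0 u - f0 (u - \<sigma> * v)))"
      by (simp only: right_diff_distrib)
    also have "norm \<dots> \<le> (LINT v|lborel. norm (?n v * (f0 u - f0 (u - \<sigma> * v))))"
      by (rule integral_norm_bound)
    also have "\<dots> \<le> (LINT v|lborel. (e / 3) * ?n v + (2 * B * \<sigma>\<^sup>2 / \<eta>\<^sup>2) * (?n v * v\<^sup>2))"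
    proof (rule integral_mono)
      show "integrable lborel (\<lambda>v. norm (?n v * (f0 u - f0 (u - \<sigma> * v))))"
        using i1 by (rule integrable_norm)
      show "integrable lborel (\<lambda>v. (e / 3) * ?n v + (2 * B * \<sigma>\<^sup>2 / \<eta>\<^sup>2) * (?n v * v\<^sup>2))"
        using in0 in2 by simp
      fix v
      \<comment> \<open>Chebyshev's inequality in pointwise form: where |\<sigma> v| is at least
        \<eta>, the trivial bound 2 B may be multiplied by (\<sigma> v / \<eta>)^2.\<close>
      have "norm (f0 u - f0 (u - \<sigma> * v)) \<le> e / 3 + 2 * B * (\<sigma>\<^sup>2 * v\<^sup>2 / \<eta>\<^sup>2)"
      proof (cases "\<bar>\<sigma> * v\<bar> < \<eta>")
        case True
        then have "norm (f0 u - f0 (u - \<sigma> * v)) < e / 3" by (intro \<eta>(2)) simp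
        moreover have "0 \<le> 2 * B * (\<sigma>\<^sup>2 * v\<^sup>2 / \<eta>\<^sup>2)" using B0 by simp
        ultimately show ?thesis by linarith
      next
        case False
        then have "\<eta>\<^sup>2 \<le> \<bar>\<sigma> * v\<bar>\<^sup>2" using \<eta> by (intro power_mono) auto
        then have "1 \<le> \<sigma>\<^sup>2 * v\<^sup>2 / \<eta>\<^sup>2" using \<eta> by (simp add: power_mult_distrib)
        then have "2 * B * 1 \<le> 2 * B * (\<sigma>\<^sup>2 * v\<^sup>2 / \<eta>\<^sup>2)" using B0 by (intro mult_left_mono) auto
        moreover have "norm (f0 u - f0 (u - \<sigma> * v)) \<le> 2 * B"
          using norm_triangle_ineq4[of "f0 u" "f0 (u - \<sigma> * v)"] B[of u] B[of "u - \<sigma> * v"] by linarith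
        ultimately show ?thesis using e by linarith
      qed
      then have "?n v * norm (f0 u - f0 (u - \<sigma> * v)) \<le> ?n v * (e / 3 + 2 * B * (\<sigma>\<^sup>2 * v\<^sup>2 / \<eta>\<^sup>2))"
        by (rule mult_left_mono[OF _ n0])
      also have "\<dots> = (e / 3) * ?n v + (2 * B * \<sigma>\<^sup>2 / \<eta>\<^sup>2) * (?n v * v\<^sup>2)"
        by (simp only: distrib_left mult_ac times_divide_eq_left times_divide_eq_right)
      finally show "norm (?n v * (f0 u - f0 (u - \<sigma> * v))) \<le> (e / 3) * ?n v + (2 * B * \<sigma>\<^sup>2 / \<eta>\<^sup>2) * (?n v * v\<^sup>2)"
        using n0[of v] by (simp only: norm_mult norm_of_real abs_of_nonneg)
    qed
    also have "\<dots> = (e / 3) * 1 + (2 * B * \<sigma>\<^sup>2 / \<eta>\<^sup>2) * 1"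
    proof -
      have "(LINT v|lborel. ?n v * v\<^sup>2) = 1" using integral_std_normal_moment_even[of 1] by simp
      then show ?thesis
        using integral_std_normal in0 in2
        by (subst Bochner_Integration.integral_add) (simp_all only: integrable_mult_right integral_mult_right_zero simp_thms)
    qed
    also have "\<dots> \<le> 2 * e / 3" using \<sigma>2 by simp
    finally show ?thesis .
  qed
  have "norm (f t - f' t) \<le> e" for t
    using norm_triangle_ineq[of "f t - f0 t" "f0 t - f' t"] f0[of t] close[of t] by simp
  moreover have "fourier_pair f' c"
    unfolding fourier_pair_def by (intro conjI allI C0 if' ic cc f'inv) (simp add: f'hat)
  ultimately show ?thesis by blast
qed

section \<open>Exponentials on the half-line, the Poisson kernel and the Gamma kernel\<close>

lemma integral_FTC_halfline:
  fixes f F :: "real \<Rightarrow> complex"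
  assumes F: "\<And>t. (F has_vector_derivative f t) (at t)" and f: "\<And>t. isCont f t"
    and i: "set_integrable lborel {0<..} f" and lim: "(F \<longlongrightarrow> 0) at_top"
  shows "(LINT t:{0<..}|lborel. f t) = - F 0"
proof -
  have ei: "einterval (ereal 0) \<infinity> = {0<..}"
    by (auto simp: einterval_def)
  have "isCont F 0" using F[of 0] by (rule has_vector_derivative_continuous)
  then have "(F \<longlongrightarrow> F 0) (at_right 0)"
    unfolding isCont_def by (rule tendsto_within_subset) simp
  then have "(LBINT t=ereal 0..\<infinity>. f t) = 0 - F 0"
    using i lim
    by (intro interval_integral_FTC_integrable) (simp_all only: ei ereal_tendsto_simps, simp_all add: F f)
  then show ?thesis by (simp add: interval_integral_to_infinity_eq)
qed

text \<open>Up to a constant this is an Erlang density, whose total mass is finite.\<close>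

lemma integrable_power_exp_halfline:
  fixes l :: real
  assumes "l > 0"
  shows "set_integrable lborel {0<..} (\<lambda>t. t ^ k * exp (- (t * l)))"
proof -
  have i: "integrable lborel (erlang_density k l)"
  proof (rule integrableI_nonneg)
    show "(\<integral>\<^sup>+ x. ennreal (erlang_density k l x) \<partial>lborel) < \<infinity>"
      using nn_integral_erlang_ith_moment[OF assms, of k 0] by simp
  qed (use assms in auto)
  have "set_integrable lborel {0<..} (\<lambda>t. fact k / l ^ Suc k * erlang_density k l t)"
    unfolding set_integrable_def using i by (intro integrable_mult_indicator integrable_mult_right) auto
  then show ?thesis
    unfolding set_integrable_def
    by (rule Bochner_Integration.integrable_cong[THEN iffD1, rotated 2])
       (use assms in \<open>auto simp: erlang_density_def indicator_def field_simps\<close>)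
qed

lemma
  fixes z :: complex
  assumes z: "Re z > 0"
  shows integrable_exp_halfline: "set_integrable lborel {0<..} (\<lambda>t. exp (- (of_real t * z)))"
    and integral_exp_halfline: "(LINT t:{0<..}|lborel. exp (- (of_real t * z))) = 1 / z"
    and integrable_ident_exp_halfline: "set_integrable lborel {0<..} (\<lambda>t. of_real t * exp (- (of_real t * z)))"
    and integral_ident_exp_halfline: "(LINT t:{0<..}|lborel. of_real t * exp (- (of_real t * z))) = 1 / z\<^sup>2"
proof -
  have z0: "z \<noteq> 0" using z by auto
  show i0: "set_integrable lborel {0<..} (\<lambda>t. exp (- (of_real t * z)))"
    using integrable_power_exp_halfline[OF z, of 0] unfolding set_integrable_def
    by (rule Bochner_Integration.integrable_bound) (auto simp: indicator_def)
  show i1: "set_integrable lborel {0<..} (\<lambda>t. of_real t * exp (- (of_real t * z)))"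
    using integrable_power_exp_halfline[OF z, of 1] unfolding set_integrable_def
    by (rule Bochner_Integration.integrable_bound) (auto simp: indicator_def norm_mult)
  have lim0: "((\<lambda>t. exp (- (of_real t * z))) \<longlongrightarrow> 0) at_top"
  proof (rule tendsto_norm_zero_cancel)
    have "((\<lambda>t. exp (- (t * Re z))) \<longlongrightarrow> 0) at_top"
      using z by real_asymp
    then show "((\<lambda>t. norm (exp (- (of_real t * z)))) \<longlongrightarrow> 0) at_top" by simp
  qed
  have lim1: "((\<lambda>t. of_real t * exp (- (of_real t * z))) \<longlongrightarrow> 0) at_top"
  proof (rule tendsto_norm_zero_cancel)
    have "((\<lambda>t. \<bar>t\<bar> * exp (- (t * Re z))) \<longlongrightarrow> 0) at_top"
      using z by real_asymp
    then show "((\<lambda>t. norm (of_real t * exp (- (of_real t * z)))) \<longlongrightarrow> 0) at_top" by (simp add: norm_mult)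
  qed
  have "(LINT t:{0<..}|lborel. exp (- (of_real t * z))) = - (- exp (- (of_real 0 * z)) / z)"
  proof (rule integral_FTC_halfline[OF _ _ i0])
    show "((\<lambda>t. - exp (- (of_real t * z)) / z) has_vector_derivative exp (- (of_real t * z))) (at t)" for t
      using z0 by (auto intro!: derivative_eq_intros has_vector_derivative_real_field simp: field_simps)
    show "isCont (\<lambda>t. exp (- (of_real t * z))) t" for t by (intro continuous_intros)
    show "((\<lambda>t. - exp (- (of_real t * z)) / z) \<longlongrightarrow> 0) at_top"
      using tendsto_divide[OF tendsto_minus[OF lim0] tendsto_const z0] by simp
  qed
  then show "(LINT t:{0<..}|lborel. exp (- (of_real t * z))) = 1 / z" by simp
  have "(LINT t:{0<..}|lborel. of_real t * exp (- (of_real t * z)))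
      = - (- (of_real 0 * exp (- (of_real 0 * z))) / z - exp (- (of_real 0 * z)) / z\<^sup>2)"
  proof (rule integral_FTC_halfline[OF _ _ i1])
    show "((\<lambda>t. - (of_real t * exp (- (of_real t * z))) / z - exp (- (of_real t * z)) / z\<^sup>2)
        has_vector_derivative of_real t * exp (- (of_real t * z))) (at t)" for t
      using z0 by (auto intro!: derivative_eq_intros has_vector_derivative_real_field simp: field_simps power2_eq_square)
    show "isCont (\<lambda>t. of_real t * exp (- (of_real t * z))) t" for t by (intro continuous_intros)
    show "((\<lambda>t. - (of_real t * exp (- (of_real t * z))) / z - exp (- (of_real t * z)) / z\<^sup>2) \<longlongrightarrow> 0) at_top"
      using tendsto_diff[OF tendsto_divide[OF tendsto_minus[OF lim1] tendsto_const z0]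
          tendsto_divide[OF lim0 tendsto_const[of "z\<^sup>2"]]] z0 by simp
  qed
  then show "(LINT t:{0<..}|lborel. of_real t * exp (- (of_real t * z))) = 1 / z\<^sup>2" by simp
qed

lemma integrable_inverse_square:
  assumes "a > 0"
  shows "integrable lborel (\<lambda>u :: real. 1 / (a\<^sup>2 + u\<^sup>2))"
proof -
  have "integrable lborel (\<lambda>x :: real. inverse (1 + x\<^sup>2))"
    using integrable_inverse_1_plus_square by (simp add: set_integrable_def einterval_def)
  from lborel_integrable_real_affine[OF this, of "1 / a" 0]
  have "integrable lborel (\<lambda>x :: real. (1 / a\<^sup>2) * inverse (1 + (x / a)\<^sup>2))"
    using assms by simp
  moreover have "(1 / a\<^sup>2) * inverse (1 + (x / a)\<^sup>2) = 1 / (a\<^sup>2 + x\<^sup>2)" for x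
    using assms by (simp add: field_simps power_divide)
  ultimately show ?thesis by simp
qed

definition poisson_kernel :: "real \<Rightarrow> real \<Rightarrow> real" where
  "poisson_kernel a s = a / (pi * (s\<^sup>2 + a\<^sup>2))"

lemma integrable_poisson_kernel:
  assumes "a > 0" shows "integrable lborel (poisson_kernel a)"
proof -
  have "integrable lborel (\<lambda>s. a / pi * (1 / (a\<^sup>2 + s\<^sup>2)))"
    by (intro integrable_mult_right integrable_inverse_square assms)
  then show ?thesis by (simp add: poisson_kernel_def[abs_def] add.commute)
qed

text \<open>The opposite direction is elementary: exp (- a |t|) splits at 0 into two exponentials
  with transforms 1 / (a - iv) and 1 / (a + iv), whose sum is 2 pi times the kernel.
  \<open>fourier_inversion\<close> turns this round.\<close>

lemma poisson_kernel_fourier: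
  assumes a: "a > 0"
  shows "(LINT s|lborel. of_real (poisson_kernel a s) * cis (s * t)) = of_real (exp (- a * \<bar>t\<bar>))"
proof -
  define g where "g t = complex_of_real (exp (- a * \<bar>t\<bar>))" for t
  define G where "G u = complex_of_real (2 * pi * poisson_kernel a u)" for u
  have half: "set_integrable lborel {0<..} (\<lambda>t. g t * cis (v * t))"
    "(LINT t:{0<..}|lborel. g t * cis (v * t)) = 1 / Complex a (- v)" for v
  proof -
    have eq: "g t * cis (v * t) = exp (- (of_real t * Complex a (- v)))" if "t \<in> {0<..}" for t
      using that by (simp add: g_def cis_conv_exp exp_of_real[symmetric] mult_exp_exp complex_eq_iff flip: exp_of_real)
        (simp add: exp_eq_polar complex_eq_iff Complex_eq mult_ac)
    show "set_integrable lborel {0<..} (\<lambda>t. g t * cis (v * t))"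
      using integrable_exp_halfline[of "Complex a (- v)"] a
      by (subst set_integrable_cong[OF refl refl eq]) auto
    show "(LINT t:{0<..}|lborel. g t * cis (v * t)) = 1 / Complex a (- v)"
      using integral_exp_halfline[of "Complex a (- v)"] a
      by (subst set_lebesgue_integral_cong[where g = "\<lambda>t. exp (- (of_real t * Complex a (- v)))"]) (use eq in auto)
  qed
  have split: "integrable lborel (\<lambda>t. g t * cis (v * t))"
    "(LINT t|lborel. g t * cis (v * t)) = 1 / Complex a (- v) + 1 / Complex a v" for v
  proof -
    define p where "p t = indicator {0<..} t *\<^sub>R (g t * cis (v * t))" for t
    define q where "q t = indicator {0<..} t *\<^sub>R (g t * cis ((- v) * t))" for t
    have pq: "integrable lborel p" "integrable lborel q"
      "integral\<^sup>L lborel p = 1 / Complex a (- v)" "integral\<^sup>L lborel q = 1 / Complex a v"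
      using half[of v] half[of "-v"] by (simp_all add: p_def[abs_def] q_def[abs_def] set_integrable_def set_lebesgue_integral_def)
    have q': "integrable lborel (\<lambda>t. q (- t))" "(LINT t|lborel. q (- t)) = 1 / Complex a v"
      using lborel_integrable_real_affine[OF pq(2), of "-1" 0] lborel_integral_real_affine[of "-1" q 0] pq(4) by simp_all
    \<comment> \<open>The two open half-lines miss the point 0, so the splitting holds almost
      everywhere only.\<close>
    have ae: "AE t in lborel. p t + q (- t) = g t * cis (v * t)"
    proof (rule AE_mp[OF AE_lborel_singleton[of 0]], rule AE_I2, rule impI)
      fix t :: real assume "t \<noteq> 0"
      then show "p t + q (- t) = g t * cis (v * t)"
        by (cases "t > 0") (auto simp: p_def q_def g_def)
    qed
    have [measurable]: "g \<in> borel_measurable borel" unfolding g_def by measurable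
    have m: "(\<lambda>t. g t * cis (v * t)) \<in> borel_measurable lborel" by measurable
    have [measurable]: "p \<in> borel_measurable lborel" "(\<lambda>t. q (-t)) \<in> borel_measurable lborel"
      using pq q' by (auto dest: borel_measurable_integrable)
    show "integrable lborel (\<lambda>t. g t * cis (v * t))"
      using integrable_cong_AE[of "\<lambda>t. p t + q (- t)" lborel, OF _ m ae] pq q' by auto
    show "(LINT t|lborel. g t * cis (v * t)) = 1 / Complex a (- v) + 1 / Complex a v"
      using integral_cong_AE[of "\<lambda>t. p t + q (- t)" lborel, OF _ m ae] pq q' by auto
  qed
  have "(LINT u|lborel. G u * cis (- (u * (- t)))) = 2 * pi * g (- t)"
  proof (rule fourier_inversion)
    show "continuous_on UNIV g" unfolding g_def by (intro continuous_intros)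
    show "integrable lborel g" using split(1)[of 0] by simp
    show "norm (g t) \<le> 1" for t using a by (simp add: g_def)
    show "G u = (LINT t|lborel. g t * cis (u * t))" for u
    proof -
      have nz: "Complex a u \<noteq> 0" "Complex a (- u) \<noteq> 0" using a by (auto simp: complex_eq_iff)
      have "a\<^sup>2 + u\<^sup>2 \<noteq> 0" using a by (simp add: sum_power2_eq_zero_iff)
      have "1 / Complex a (- u) + 1 / Complex a u = (Complex a u + Complex a (- u)) / (Complex a (- u) * Complex a u)"
        using nz by (simp add: field_simps)
      also have "\<dots> = of_real (2 * a) / of_real (a\<^sup>2 + u\<^sup>2)"
        by (intro arg_cong2[of _ _ _ _ "(/)"]) (auto simp: complex_eq_iff power2_eq_square)
      also have "\<dots> = G u"
        unfolding G_def poisson_kernel_def of_real_divide[symmetric]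
        by (rule arg_cong[of _ _ of_real]) (simp add: add.commute)
      finally show ?thesis using split(2)[of u] by simp
    qed
    show "integrable lborel G"
      unfolding G_def using integrable_poisson_kernel[OF a] by (intro integrable_of_real integrable_mult_right)
  qed
  then have "2 * pi * (LINT s|lborel. of_real (poisson_kernel a s) * cis (s * t)) = 2 * pi * g t"
    by (simp add: G_def g_def mult.assoc)
  then show ?thesis by (simp add: g_def)
qed

lemma poisson_kernel_nonneg: "a > 0 \<Longrightarrow> 0 \<le> poisson_kernel a s"
  by (simp add: poisson_kernel_def)

lemma integral_poisson_kernel:
  assumes "a > 0" shows "(LINT s|lborel. poisson_kernel a s) = 1"
proof -
  have "complex_of_real (LINT s|lborel. poisson_kernel a s) = 1"
    using poisson_kernel_fourier[OF assms, of 0] by (simp add: integral_complex_of_real)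
  then show ?thesis by (simp only: of_real_eq_1_iff)
qed

text \<open>The density of the Gamma distribution with shape 2 and rate \<open>l\<close>: an approximate identity
  supported on the half-line whose Fourier transform is integrable.\<close>

definition gamma2 :: "real \<Rightarrow> real \<Rightarrow> complex" where
  "gamma2 l t = of_real (l\<^sup>2 * max 0 t * exp (- (l * max 0 t)))"

lemma gamma2_neg: "t < 0 \<Longrightarrow> gamma2 l t = 0"
  by (simp add: gamma2_def)

lemma continuous_gamma2: "continuous_on UNIV (gamma2 l)"
  unfolding gamma2_def by (intro continuous_intros)

lemma gamma2_indicator: "gamma2 l t = indicator {0<..} t *\<^sub>R (of_real (l\<^sup>2) * (of_real t * exp (- (of_real t * of_real l))))"
  by (auto simp: gamma2_def indicator_def max_def mult_ac exp_of_real[symmetric])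

lemma integrable_gamma2:
  assumes "l > 0" shows "integrable lborel (gamma2 l)"
proof -
  have "set_integrable lborel {0<..} (\<lambda>t. of_real (l\<^sup>2) * (of_real t * exp (- (of_real t * complex_of_real l))))"
    using integrable_ident_exp_halfline[of "of_real l"] assms by (intro set_integrable_mult_right) auto
  then show ?thesis unfolding set_integrable_def gamma2_indicator[abs_def] .
qed

lemma gamma2_bound:
  assumes "l > 0" shows "norm (gamma2 l t) \<le> l"
proof -
  define x where "x = l * max 0 t"
  have x: "x \<ge> 0" using assms by (simp add: x_def)
  have "x * exp (- x) \<le> 1"
  proof -
    have "x \<le> exp x" using exp_ge_add_one_self[of x] by linarith
    then show ?thesis by (simp add: exp_minus field_simps)
  qed
  then have "l * (x * exp (- x)) \<le> l * 1" using assms by (intro mult_left_mono) auto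
  moreover have "norm (gamma2 l t) = l * (x * exp (- x))"
    using assms x unfolding gamma2_def norm_of_real by (simp add: x_def power2_eq_square abs_mult)
  ultimately show ?thesis by simp
qed

lemma gamma2_fourier:
  assumes l: "l > 0"
  shows "(LINT t|lborel. gamma2 l t * cis (u * t)) = of_real (l\<^sup>2) / (Complex l (- u))\<^sup>2"
proof -
  have "(LINT t|lborel. gamma2 l t * cis (u * t))
     = (LINT t|lborel. of_real (l\<^sup>2) * (indicator {0<..} t *\<^sub>R (of_real t * exp (- (of_real t * Complex l (- u))))))"
  proof (rule Bochner_Integration.integral_cong[OF refl])
    fix t
    have "exp (- (of_real t * complex_of_real l)) * cis (u * t) = exp (- (of_real t * Complex l (- u)))"
      by (simp add: cis_conv_exp mult_exp_exp Complex_eq algebra_simps)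
    then show "gamma2 l t * cis (u * t) = of_real (l\<^sup>2) * (indicator {0<..} t *\<^sub>R (of_real t * exp (- (of_real t * Complex l (- u)))))"
      unfolding gamma2_indicator by (simp add: mult.assoc indicator_def)
  qed
  also have "\<dots> = of_real (l\<^sup>2) * (LINT t:{0<..}|lborel. of_real t * exp (- (of_real t * Complex l (- u))))"
    unfolding set_lebesgue_integral_def by (rule integral_mult_right_zero)
  finally show ?thesis using integral_ident_exp_halfline[of "Complex l (- u)"] l by simp
qed

text \<open>Shape 2 is what makes the transform integrable: its modulus is l^2 / (l^2 + u^2),
  whereas the transform of the plain exponential density decays only like 1/u.\<close>

lemma gamma2_inversion:
  assumes l: "l > 0"
  shows "\<exists>G. integrable lborel G \<and> (\<forall>t. gamma2 l t = (LINT u|lborel. G u * cis (- (u * t))))"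
proof -
  define G where "G u = complex_of_real (l\<^sup>2) / (Complex l (- u))\<^sup>2" for u
  have nG: "norm (G u) = l\<^sup>2 * (1 / (l\<^sup>2 + u\<^sup>2))" for u
    unfolding G_def norm_divide norm_power by (simp add: cmod_power2 norm_power)
  have [measurable]: "(\<lambda>u. Complex l (- u)) \<in> borel_measurable borel"
    by (intro borel_measurable_continuous_onI) (simp add: Complex_eq, intro continuous_intros)
  have iG: "integrable lborel G"
  proof (rule Bochner_Integration.integrable_bound)
    show "integrable lborel (\<lambda>u. l\<^sup>2 * (1 / (l\<^sup>2 + u\<^sup>2)))"
      by (intro integrable_mult_right integrable_inverse_square l)
    show "G \<in> borel_measurable lborel" unfolding G_def by measurable
    show "AE u in lborel. norm (G u) \<le> norm (l\<^sup>2 * (1 / (l\<^sup>2 + u\<^sup>2)))"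
      unfolding nG by (intro AE_I2) simp
  qed
  have "(LINT u|lborel. G u * cis (- (u * t))) = 2 * pi * gamma2 l t" for t
    by (rule fourier_inversion[OF continuous_gamma2 integrable_gamma2[OF l] gamma2_bound[OF l] _ iG])
       (simp add: G_def gamma2_fourier[OF l])
  then have "(LINT u|lborel. (G u / (2 * pi)) * cis (- (u * t))) = gamma2 l t" for t
    by simp
  then show ?thesis using iG by (intro exI[of _ "\<lambda>u. G u / (2 * pi)"]) auto
qed

section \<open>The spaces \<open>H\<^sup>1\<close> and \<open>\<A>\<^sub>0\<close> through Borel representatives\<close>

text \<open>The definitions use the gauge integral and so admit Lebesgue measurable functions, while
  Fubini is applied to products of the Borel measure. A change on a negligible set reconciles the
  two.\<close>

lemma borel_representative:
  fixes h :: "real \<Rightarrow> complex"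
  assumes "h absolutely_integrable_on UNIV"
  shows "\<exists>h'. integrable lborel h' \<and> negligible {t. h t \<noteq> h' t}"
proof -
  have h: "integrable lebesgue h" using assms by (simp add: set_integrable_def)
  then have hm: "h \<in> borel_measurable lebesgue" by (rule borel_measurable_integrable)
  have "(\<lambda>t. Re (h t)) \<in> borel_measurable lebesgue" "(\<lambda>t. Im (h t)) \<in> borel_measurable lebesgue"
    using hm by measurable
  then obtain r i where ri[measurable]: "r \<in> borel_measurable lborel" "i \<in> borel_measurable lborel"
    and ae: "AE t in lborel. Re (h t) = r t" "AE t in lborel. Im (h t) = i t"
    using completion_ex_borel_measurable_real by metis
  define h' where "h' t = of_real (r t) + \<i> * of_real (i t)" for t
  have m: "h' \<in> borel_measurable lborel" unfolding h'_def by measurable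
  have eq: "AE t in lborel. h t = h' t"
    using ae by eventually_elim (simp add: h'_def complex_eq_iff)
  then have eq': "AE t in lebesgue. h t = h' t" by (rule AE_completion)
  have "integrable lebesgue h'"
    using integrable_cong_AE[OF hm measurable_completion[OF m] eq'] h by simp
  then have "integrable lborel h'" using integrable_completion[OF m] by simp
  moreover obtain N where "N \<in> null_sets lebesgue" "{t. h t \<noteq> h' t} \<subseteq> N"
    using eq' unfolding eventually_ae_filter by auto
  then have "negligible {t. h t \<noteq> h' t}"
    using negligible_iff_null_sets negligible_subset by blast
  ultimately show ?thesis by blast
qed

text \<open>For integrable Borel functions this agrees with \<open>fourier\<close>. The factor
  \<open>- 1\<close> is written out so that the integrand is literally an instance of
  \<open>continuous_on_fourier_integral\<close>.\<close>

definition hft :: "(real \<Rightarrow> complex) \<Rightarrow> real \<Rightarrow> complex" where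
  "hft h u = (LINT s|lborel. h s * cis (- 1 * (u * s)))"

text \<open>Transform, norm and convolution see \<open>h\<close> only through integrals, which
  ignore a negligible set. Convolution is preserved for every \<open>f\<close> at once, so a
  representation of an element of A_0 keeps its functions \<open>f\<close>.\<close>

lemma H1fun_representative:
  assumes "H1fun h"
  shows "\<exists>h'. integrable lborel h' \<and> (\<forall>u\<le>0. hft h' u = 0) \<and> (LINT t|lborel. norm (h' t)) = L1norm h \<and>
    (\<forall>f. conv f h = conv f h')"
proof -
  obtain h' where h': "integrable lborel h'" and N: "negligible {t. h t \<noteq> h' t}"
    using borel_representative assms by (auto simp: H1fun_def)
  have spike: "integral UNIV (\<lambda>s. \<phi> s (h s)) = integral UNIV (\<lambda>s. \<phi> s (h' s))" for \<phi> :: "real \<Rightarrow> complex \<Rightarrow> complex"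
    by (rule integral_spike[OF N]) auto
  have spike_norm: "integral UNIV (\<lambda>s. norm (h s)) = integral UNIV (\<lambda>s. norm (h' s))"
    by (rule integral_spike[OF N]) auto
  have "hft h' u = fourier h u" for u
  proof -
    have "integrable lborel (\<lambda>s. h' s * cis (- 1 * (u * s)))"
      by (rule integrable_mult_bounded[OF h', where B = 1]) auto
    then have "hft h' u = integral UNIV (\<lambda>s. h' s * cis (- 1 * (u * s)))"
      unfolding hft_def by (rule integral_lborel[symmetric])
    also have "\<dots> = integral UNIV (\<lambda>s. h s * cis (- 1 * (u * s)))"
      by (rule spike[symmetric])
    also have "\<dots> = fourier h u"
      unfolding fourier_def cis_conv_exp by (simp add: mult.commute)
    finally show ?thesis .
  qed
  moreover have "L1norm h = (LINT t|lborel. norm (h' t))"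
    unfolding L1norm_def spike_norm using h' by (intro integral_lborel integrable_norm)
  moreover have "conv f h = conv f h'" for f
  proof
    fix t
    show "conv f h t = conv f h' t"
      unfolding conv_def by (rule spike[of "\<lambda>s x. f (t - s) * x"])
  qed
  ultimately show ?thesis
    using h' assms unfolding H1fun_def by (intro exI[of _ h']) simp
qed

lemma C0fun_measurable: "C0fun f \<Longrightarrow> f \<in> borel_measurable borel"
  by (simp add: C0fun_def borel_measurable_continuous_onI)

lemma norm_le_supnorm: "C0fun f \<Longrightarrow> norm (f t) \<le> supnorm f"
  unfolding supnorm_def using C0fun_bounded[of f] by (auto intro!: cSUP_upper bdd_aboveI)

lemma supnorm_nonneg: "C0fun f \<Longrightarrow> 0 \<le> supnorm f"
  using norm_le_supnorm[of f 0] norm_ge_zero order_trans by blast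

lemma supnorm_le: "(\<And>t. norm (f t) \<le> K) \<Longrightarrow> supnorm f \<le> K"
  unfolding supnorm_def by (rule cSUP_least) auto

text \<open>If |h| is not integrable, the bound rests on the default value 0 of the gauge
  integral.\<close>

lemma L1norm_nonneg: "0 \<le> L1norm h"
  unfolding L1norm_def
  by (cases "(\<lambda>t. norm (h t)) integrable_on UNIV") (auto intro: integral_nonneg simp: not_integrable_integral)

lemma conv_eq_LINT:
  assumes f: "C0fun f" and h: "integrable lborel h"
  shows "conv f h t = (LINT s|lborel. h s * f (t - s))"
proof -
  note [measurable] = C0fun_measurable[OF f]
  have "integrable lborel (\<lambda>s. h s * f (t - s))"
    by (rule integrable_mult_bounded[OF h, where B = "supnorm f"]) (use norm_le_supnorm[OF f] in auto)
  then have "integral UNIV (\<lambda>s. h s * f (t - s)) = (LINT s|lborel. h s * f (t - s))"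
    by (rule integral_lborel)
  then show ?thesis by (simp add: conv_def mult.commute)
qed

lemma
  assumes f: "C0fun f" and h: "H1fun h"
  shows conv_measurable: "conv f h \<in> borel_measurable borel"
    and norm_conv_le: "norm (conv f h t) \<le> supnorm f * L1norm h"
proof -
  note [measurable] = C0fun_measurable[OF f]
  obtain h' where h': "integrable lborel h'" "(LINT t|lborel. norm (h' t)) = L1norm h" "conv f h = conv f h'"
    using H1fun_representative[OF h] by blast
  then have [measurable]: "h' \<in> borel_measurable borel" by (auto dest: borel_measurable_integrable)
  have "conv f h = (\<lambda>t. LINT s|lborel. h' s * f (t - s))"
    using h' conv_eq_LINT[OF f] by auto
  then show "conv f h \<in> borel_measurable borel" by simp
  show "norm (conv f h t) \<le> supnorm f * L1norm h"
    unfolding h'(3) conv_eq_LINT[OF f h'(1)] h'(2)[symmetric] mult.commute[of "supnorm f"]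
    by (rule norm_integral_mult_le[OF h'(1)]) (use norm_le_supnorm[OF f] in auto)
qed

lemma hft_bound:
  assumes "integrable lborel h" shows "norm (hft h u) \<le> (LINT t|lborel. norm (h t))"
  using norm_integral_mult_le[OF assms, of "\<lambda>s. cis (- 1 * (u * s))" 1] by (simp add: hft_def)

lemma continuous_hft: "integrable lborel h \<Longrightarrow> continuous_on UNIV (hft h)"
  unfolding hft_def[abs_def] by (rule continuous_on_fourier_integral)

lemma conv_fourier_pair:
  assumes n: "fourier_pair f c" and h: "integrable lborel h"
  shows "conv f h t = (LINT r|lborel. (c r * hft h r) * cis (t * r))"
proof -
  have c: "integrable lborel c" and f: "C0fun f" and fc: "\<And>u. f u = (LINT r|lborel. c r * cis (u * r))"
    using n by (auto simp: fourier_pair_def)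
  have "conv f h t = (LINT s|lborel. LINT r|lborel. h s * c r * cis ((t - s) * r))"
    unfolding conv_eq_LINT[OF f h] by (simp add: fc mult.assoc)
  also have "\<dots> = (LINT r|lborel. LINT s|lborel. h s * c r * cis ((t - s) * r))"
    using integrable_pair_mult[OF h c, of "\<lambda>(s, r). cis ((t - s) * r)" 1]
    by (intro lborel_pair.Fubini_integral[symmetric]) simp
  also have "\<dots> = (LINT r|lborel. (c r * hft h r) * cis (t * r))"
  proof (rule Bochner_Integration.integral_cong[OF refl])
    fix r
    have "(LINT s|lborel. h s * c r * cis ((t - s) * r)) = (LINT s|lborel. (h s * cis (- 1 * (r * s))) * (c r * cis (t * r)))"
    proof (rule Bochner_Integration.integral_cong[OF refl])
      fix s
      have "cis ((t - s) * r) = cis (- 1 * (r * s)) * cis (t * r)"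
        by (simp add: cis_mult algebra_simps)
      then show "h s * c r * cis ((t - s) * r) = (h s * cis (- 1 * (r * s))) * (c r * cis (t * r))"
        by (simp only: mult_ac)
    qed
    also have "\<dots> = hft h r * (c r * cis (t * r))"
      unfolding hft_def by (rule integral_mult_left_zero)
    finally show "(LINT s|lborel. h s * c r * cis ((t - s) * r)) = (c r * hft h r) * cis (t * r)"
      by (simp only: mult_ac)
  qed
  finally show ?thesis .
qed

text \<open>The space L^1 (0, \<infinity>), realised by Borel functions on the whole line, so that
  convolutions and Fourier integrals run over the line without restriction.\<close>

definition L1p :: "(real \<Rightarrow> complex) set" where
  "L1p = {b. integrable lborel b \<and> (\<forall>t<0. b t = 0)}"

text \<open>Writing \<open>max 0 t\<close> changes nothing where \<open>b\<close> lives, but keeps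
  the exponential bounded on the whole line. \<open>\<Theta>\<close> and \<open>damp\<close> use the
  same device.\<close>

lemma integrable_bound_exp:
  assumes b: "b \<in> L1p" and z: "0 \<le> Re z"
  shows "integrable lborel (\<lambda>t. b t * exp (- (of_real (max 0 t) * z)))"
proof (rule integrable_mult_bounded)
  show "integrable lborel b" using b by (simp add: L1p_def)
  show "norm (exp (- (complex_of_real (max 0 t) * z))) \<le> 1" for t using z by simp
qed measurable

lemma laplace_eq_LINT:
  assumes b: "b \<in> L1p" and z: "0 < Re z"
  shows "laplace b z = (LINT t|lborel. b t * exp (- (of_real (max 0 t) * z)))"
proof -
  have "laplace b z = integral UNIV (\<lambda>t. if t \<in> {0..} then exp (- (complex_of_real t * z)) * b t else 0)"
    using z by (simp only: laplace_def if_True integral_restrict_UNIV)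
  also have "(\<lambda>t. if t \<in> {0..} then exp (- (complex_of_real t * z)) * b t else 0)
      = (\<lambda>t. b t * exp (- (of_real (max 0 t) * z)))"
    using b by (auto simp: L1p_def fun_eq_iff max_def)
  also have "integral UNIV \<dots> = (LINT t|lborel. b t * exp (- (of_real (max 0 t) * z)))"
    by (intro integral_lborel integrable_bound_exp b) (use z in simp)
  finally show ?thesis .
qed

lemma laplace_add:
  assumes "a \<in> L1p" "b \<in> L1p" "0 < Re z"
  shows "laplace (\<lambda>t. a t + b t) z = laplace a z + laplace b z"
proof -
  have "(\<lambda>t. a t + b t) \<in> L1p" using assms by (auto simp: L1p_def)
  then show ?thesis using assms integrable_bound_exp[of a z] integrable_bound_exp[of b z]
    by (simp add: laplace_eq_LINT distrib_right)
qed

lemma laplace_cmult: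
  assumes "b \<in> L1p" "0 < Re z"
  shows "laplace (\<lambda>t. c * b t) z = c * laplace b z"
proof -
  have "(\<lambda>t. c * b t) \<in> L1p" using assms by (auto simp: L1p_def)
  then show ?thesis using assms by (simp add: laplace_eq_LINT mult.assoc)
qed

lemma norm_laplace_le:
  assumes b: "b \<in> L1p"
  shows "norm (laplace b z) \<le> (LINT t|lborel. norm (b t))"
proof (cases "0 < Re z")
  case True
  have "norm (LINT t|lborel. b t * exp (- (of_real (max 0 t) * z))) \<le> (LINT t|lborel. norm (b t)) * 1"
  proof (rule norm_integral_mult_le)
    show "integrable lborel b" using b by (simp add: L1p_def)
    show "norm (exp (- (complex_of_real (max 0 t) * z))) \<le> 1" for t using True by simp
  qed measurable
  then show ?thesis using laplace_eq_LINT[OF b True] by simp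
qed (simp add: laplace_def)

text \<open>For w = i z one has Re w = - Im z and Im w = Re z; these are the centre and the height
  of the Poisson kernel.\<close>

lemma tildeF_eq_LINT:
  assumes G[measurable]: "G \<in> borel_measurable borel" and K: "\<And>t. norm (G t) \<le> K" and z: "0 < Re z"
  shows "integrable lborel (\<lambda>t. of_real (poisson_kernel (Re z) (- Im z - t)) * G t)"
    and "tildeF G z = (LINT t|lborel. of_real (poisson_kernel (Re z) (- Im z - t)) * G t)"
proof -
  have "integrable lborel (\<lambda>t. poisson_kernel (Re z) (- Im z - t))"
    using lborel_integrable_real_affine[OF integrable_poisson_kernel[OF z], of "-1" "- Im z"] by simp
  then show i: "integrable lborel (\<lambda>t. of_real (poisson_kernel (Re z) (- Im z - t)) * G t)"
    by (intro integrable_mult_bounded[where B = K] integrable_of_real) (use K in auto)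
  have "tildeF G z = integral UNIV (\<lambda>t. of_real (poisson_kernel (Re z) (- Im z - t)) * G t)"
    using z by (simp add: tildeF_def poisson_def poisson_kernel_def)
  then show "tildeF G z = (LINT t|lborel. of_real (poisson_kernel (Re z) (- Im z - t)) * G t)"
    using integral_lborel[OF i] by simp
qed

lemma tildeF_diff:
  assumes G: "G \<in> borel_measurable borel" "\<And>t. norm (G t) \<le> K"
    and H: "H \<in> borel_measurable borel" "\<And>t. norm (H t) \<le> L"
  shows "tildeF (\<lambda>t. G t - H t) z = tildeF G z - tildeF H z"
proof (cases "0 < Re z")
  case True
  have GH: "(\<lambda>t. G t - H t) \<in> borel_measurable borel" "\<And>t. norm (G t - H t) \<le> K + L"
    using G H by (auto intro: order_trans[OF norm_triangle_ineq4 add_mono])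
  show ?thesis
    unfolding tildeF_eq_LINT(2)[OF G True] tildeF_eq_LINT(2)[OF H True] tildeF_eq_LINT(2)[OF GH True]
    using Bochner_Integration.integral_diff[OF tildeF_eq_LINT(1)[OF G True] tildeF_eq_LINT(1)[OF H True]]
    by (simp add: right_diff_distrib)
qed (simp add: tildeF_def)

text \<open>The Poisson kernel is nonnegative with total mass 1. Off the half-plane the default
  value 0 of \<open>tildeF\<close> respects the bound.\<close>

lemma norm_tildeF_le:
  assumes G: "G \<in> borel_measurable borel" "\<And>t. norm (G t) \<le> K"
  shows "norm (tildeF G z) \<le> K"
proof (cases "0 < Re z")
  case True
  let ?P = "\<lambda>t. poisson_kernel (Re z) (- Im z - t)"
  have P: "integrable lborel ?P" "(LINT t|lborel. ?P t) = 1"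
    using lborel_integrable_real_affine[OF integrable_poisson_kernel[OF True], of "-1" "- Im z"]
      lborel_integral_real_affine[of "-1" "poisson_kernel (Re z)" "- Im z"] integral_poisson_kernel[OF True]
    by simp_all
  have "norm (tildeF G z) \<le> (LINT t|lborel. norm (complex_of_real (?P t))) * K"
    unfolding tildeF_eq_LINT(2)[OF G True]
    by (rule norm_integral_mult_le) (use P G in \<open>auto intro: integrable_of_real\<close>)
  then show ?thesis using P poisson_kernel_nonneg[OF True] by simp
next
  case False
  have "0 \<le> K" using norm_ge_zero[of "G 0"] G(2)[of 0] by linarith
  then show ?thesis using False by (simp add: tildeF_def)
qed

text \<open>By Fubini the Poisson integral acts on each character separately: it carries cis (s t)
  to cis (- Im z t) exp (- Re z |t|), which is exp (- t z) precisely when t \<ge> 0. This is where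
  the support of \<open>b\<close> on the half-line produces an analytic function.\<close>

lemma tildeF_fourier:
  assumes b: "b \<in> L1p"
  shows "tildeF (\<lambda>u. LINT t|lborel. b t * cis (u * t)) = laplace b"
proof
  fix z
  show "tildeF (\<lambda>u. LINT t|lborel. b t * cis (u * t)) z = laplace b z"
  proof (cases "0 < Re z")
    case True
    let ?P = "\<lambda>s. complex_of_real (poisson_kernel (Re z) (- Im z - s))"
    have bi: "integrable lborel b" using b by (simp add: L1p_def)
    then have [measurable]: "b \<in> borel_measurable borel" by (auto dest: borel_measurable_integrable)
    have P: "integrable lborel ?P"
      using lborel_integrable_real_affine[OF integrable_poisson_kernel[OF True], of "-1" "- Im z"]
      by (intro integrable_of_real) simp
    have "tildeF (\<lambda>u. LINT t|lborel. b t * cis (u * t)) z = (LINT s|lborel. ?P s * (LINT t|lborel. b t * cis (s * t)))"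
    proof (rule tildeF_eq_LINT(2)[OF _ _ True])
      show "norm (LINT t|lborel. b t * cis (u * t)) \<le> (LINT t|lborel. norm (b t)) * 1" for u
        by (rule norm_integral_mult_le[OF bi]) auto
    qed measurable
    also have "\<dots> = (LINT s|lborel. LINT t|lborel. ?P s * b t * cis (s * t))"
      by (simp add: mult.assoc)
    also have "\<dots> = (LINT t|lborel. LINT s|lborel. ?P s * b t * cis (s * t))"
      using integrable_pair_mult[OF P bi, of "\<lambda>(s, t). cis (s * t)" 1]
      by (intro lborel_pair.Fubini_integral[symmetric]) simp
    also have "\<dots> = (LINT t|lborel. b t * exp (- (of_real (max 0 t) * z)))"
    proof (rule Bochner_Integration.integral_cong[OF refl])
      fix t
      have "(LINT s|lborel. ?P s * b t * cis (s * t)) = (LINT s|lborel. (?P s * cis (s * t)) * b t)"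
        by (simp only: mult_ac)
      also have "\<dots> = (LINT s|lborel. ?P s * cis (s * t)) * b t"
        by (rule integral_mult_left_zero)
      also have "(LINT s|lborel. ?P s * cis (s * t))
          = (LINT s|lborel. of_real (poisson_kernel (Re z) s) * cis ((- Im z - s) * t))"
        using lborel_integral_real_affine[of "-1" "\<lambda>s. ?P s * cis (s * t)" "- Im z"] by simp
      also have "\<dots> = (LINT s|lborel. cis (- Im z * t) * (of_real (poisson_kernel (Re z) s) * cis (s * (- t))))"
      proof (rule Bochner_Integration.integral_cong[OF refl])
        fix s
        have "cis ((- Im z - s) * t) = cis (- Im z * t) * cis (s * (- t))"
          unfolding cis_mult by (rule arg_cong[of _ _ cis]) (simp add: algebra_simps)
        then show "of_real (poisson_kernel (Re z) s) * cis ((- Im z - s) * t)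
          = cis (- Im z * t) * (of_real (poisson_kernel (Re z) s) * cis (s * (- t)))" by (simp only: mult_ac)
      qed
      also have "\<dots> = cis (- Im z * t) * (LINT s|lborel. of_real (poisson_kernel (Re z) s) * cis (s * (- t)))"
        by (rule integral_mult_right_zero)
      also have "\<dots> = cis (- Im z * t) * of_real (exp (- Re z * \<bar>t\<bar>))"
        by (simp only: poisson_kernel_fourier[OF True]) simp
      finally have "(LINT s|lborel. ?P s * b t * cis (s * t)) = cis (- Im z * t) * of_real (exp (- Re z * \<bar>t\<bar>)) * b t" .
      moreover have "cis (- Im z * t) * of_real (exp (- Re z * \<bar>t\<bar>)) = exp (- (of_real (max 0 t) * z))" if "t \<ge> 0"
        using that by (simp add: exp_eq_polar mult_ac)
      ultimately show "(LINT s|lborel. ?P s * b t * cis (s * t)) = b t * exp (- (of_real (max 0 t) * z))"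
        using b by (cases "t \<ge> 0") (auto simp: L1p_def)
    qed
    also have "\<dots> = laplace b z" using laplace_eq_LINT[OF b True] by simp
    finally show ?thesis .
  qed (simp add: tildeF_def laplace_def)
qed

lemma fourier_pair_hft_L1p:
  assumes n: "fourier_pair f c" and h: "integrable lborel h" "\<And>u. u \<le> 0 \<Longrightarrow> hft h u = 0"
  shows "(\<lambda>r. c r * hft h r) \<in> L1p"
  unfolding L1p_def
proof (intro CollectI conjI allI impI)
  show "integrable lborel (\<lambda>r. c r * hft h r)"
  proof (rule integrable_mult_bounded)
    show "integrable lborel c" using n by (simp add: fourier_pair_def)
    show "hft h \<in> borel_measurable borel"
      by (rule borel_measurable_continuous_onI[OF continuous_hft[OF h(1)]])
  qed (rule hft_bound[OF h(1)])
qed (use h in auto)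

section \<open>The key estimate\<close>

lemma coeff_pairing_monom: "coeff_pairing \<phi> (monom a n) = a * \<phi> n"
proof -
  have "coeff_pairing \<phi> (monom a n) = (\<Sum>k\<le>n. coeff (monom a n) k * \<phi> k)"
    by (rule coeff_pairing_eq) (rule degree_monom_le)
  also have "\<dots> = (\<Sum>k\<le>n. if k = n then a * \<phi> n else 0)"
    by (intro sum.cong) auto
  finally show ?thesis by simp
qed

lemma coeff_pairing_sum: "finite A \<Longrightarrow> coeff_pairing \<phi> (\<Sum>i\<in>A. q i) = (\<Sum>i\<in>A. coeff_pairing \<phi> (q i))"
proof (induction A rule: finite_induct)
  case empty
  show ?case by (simp add: coeff_pairing_def)
qed (simp add: coeff_pairing_add)

text \<open>For n \<ge> 1 exactly M - n pairs l < j < M have difference n. Diagonal pairs are absent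
  on the left, and on the right the term n = 0 is removed by \<open>a 0 = 0\<close>.\<close>

lemma fejer_sum:
  fixes a :: "nat \<Rightarrow> complex"
  assumes "a 0 = 0"
  shows "(\<Sum>j<M. \<Sum>l<j. a (j - l)) = (\<Sum>n<M. of_nat (M - n) * a n)"
proof (induction M)
  case (Suc M)
  have "(\<Sum>l<M. a (M - l)) = (\<Sum>l<M. a (Suc (M - Suc l)))"
    by (intro sum.cong) (auto simp: Suc_diff_Suc)
  also have "\<dots> = (\<Sum>i<M. a (Suc i))" by (rule sum.nat_diff_reindex)
  also have "\<dots> = (\<Sum>n<Suc M. a n)" using assms by (simp add: sum.lessThan_Suc_shift del: sum.lessThan_Suc)
  finally have "(\<Sum>j<Suc M. \<Sum>l<j. a (j - l)) = (\<Sum>n<M. of_nat (M - n) * a n) + (\<Sum>n<Suc M. a n)"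
    using Suc by simp
  also have "\<dots> = (\<Sum>n<M. of_nat (M - n) * a n + a n) + a M"
    by (simp add: sum.distrib)
  also have "(\<Sum>n<M. of_nat (M - n) * a n + a n) = (\<Sum>n<M. of_nat (Suc M - n) * a n)"
    by (intro sum.cong) (auto simp: Suc_diff_le algebra_simps)
  finally show ?case by simp
qed simp

definition fejer_kernel :: "nat \<Rightarrow> real \<Rightarrow> real" where
  "fejer_kernel M t = (norm (\<Sum>j<M. cis (real j * t)))\<^sup>2 / M"

lemma fejer_kernel_expand:
  "complex_of_real (fejer_kernel M t) = (\<Sum>j<M. \<Sum>l<M. cis (of_int (int j - int l) * t)) / M"
proof -
  have "complex_of_real ((norm (\<Sum>j<M. cis (real j * t)))\<^sup>2) = (\<Sum>j<M. cis (real j * t)) * cnj (\<Sum>j<M. cis (real j * t))"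
    by (rule complex_norm_square)
  also have "\<dots> = (\<Sum>j<M. \<Sum>l<M. cis (real j * t) * cis (- (real l * t)))"
    by (simp add: sum_product cis_cnj)
  also have "\<dots> = (\<Sum>j<M. \<Sum>l<M. cis (of_int (int j - int l) * t))"
    by (simp add: cis_mult left_diff_distrib)
  finally show ?thesis by (simp add: fejer_kernel_def)
qed

lemma fejer_kernel_bound: "0 \<le> fejer_kernel M t" "M > 0 \<Longrightarrow> fejer_kernel M t \<le> M"
proof -
  show "0 \<le> fejer_kernel M t" by (simp add: fejer_kernel_def)
  assume "M > 0"
  have "norm (\<Sum>j<M. cis (real j * t)) \<le> (\<Sum>j<M. 1)"
    by (rule sum_norm_le) simp
  then have "(norm (\<Sum>j<M. cis (real j * t)))\<^sup>2 \<le> (real M)\<^sup>2"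
    by (intro power_mono) auto
  then show "fejer_kernel M t \<le> M"
    using \<open>M > 0\<close> by (simp add: fejer_kernel_def divide_le_eq power2_eq_square)
qed

lemma continuous_fejer_kernel [continuous_intros]:
  "continuous_on S u \<Longrightarrow> continuous_on S (\<lambda>t. fejer_kernel M (u t))"
  unfolding fejer_kernel_def by (cases "M = 0") (auto intro!: continuous_intros)

lemma fejer_kernel_measurable [measurable]: "fejer_kernel M \<in> borel_measurable borel"
  by (intro borel_measurable_continuous_onI continuous_intros)

lemma integral_fejer_kernel:
  assumes "M > 0"
  shows "integral {-pi..pi} (\<lambda>t. fejer_kernel M (t - a)) = 2 * pi"
proof -
  have i: "(\<lambda>t. cis (of_int (int j - int l) * (t - a))) integrable_on {-pi..pi}" for j l
    by (intro integrable_continuous_real continuous_intros)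
  have "complex_of_real (integral {-pi..pi} (\<lambda>t. fejer_kernel M (t - a)))
      = integral {-pi..pi} (\<lambda>t. complex_of_real (fejer_kernel M (t - a)))"
    by (rule integral_linear[OF _ bounded_linear_of_real, unfolded o_def, symmetric])
       (intro integrable_continuous_real continuous_intros)
  also have "\<dots> = integral {-pi..pi} (\<lambda>t. \<Sum>j<M. \<Sum>l<M. cis (of_int (int j - int l) * (t - a))) / M"
    by (simp only: fejer_kernel_expand integral_divide)
  also have "integral {-pi..pi} (\<lambda>t. \<Sum>j<M. \<Sum>l<M. cis (of_int (int j - int l) * (t - a)))
      = (\<Sum>j<M. \<Sum>l<M. integral {-pi..pi} (\<lambda>t. cis (of_int (int j - int l) * (t - a))))"
    by (simp only: integral_sum[OF finite_lessThan integrable_sum[OF finite_lessThan i]] integral_sum[OF finite_lessThan i])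
  also have "\<dots> = (\<Sum>j<M. \<Sum>l<M. if j = l then complex_of_real (2 * pi) else 0)"
  proof (intro sum.cong refl)
    fix j l
    have "cis (of_int (int j - int l) * (t - a)) = cis (of_int (int j - int l) * t) * cis (- (of_int (int j - int l) * a))" for t
      by (simp add: cis_mult right_diff_distrib)
    then have "integral {-pi..pi} (\<lambda>t. cis (of_int (int j - int l) * (t - a)))
      = integral {-pi..pi} (\<lambda>t. cis (of_int (int j - int l) * t)) * cis (- (of_int (int j - int l) * a))"
      by (simp only: integral_mult_left)
    then show "integral {-pi..pi} (\<lambda>t. cis (of_int (int j - int l) * (t - a))) = (if j = l then complex_of_real (2 * pi) else 0)"
      unfolding cis_integral by auto
  qed
  also have "\<dots> = of_nat M * complex_of_real (2 * pi)" by (simp add: sum.delta)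
  finally have "complex_of_real (integral {-pi..pi} (\<lambda>t. fejer_kernel M (t - a))) = complex_of_real (2 * pi)"
    using assms by simp
  then show ?thesis by (simp only: of_real_eq_iff)
qed

text \<open>Collecting equal differences puts the Fejer weight 1 - n/M on the sample of
  \<open>hft h\<close> at n \<tau>. The uncollected double sum is the form that meets the expansion
  of the Fejer kernel.\<close>

definition fejer_poly :: "(real \<Rightarrow> complex) \<Rightarrow> real \<Rightarrow> nat \<Rightarrow> complex poly" where
  "fejer_poly h \<tau> M = smult (1 / of_nat M) (\<Sum>j<M. \<Sum>l<j. monom (hft h (real (j - l) * \<tau>)) (j - l))"

lemma coeff_pairing_fejer_poly:
  assumes "hft h 0 = 0" and M: "M > 0"
  shows "coeff_pairing \<phi> (fejer_poly h \<tau> M) = (\<Sum>n<M. of_real (1 - n / M) * (hft h (real n * \<tau>) * \<phi> n))"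
proof -
  have "coeff_pairing \<phi> (fejer_poly h \<tau> M) = (\<Sum>j<M. \<Sum>l<j. hft h (real (j - l) * \<tau>) * \<phi> (j - l)) / of_nat M"
    by (simp add: fejer_poly_def coeff_pairing_smult coeff_pairing_sum coeff_pairing_monom)
  also have "\<dots> = (\<Sum>n<M. of_nat (M - n) * (hft h (real n * \<tau>) * \<phi> n)) / of_nat M"
    using fejer_sum[of "\<lambda>n. hft h (real n * \<tau>) * \<phi> n" M] assms by simp
  also have "\<dots> = (\<Sum>n<M. of_real (1 - n / M) * (hft h (real n * \<tau>) * \<phi> n))"
    unfolding sum_divide_distrib
  proof (intro sum.cong refl)
    fix n assume "n \<in> {..<M}"
    then have "complex_of_nat (M - n) / of_nat M = of_real (1 - n / M)"
      using M by (simp add: of_nat_diff diff_divide_distrib)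
    then show "of_nat (M - n) * (hft h (real n * \<tau>) * \<phi> n) / of_nat M = of_real (1 - n / M) * (hft h (real n * \<tau>) * \<phi> n)"
      by (metis times_divide_eq_left)
  qed
  finally show ?thesis .
qed

text \<open>Terms with l \<ge> j carry \<open>hft h\<close> at a nonpositive argument and vanish, so
  the triangular sum completes to the full square, which is the Fejer kernel. This uses that
  \<open>h\<close> lies in H^1.\<close>

lemma poly_fejer_poly:
  assumes h: "integrable lborel h" "\<And>u. u \<le> 0 \<Longrightarrow> hft h u = 0" and \<tau>: "\<tau> \<ge> 0"
  shows "poly (fejer_poly h \<tau> M) (cis t) = (LINT s|lborel. h s * of_real (fejer_kernel M (t - \<tau> * s)))"
proof -
  have i: "integrable lborel (\<lambda>s. h s * cis (of_int (int j - int l) * (t - \<tau> * s)))" for j l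
    by (rule integrable_mult_bounded[OF h(1), where B = 1]) auto
  have "(LINT s|lborel. h s * of_real (fejer_kernel M (t - \<tau> * s)))
      = (LINT s|lborel. (\<Sum>j<M. (\<Sum>l<M. h s * cis (of_int (int j - int l) * (t - \<tau> * s)))) / M)"
    by (simp only: fejer_kernel_expand sum_distrib_left times_divide_eq_right)
  also have "\<dots> = (LINT s|lborel. (\<Sum>j<M. (\<Sum>l<M. h s * cis (of_int (int j - int l) * (t - \<tau> * s))))) / M"
    by (rule integral_divide_zero)
  also have "(LINT s|lborel. (\<Sum>j<M. (\<Sum>l<M. h s * cis (of_int (int j - int l) * (t - \<tau> * s)))))
      = (\<Sum>j<M. \<Sum>l<M. LINT s|lborel. h s * cis (of_int (int j - int l) * (t - \<tau> * s)))"
    by (subst Bochner_Integration.integral_sum, intro Bochner_Integration.integrable_sum i,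
        intro sum.cong refl, rule Bochner_Integration.integral_sum, rule i)
  also have "\<dots> = (\<Sum>j<M. \<Sum>l<j. hft h (real (j - l) * \<tau>) * cis (real (j - l) * t))"
  proof (rule sum.cong[OF refl])
    fix j assume j: "j \<in> {..<M}"
    have e: "(LINT s|lborel. h s * cis (of_int (int j - int l) * (t - \<tau> * s)))
        = hft h ((real j - real l) * \<tau>) * cis ((real j - real l) * t)" for l
    proof -
      have "cis (of_int (int j - int l) * (t - \<tau> * s)) = cis (- 1 * ((real j - real l) * \<tau> * s)) * cis ((real j - real l) * t)" for s
        unfolding cis_mult by (rule arg_cong[of _ _ cis]) (simp add: algebra_simps)
      then have "(LINT s|lborel. h s * cis (of_int (int j - int l) * (t - \<tau> * s)))
        = (LINT s|lborel. (h s * cis (- 1 * ((real j - real l) * \<tau> * s))) * cis ((real j - real l) * t))"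
        by (simp only: mult.assoc)
      also have "\<dots> = hft h ((real j - real l) * \<tau>) * cis ((real j - real l) * t)"
        unfolding hft_def by (rule integral_mult_left_zero)
      finally show ?thesis .
    qed
    show "(\<Sum>l<M. (LINT s|lborel. h s * cis (of_int (int j - int l) * (t - \<tau> * s))))
        = (\<Sum>l<j. hft h (real (j - l) * \<tau>) * cis (real (j - l) * t))"
      unfolding e
    proof (rule sum.mono_neutral_cong_right)
      show "finite {..<M}" "{..<j} \<subseteq> {..<M}" using j by auto
      show "\<forall>l\<in>{..<M} - {..<j}. hft h ((real j - real l) * \<tau>) * cis ((real j - real l) * t) = 0"
        using \<tau> by (auto intro!: h(2) mult_nonpos_nonneg)
      show "hft h ((real j - real l) * \<tau>) * cis ((real j - real l) * t) = hft h (real (j - l) * \<tau>) * cis (real (j - l) * t)"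
        if "l \<in> {..<j}" for l using that by (simp add: of_nat_diff)
    qed
  qed
  also have "\<dots> / M = poly (fejer_poly h \<tau> M) (cis t)"
    by (simp add: fejer_poly_def poly_sum poly_monom Complex.DeMoivre)
  finally show ?thesis by simp
qed

text \<open>After the triangle inequality the kernel, being nonnegative, integrates over the circle
  to 2 pi whatever its shift. The resulting bound is independent of the step \<tau> and of
  \<open>M\<close>.\<close>

lemma circ_mean_fejer_poly:
  assumes h: "integrable lborel h" "\<And>u. u \<le> 0 \<Longrightarrow> hft h u = 0" and \<tau>: "\<tau> \<ge> 0" and M: "M > 0"
  shows "circ_mean (\<lambda>t. norm (poly (fejer_poly h \<tau> M) (cis t))) \<le> (LINT s|lborel. norm (h s))"
proof -
  have [measurable]: "h \<in> borel_measurable borel" using h(1) by (auto dest: borel_measurable_integrable)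
  define k where "k t s = indicator {-pi..pi} t * (norm (h s) * fejer_kernel M (t - \<tau> * s))" for t s
  have k0: "k t s \<ge> 0" for t s by (simp add: k_def fejer_kernel_bound)
  have pair: "integrable (lborel \<Otimes>\<^sub>M lborel) (\<lambda>(t, s). k t s)"
  proof -
    have "integrable lborel (\<lambda>t. indicator {-pi..pi} t :: real)"
      by (intro integrable_real_indicator) (auto simp: emeasure_lborel_Icc_eq)
    then have "integrable (lborel \<Otimes>\<^sub>M lborel) (\<lambda>(t, s). complex_of_real (indicator {-pi..pi} t) * of_real (norm (h s)) *
        (case (t, s) of (t, s) \<Rightarrow> of_real (fejer_kernel M (t - \<tau> * s))))"
      by (intro integrable_pair_mult[where B = "real M"] integrable_of_real integrable_norm h(1))
         (use fejer_kernel_bound M in auto)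
    then have "integrable (lborel \<Otimes>\<^sub>M lborel) (\<lambda>p. complex_of_real (case p of (t, s) \<Rightarrow> k t s))"
      by (simp add: k_def split_def mult.assoc)
    then show ?thesis by (simp only: complex_of_real_integrable_eq)
  qed
  have kint: "integrable lborel (\<lambda>s. norm (h s) * fejer_kernel M (t - \<tau> * s))" for t
  proof (rule Bochner_Integration.integrable_bound)
    show "integrable lborel (\<lambda>s. norm (h s) * M)" using h(1) by simp
  qed (use fejer_kernel_bound M in \<open>auto intro!: mult_left_mono\<close>)
  have "integral {-pi..pi} (\<lambda>t. norm (poly (fejer_poly h \<tau> M) (cis t)))
      = (LINT t:{-pi..pi}|lborel. norm (poly (fejer_poly h \<tau> M) (cis t)))"
    by (rule set_borel_integral_eq_integral(2)[symmetric])
       (intro borel_integrable_atLeastAtMost', intro continuous_intros)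
  also have "\<dots> \<le> (LINT t|lborel. LINT s|lborel. k t s)"
    unfolding set_lebesgue_integral_def
  proof (rule integral_mono)
    have "set_integrable lborel {-pi..pi} (\<lambda>t. norm (poly (fejer_poly h \<tau> M) (cis t)))"
      by (intro borel_integrable_atLeastAtMost', intro continuous_intros)
    then show "integrable lborel (\<lambda>t. indicator {-pi..pi} t *\<^sub>R norm (poly (fejer_poly h \<tau> M) (cis t)))"
      by (simp only: set_integrable_def)
    show "integrable lborel (\<lambda>t. LINT s|lborel. k t s)"
      using lborel_pair.integrable_fst[OF pair] .
    fix t
    have "norm (poly (fejer_poly h \<tau> M) (cis t)) \<le> (LINT s|lborel. norm (h s * of_real (fejer_kernel M (t - \<tau> * s))))"
    proof -
      have "poly (fejer_poly h \<tau> M) (cis t) = (LINT s|lborel. h s * of_real (fejer_kernel M (t - \<tau> * s)))"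
        by (rule poly_fejer_poly) (use h \<tau> in auto)
      then show ?thesis by (simp only: integral_norm_bound)
    qed
    also have "\<dots> = (LINT s|lborel. norm (h s) * fejer_kernel M (t - \<tau> * s))"
      by (simp add: norm_mult fejer_kernel_bound)
    finally have "indicator {-pi..pi} t *\<^sub>R norm (poly (fejer_poly h \<tau> M) (cis t))
        \<le> indicator {-pi..pi} t *\<^sub>R (LINT s|lborel. norm (h s) * fejer_kernel M (t - \<tau> * s))"
      by (intro scaleR_left_mono) auto
    then show "indicator {-pi..pi} t *\<^sub>R norm (poly (fejer_poly h \<tau> M) (cis t)) \<le> (LINT s|lborel. k t s)"
      by (simp add: k_def)
  qed
  also have "\<dots> = (LINT s|lborel. LINT t|lborel. k t s)"
    by (rule lborel_pair.Fubini_integral[symmetric, OF pair])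
  also have "\<dots> = (LINT s|lborel. norm (h s) * (2 * pi))"
  proof (rule Bochner_Integration.integral_cong[OF refl])
    fix s
    have "(LINT t|lborel. k t s) = (LINT t|lborel. norm (h s) * (indicator {-pi..pi} t *\<^sub>R fejer_kernel M (t - \<tau> * s)))"
      by (simp add: k_def mult_ac)
    also have "\<dots> = norm (h s) * (LINT t:{-pi..pi}|lborel. fejer_kernel M (t - \<tau> * s))"
      unfolding set_lebesgue_integral_def by (rule integral_mult_right_zero)
    also have "(LINT t:{-pi..pi}|lborel. fejer_kernel M (t - \<tau> * s)) = integral {-pi..pi} (\<lambda>t. fejer_kernel M (t - \<tau> * s))"
      by (intro set_borel_integral_eq_integral(2) borel_integrable_atLeastAtMost' continuous_intros)
    finally show "(LINT t|lborel. k t s) = norm (h s) * (2 * pi)"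
      by (simp add: integral_fejer_kernel[OF M])
  qed
  also have "\<dots> = (LINT s|lborel. norm (h s)) * (2 * pi)" by (rule integral_mult_left_zero)
  finally show ?thesis by (simp add: divide_le_eq)
qed

text \<open>There are \<open>Suc m\<close> cells with tags at their left ends; the mesh N / (m + 1)
  and the tags are the step and the sampling points of the key estimate.\<close>

lemma riemann_sum_limit:
  fixes \<psi> :: "real \<Rightarrow> complex"
  assumes c: "continuous_on {0..N} \<psi>" and N: "N > 0"
  shows "(\<lambda>m. \<Sum>n<Suc m. of_real (N / Suc m) * \<psi> (real n * (N / Suc m))) \<longlonglongrightarrow> integral {0..N} \<psi>"
proof (rule LIMSEQ_I)
  fix r :: real assume r: "r > 0"
  define e where "e = r / (2 * N)"
  have e: "e > 0" using r N by (simp add: e_def)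
  have "uniformly_continuous_on {0..N} \<psi>"
    by (intro compact_uniformly_continuous c) auto
  then obtain d where d: "d > 0" "\<And>s t. s \<in> {0..N} \<Longrightarrow> t \<in> {0..N} \<Longrightarrow> dist s t < d \<Longrightarrow> dist (\<psi> s) (\<psi> t) < e"
    using e unfolding uniformly_continuous_on_def by metis
  obtain m0 where m0: "N / real (Suc m0) < d"
  proof -
    obtain m0 where "inverse (real (Suc m0)) < d / N"
      using reals_Archimedean[of "d / N"] d N by auto
    then show ?thesis using N by (intro that[of m0]) (simp add: field_simps)
  qed
  show "\<exists>no. \<forall>m\<ge>no. norm ((\<Sum>n<Suc m. of_real (N / Suc m) * \<psi> (real n * (N / Suc m))) - integral {0..N} \<psi>) < r"
  proof (intro exI[of _ m0] allI impI)
    fix m assume m: "m \<ge> m0"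
    define \<tau> where "\<tau> = N / Suc m"
    have \<tau>: "\<tau> > 0" using N by (simp add: \<tau>_def)
    have \<tau>d: "\<tau> < d"
    proof -
      have "\<tau> \<le> N / real (Suc m0)" unfolding \<tau>_def using m N by (intro divide_left_mono) auto
      then show ?thesis using m0 by linarith
    qed
    have \<tau>N: "real (Suc m) * \<tau> = N" by (simp add: \<tau>_def)
    have "norm ((\<Sum>n<k. of_real \<tau> * \<psi> (real n * \<tau>)) - integral {0..real k * \<tau>} \<psi>) \<le> e * (real k * \<tau>)" if "k \<le> Suc m" for k
      using that
    proof (induction k)
      case (Suc k)
      have kN: "real (Suc k) * \<tau> \<le> N"
        using Suc.prems \<tau> \<tau>N by (metis mult_right_mono of_nat_le_iff less_imp_le)
      have sub: "{real k * \<tau>..real (Suc k) * \<tau>} \<subseteq> {0..N}" "{0..real (Suc k) * \<tau>} \<subseteq> {0..N}"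
        using kN \<tau> by auto
      have comb: "integral {0..real k * \<tau>} \<psi> + integral {real k * \<tau>..real (Suc k) * \<tau>} \<psi> = integral {0..real (Suc k) * \<tau>} \<psi>"
        by (rule Henstock_Kurzweil_Integration.integral_combine)
           (use \<tau> sub in \<open>auto intro!: integrable_continuous_real continuous_on_subset[OF c] simp: mult_right_mono\<close>)
      have const: "integral {real k * \<tau>..real (Suc k) * \<tau>} (\<lambda>_. \<psi> (real k * \<tau>)) = of_real \<tau> * \<psi> (real k * \<tau>)"
        using \<tau> by (simp add: scaleR_conv_of_real algebra_simps)
      have "norm (integral {real k * \<tau>..real (Suc k) * \<tau>} (\<lambda>t. \<psi> (real k * \<tau>) - \<psi> t)) \<le> integral {real k * \<tau>..real (Suc k) * \<tau>} (\<lambda>t. e)"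
      proof (rule integral_norm_bound_integral)
        show "(\<lambda>t. \<psi> (real k * \<tau>) - \<psi> t) integrable_on {real k * \<tau>..real (Suc k) * \<tau>}"
          by (intro integrable_continuous_real continuous_intros continuous_on_subset[OF c] sub)
        fix t assume t: "t \<in> {real k * \<tau>..real (Suc k) * \<tau>}"
        then have "dist (real k * \<tau>) t < d" using \<tau>d by (auto simp: dist_real_def algebra_simps)
        then have "dist (\<psi> (real k * \<tau>)) (\<psi> t) < e"
        proof (intro d(2))
          show "t \<in> {0..N}" using t sub(1) by blast
          show "real k * \<tau> \<in> {0..N}" using sub(1) \<tau> by (auto simp: distrib_right)
        qed
        then show "norm (\<psi> (real k * \<tau>) - \<psi> t) \<le> e" by (simp add: dist_norm)
      qed auto
      also have "\<dots> = e * \<tau>" using \<tau> by (simp add: algebra_simps)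
      also have "integral {real k * \<tau>..real (Suc k) * \<tau>} (\<lambda>t. \<psi> (real k * \<tau>) - \<psi> t)
          = of_real \<tau> * \<psi> (real k * \<tau>) - integral {real k * \<tau>..real (Suc k) * \<tau>} \<psi>"
        unfolding const[symmetric]
        by (rule Henstock_Kurzweil_Integration.integral_diff)
           (intro integrable_continuous_real continuous_intros continuous_on_subset[OF c] sub)+
      finally have step: "norm (of_real \<tau> * \<psi> (real k * \<tau>) - integral {real k * \<tau>..real (Suc k) * \<tau>} \<psi>) \<le> e * \<tau>" .
      have "(\<Sum>n<Suc k. of_real \<tau> * \<psi> (real n * \<tau>)) - integral {0..real (Suc k) * \<tau>} \<psi>
        = ((\<Sum>n<k. of_real \<tau> * \<psi> (real n * \<tau>)) - integral {0..real k * \<tau>} \<psi>)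
          + (of_real \<tau> * \<psi> (real k * \<tau>) - integral {real k * \<tau>..real (Suc k) * \<tau>} \<psi>)"
        unfolding comb[symmetric] by simp
      also have "norm \<dots> \<le> e * (real k * \<tau>) + e * \<tau>"
        using Suc step by (intro norm_triangle_mono) auto
      finally show ?case by (simp add: algebra_simps)
    qed simp
    from this[of "Suc m"] have "norm ((\<Sum>n<Suc m. of_real \<tau> * \<psi> (real n * \<tau>)) - integral {0..N} \<psi>) \<le> e * N"
      unfolding \<tau>N by blast
    also have "e * N < r" using r N by (simp add: e_def)
    finally show "norm ((\<Sum>n<Suc m. of_real (N / Suc m) * \<psi> (real n * (N / Suc m))) - integral {0..N} \<psi>) < r"
      unfolding \<tau>_def .
  qed
qed

text \<open>\<open>C\<close> is any bound rather than the supremum, so that the damped semigroups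
  are instances with the same \<open>C\<close>.\<close>

locale bdd_semigroup = cplx_hilbert J
  for J :: "'h::{real_inner,complete_space} \<Rightarrow> 'h" +
  fixes T :: "real \<Rightarrow> 'h \<Rightarrow>\<^sub>L 'h" and C :: real
  assumes T: "bounded_C0_semigroup J T" and norm_T: "\<And>t. t \<ge> 0 \<Longrightarrow> norm (T t) \<le> C"
begin

lemma T_BH: "t \<ge> 0 \<Longrightarrow> T t \<in> BH J"
  and T_0: "T 0 = id_blinfun"
  and T_add: "s \<ge> 0 \<Longrightarrow> t \<ge> 0 \<Longrightarrow> T (s + t) = T s o\<^sub>L T t"
  and T_cont: "continuous_on {0..} (\<lambda>t. T t x)"
  using T by (auto simp: bounded_C0_semigroup_def)

lemma C_nonneg: "C \<ge> 0"
  using norm_T[of 0] norm_ge_zero[of "T 0"] by linarith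

text \<open>The matrix coefficient, continued to negative times by its value at 0: it becomes
  continuous and bounded on the line and can be integrated against any integrable
  \<open>b\<close>.\<close>

definition \<Theta> :: "'h \<Rightarrow> 'h \<Rightarrow> real \<Rightarrow> complex" where
  "\<Theta> x y t = cinner J (T (max 0 t) x) y"

lemma norm_T_apply: "t \<ge> 0 \<Longrightarrow> norm (T t x) \<le> C * norm x"
  by (rule order_trans[OF norm_blinfun mult_right_mono[OF norm_T]]) auto

lemma norm_\<Theta>: "norm (\<Theta> x y t) \<le> C * norm x * norm y"
  unfolding \<Theta>_def
  by (rule order_trans[OF norm_cinner_le mult_right_mono[OF norm_T_apply]]) auto

lemma continuous_\<Theta>: "continuous_on UNIV (\<Theta> x y)"
proof -
  have c: "continuous_on UNIV (\<lambda>t :: real. T (max 0 t) x)"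
    by (rule continuous_on_compose2[OF T_cont]) (auto intro!: continuous_intros)
  have "\<Theta> x y = (\<lambda>t. of_real (inner (T (max 0 t) x) y) - \<i> * of_real (inner (J (T (max 0 t) x)) y))"
    by (auto simp: \<Theta>_def cinner_def complex_eq_iff fun_eq_iff)
  then show ?thesis
    by (simp only:) (intro continuous_intros c J.continuous_on)
qed

lemma \<Theta>_measurable [measurable]: "\<Theta> x y \<in> borel_measurable borel"
  by (rule borel_measurable_continuous_onI[OF continuous_\<Theta>])

lemma \<Theta>_linear:
  "\<Theta> (x + x') y t = \<Theta> x y t + \<Theta> x' y t" "\<Theta> (r *\<^sub>R x) y t = r *\<^sub>R \<Theta> x y t"
  "\<Theta> x (y + y') t = \<Theta> x y t + \<Theta> x y' t" "\<Theta> x (r *\<^sub>R y) t = r *\<^sub>R \<Theta> x y t"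
  by (simp_all add: \<Theta>_def blinfun.add_right blinfun.scaleR_right cinner_add cinner_scaleR)

lemma \<Theta>_J: "\<Theta> (J x) y t = \<i> * \<Theta> x y t" "\<Theta> x (J y) t = - (\<i> * \<Theta> x y t)"
proof -
  show "\<Theta> (J x) y t = \<i> * \<Theta> x y t"
    using T_BH[of "max 0 t"] by (simp add: \<Theta>_def BH_def cinner_J)
  show "\<Theta> x (J y) t = - (\<i> * \<Theta> x y t)"
    by (simp add: \<Theta>_def cinner_def complex_eq_iff inner_J_swap)
qed

lemma integrable_\<Theta>: "integrable lborel b \<Longrightarrow> integrable lborel (\<lambda>t. b t * \<Theta> x y t)"
  by (rule integrable_mult_bounded[OF _ \<Theta>_measurable norm_\<Theta>])

text \<open>Only the real part of the sesquilinear form is represented by an operator. Its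
  compatibility with \<open>J\<close> in each argument then gives complex linearity and recovers the
  imaginary part.\<close>

lemma hp_exists:
  assumes b: "integrable lborel b"
  shows "\<exists>S. S \<in> BH J \<and> (\<forall>x y. cinner J (blinfun_apply S x) y = (LINT t|lborel. b t * \<Theta> x y t))"
proof -
  note i = integrable_\<Theta>[OF b]
  define L where "L x y = (LINT t|lborel. b t * \<Theta> x y t)" for x y
  have L: "L (x + x') y = L x y + L x' y" "L (r *\<^sub>R x) y = r *\<^sub>R L x y"
    "L x (y + y') = L x y + L x y'" "L x (r *\<^sub>R y) = r *\<^sub>R L x y"
    for x x' y y' r
    by (simp_all add: L_def \<Theta>_linear distrib_left i)
  have swap: "b t * (\<i> * z) = \<i> * (b t * z)" for t z by simp
  have LJ: "L (J x) y = \<i> * L x y" "L x (J y) = - (\<i> * L x y)" for x y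
    unfolding L_def \<Theta>_J mult_minus_right swap by simp_all
  have "\<exists>S :: 'h \<Rightarrow>\<^sub>L 'h. \<forall>x y. inner (blinfun_apply S x) y = Re (L x y)"
  proof (rule bounded_bilinear_form_operator)
    show "\<bar>Re (L x y)\<bar> \<le> ((LINT t|lborel. norm (b t)) * C) * norm x * norm y" for x y
      using abs_Re_le_cmod[of "L x y"] norm_integral_mult_le[OF b \<Theta>_measurable norm_\<Theta>, of x y]
      by (simp add: L_def mult.assoc)
  qed (auto intro!: linearI simp: L)
  then obtain S :: "'h \<Rightarrow>\<^sub>L 'h" where S: "\<And>x y. inner (blinfun_apply S x) y = Re (L x y)" by blast
  have "S (J x) = J (S x)" for x
  proof -
    have "inner (S (J x)) y = inner (J (S x)) y" for y
      by (simp add: S LJ inner_J_swap[of "S x"])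
    then show ?thesis by (metis vector_eq_rdot inner_commute)
  qed
  then have BH: "S \<in> BH J" by (simp add: BH_def)
  moreover have "cinner J (S x) y = L x y" for x y
  proof -
    have "inner (J (S x)) y = - Im (L x y)"
      by (simp add: S LJ inner_J_swap[of "S x"])
    then show ?thesis by (simp add: cinner_def S complex_eq_iff)
  qed
  ultimately show ?thesis unfolding L_def by blast
qed

text \<open>The Hille--Phillips operator \<open>\<integral> b(t) T\<^sub>t dt\<close>, as a weak integral.\<close>

definition hp :: "(real \<Rightarrow> complex) \<Rightarrow> 'h \<Rightarrow>\<^sub>L 'h" where
  "hp b = (SOME S. S \<in> BH J \<and> (\<forall>x y. cinner J (blinfun_apply S x) y = (LINT t|lborel. b t * \<Theta> x y t)))"

lemma
  assumes b: "integrable lborel b"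
  shows hp_BH: "hp b \<in> BH J"
    and cinner_hp: "cinner J (hp b x) y = (LINT t|lborel. b t * \<Theta> x y t)"
  using someI_ex[OF hp_exists[OF b]] unfolding hp_def by auto

lemma inner_hp: "integrable lborel b \<Longrightarrow> inner (hp b x) y = Re (LINT t|lborel. b t * \<Theta> x y t)"
  using cinner_hp[of b x y] by (metis cinner_def complex.sel(1))

lemma hp_unique:
  assumes "integrable lborel b" "\<And>x y. cinner J (blinfun_apply S x) y = (LINT t|lborel. b t * \<Theta> x y t)"
  shows "S = hp b"
  by (rule BH_eqI) (simp add: assms cinner_hp)

lemma norm_hp_le:
  assumes b: "integrable lborel b"
  shows "norm (hp b) \<le> C * (LINT t|lborel. norm (b t))"
proof (rule norm_blinfun_le_of_inner)
  show "0 \<le> C * (LINT t|lborel. norm (b t))" using C_nonneg by simp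
  show "\<bar>inner (hp b x) y\<bar> \<le> C * (LINT t|lborel. norm (b t)) * norm x * norm y" for x y
    using abs_Re_le_cmod[of "LINT t|lborel. b t * \<Theta> x y t"]
      norm_integral_mult_le[OF b \<Theta>_measurable norm_\<Theta>, of x y]
    by (simp add: inner_hp[OF b] mult_ac)
qed

lemma hp_add: "integrable lborel b \<Longrightarrow> integrable lborel b' \<Longrightarrow> hp (\<lambda>t. b t + b' t) = hp b + hp b'"
  by (rule hp_unique[symmetric])
     (auto simp: blinfun.add_left cinner_add cinner_hp distrib_right integrable_\<Theta>)

lemma hp_cmult: "integrable lborel b \<Longrightarrow> blinfun_apply (hp (\<lambda>t. c * b t)) x = cscale J c (hp b x)"
proof -
  assume b: "integrable lborel b"
  have "hp (\<lambda>t. c * b t) = Blinfun (cscale J c) o\<^sub>L hp b"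
    by (rule hp_unique[symmetric])
       (use b in \<open>auto simp: bounded_linear_Blinfun_apply[OF bounded_linear_cscale] cinner_cscale cinner_hp mult.assoc\<close>)
  then show ?thesis by (simp add: bounded_linear_Blinfun_apply[OF bounded_linear_cscale])
qed

lemma hp_diff: "integrable lborel b \<Longrightarrow> integrable lborel b' \<Longrightarrow> hp (\<lambda>t. b t - b' t) = hp b - hp b'"
  using hp_add[of "\<lambda>t. b t - b' t" b'] by (simp add: algebra_simps)

lemma hp_sum: "(\<And>k. k \<in> A \<Longrightarrow> integrable lborel (b k)) \<Longrightarrow> finite A \<Longrightarrow>
    hp (\<lambda>t. \<Sum>k\<in>A. b k t) = (\<Sum>k\<in>A. hp (b k))"
proof (induction A rule: infinite_finite_induct)
  case empty
  show ?case by (rule hp_unique[symmetric]) (auto simp: cinner_def complex_eq_iff)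
qed (auto simp: hp_add)

text \<open>\<open>T s\<close> is moved to the other side of the pairing as a vector
  \<open>z\<close>, which leaves the defining integral of \<open>hp b\<close>. The semigroup law is
  available for nonnegative times only, and the supports of \<open>a\<close> and \<open>b\<close>
  exclude all others.\<close>

lemma hp_mult:
  assumes a: "a \<in> L1p" and b: "b \<in> L1p"
  shows "hp (bconv a b) = hp a o\<^sub>L hp b"
proof (rule hp_unique[symmetric])
  have ai: "integrable lborel a" and bi: "integrable lborel b" using a b by (auto simp: L1p_def)
  show "integrable lborel (bconv a b)" by (rule integrable_bconv[OF ai bi])
  fix x y
  have "cinner J ((hp a o\<^sub>L hp b) x) y = (LINT s|lborel. a s * \<Theta> (hp b x) y s)"
    by (simp add: cinner_hp[OF ai])
  also have "\<dots> = (LINT s|lborel. LINT v|lborel. a s * b v * \<Theta> x y (s + v))"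
  proof (rule Bochner_Integration.integral_cong[OF refl])
    fix s
    show "a s * \<Theta> (hp b x) y s = (LINT v|lborel. a s * b v * \<Theta> x y (s + v))"
    proof (cases "s < 0")
      case True
      then show ?thesis using a by (simp add: L1p_def)
    next
      case False
      obtain z where z: "\<And>x. inner (T s x) y = inner x z"
        using blinfun_adjoint_exists[of "T s" y] by blast
      have Tz: "cinner J (T s x) y = cinner J x z" for x
      proof -
        have "inner (J (T s x)) y = inner (T s (J x)) y"
          using T_BH[of s] False by (simp add: BH_def)
        then show ?thesis by (simp add: cinner_def z)
      qed
      have "\<Theta> (hp b x) y s = cinner J (hp b x) z"
        using False by (simp add: \<Theta>_def Tz)
      also have "\<dots> = (LINT v|lborel. b v * \<Theta> x z v)" by (rule cinner_hp[OF bi])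
      also have "\<dots> = (LINT v|lborel. b v * \<Theta> x y (s + v))"
      proof (rule Bochner_Integration.integral_cong[OF refl])
        fix v
        show "b v * \<Theta> x z v = b v * \<Theta> x y (s + v)"
        proof (cases "v < 0")
          case True
          then show ?thesis using b by (simp add: L1p_def)
        next
          case v: False
          have "\<Theta> x z v = cinner J (T s (T v x)) y" using v by (simp add: \<Theta>_def Tz)
          also have "\<dots> = \<Theta> x y (s + v)" using v False by (simp add: \<Theta>_def T_add)
          finally show ?thesis by simp
        qed
      qed
      finally show ?thesis by (simp add: mult.assoc)
    qed
  qed
  also have "\<dots> = (LINT t|lborel. bconv a b t * \<Theta> x y t)"
    by (rule bconv_pairing[OF ai bi \<Theta>_measurable norm_\<Theta>, symmetric])
  finally show "cinner J ((hp a o\<^sub>L hp b) x) y = (LINT t|lborel. bconv a b t * \<Theta> x y t)" .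
qed

end

text \<open>The substitution t = \<tau> u turns the coefficient into \<tau> / (2 pi) times the
  transform of \<open>f\<close> truncated to |\<tau> u| \<le> pi, while the full transform at n
  \<tau> is 2 pi c. What remains is the tail of \<open>f\<close>.\<close>

lemma fcoeff_scaled:
  assumes f: "continuous_on UNIV f" "integrable lborel f" and \<tau>: "\<tau> > 0"
    and c: "(LINT u|lborel. f u * cis (- (u * (real n * \<tau>)))) = 2 * complex_of_real pi * c"
  shows "norm (fcoeff (\<lambda>t. f (t / \<tau>)) n - of_real \<tau> * c)
    \<le> \<tau> * ((LINT u|lborel. indicator {u. \<bar>\<tau> * u\<bar> > pi} u * norm (f u)) / (2 * pi))"
proof -
  have [measurable]: "f \<in> borel_measurable borel" using f(1) by (rule borel_measurable_continuous_onI)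
  let ?e = "\<lambda>u. f u * cis (- (u * (real n * \<tau>)))"
  have ie: "integrable lborel ?e" by (rule integrable_mult_bounded[OF f(2), where B = 1]) auto
  have c1: "continuous_on {-pi..pi} (\<lambda>t. f (t / \<tau>) * cis (- (real n * t)))"
    using \<tau> by (intro continuous_intros continuous_on_compose2[OF f(1)]) auto
  have "integral {-pi..pi} (\<lambda>t. f (t / \<tau>) * cis (- (real n * t)))
      = (LINT t:{-pi..pi}|lborel. f (t / \<tau>) * cis (- (real n * t)))"
    by (rule set_borel_integral_eq_integral(2)[symmetric]) (rule borel_integrable_atLeastAtMost'[OF c1])
  also have "\<dots> = \<tau> *\<^sub>R (LINT u|lborel. indicator {-pi..pi} (0 + \<tau> * u) *\<^sub>R (f ((0 + \<tau> * u) / \<tau>) * cis (- (real n * (0 + \<tau> * u)))))"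
    unfolding set_lebesgue_integral_def by (rule integral_affine[OF \<tau>])
  also have "\<dots> = \<tau> *\<^sub>R (LINT u|lborel. indicator {u. \<bar>\<tau> * u\<bar> \<le> pi} u *\<^sub>R ?e u)"
    using \<tau> by (intro arg_cong[of _ _ "\<lambda>x. \<tau> *\<^sub>R x"] Bochner_Integration.integral_cong refl)
       (auto simp: indicator_def mult_ac abs_le_iff)
  finally have "fcoeff (\<lambda>t. f (t / \<tau>)) n = of_real \<tau> * ((LINT u|lborel. indicator {u. \<bar>\<tau> * u\<bar> \<le> pi} u *\<^sub>R ?e u) / (2 * pi))"
    by (simp add: fcoeff_def scaleR_conv_of_real)
  moreover have "of_real \<tau> * c = of_real \<tau> * ((LINT u|lborel. ?e u) / (2 * pi))"
    using c by simp
  ultimately have "fcoeff (\<lambda>t. f (t / \<tau>)) n - of_real \<tau> * c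
     = of_real \<tau> * (((LINT u|lborel. indicator {u. \<bar>\<tau> * u\<bar> \<le> pi} u *\<^sub>R ?e u) - (LINT u|lborel. ?e u)) / (2 * pi))"
    by (simp only: right_diff_distrib diff_divide_distrib)
  also have "(LINT u|lborel. indicator {u. \<bar>\<tau> * u\<bar> \<le> pi} u *\<^sub>R ?e u) - (LINT u|lborel. ?e u)
     = (LINT u|lborel. indicator {u. \<bar>\<tau> * u\<bar> \<le> pi} u *\<^sub>R ?e u - ?e u)"
    by (rule Bochner_Integration.integral_diff[symmetric]) (intro integrable_mult_indicator ie, measurable, rule ie)
  also have "\<dots> = (LINT u|lborel. - (indicator {u. \<bar>\<tau> * u\<bar> > pi} u *\<^sub>R ?e u))"
    by (rule Bochner_Integration.integral_cong) (auto simp: indicator_def)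
  finally have eq: "norm (fcoeff (\<lambda>t. f (t / \<tau>)) n - of_real \<tau> * c)
     = \<tau> * (norm (LINT u|lborel. - (indicator {u. \<bar>\<tau> * u\<bar> > pi} u *\<^sub>R ?e u)) / (2 * pi))"
    using \<tau> by (simp add: norm_mult norm_divide)
  have "norm (LINT u|lborel. - (indicator {u. \<bar>\<tau> * u\<bar> > pi} u *\<^sub>R ?e u))
     \<le> (LINT u|lborel. norm (- (indicator {u. \<bar>\<tau> * u\<bar> > pi} u *\<^sub>R ?e u)))"
    by (rule integral_norm_bound)
  also have "\<dots> = (LINT u|lborel. indicator {u. \<bar>\<tau> * u\<bar> > pi} u * norm (f u))"
    by (simp add: norm_mult)
  finally show ?thesis unfolding eq using \<tau> by (intro mult_left_mono divide_right_mono) auto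
qed

context bdd_semigroup
begin

text \<open>Two limits are taken. For fixed N the step N / (m + 1) tends to 0, and the Hankel sums
  become an integral over [0, N] with weight 1 - r/N; then N tends to infinity. The Hankel bound is
  used with S n = T (n \<tau>) and the multiplier t \<mapsto> f (t / \<tau>), whose values are
  bounded by the same supremum for every \<tau>.\<close>

lemma key_estimate:
  assumes n: "fourier_pair f c" and h: "integrable lborel h" "\<And>u. u \<le> 0 \<Longrightarrow> hft h u = 0"
  shows "norm (hp (\<lambda>r. c r * hft h r)) \<le> C\<^sup>2 * (supnorm f * (LINT s|lborel. norm (h s)))"
proof (rule norm_blinfun_le_of_quadratic)
  have f: "C0fun f" "continuous_on UNIV f" "integrable lborel f" and c: "integrable lborel c" "continuous_on UNIV c"
    and fc: "\<And>t. (LINT u|lborel. f u * cis (- (u * t))) = 2 * complex_of_real pi * c t"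
    using n by (auto simp: fourier_pair_def C0fun_def)
  have [measurable]: "f \<in> borel_measurable borel" using f(2) by (rule borel_measurable_continuous_onI)
  define H where "H = (LINT s|lborel. norm (h s))"
  have H: "H \<ge> 0" by (simp add: H_def)
  show K: "0 \<le> C\<^sup>2 * (supnorm f * (LINT s|lborel. norm (h s)))"
    using supnorm_nonneg[OF f(1)] by simp
  define K where "K = C\<^sup>2 * (supnorm f * H)"
  define b where "b r = c r * hft h r" for r
  have bL: "b \<in> L1p" unfolding b_def by (rule fourier_pair_hft_L1p[OF n h])
  then have bi: "integrable lborel b" by (simp add: L1p_def)
  then have [measurable]: "b \<in> borel_measurable borel" by (auto dest: borel_measurable_integrable)
  fix x y :: 'h
  define q where "q = (norm x)\<^sup>2 + (norm y)\<^sup>2"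
  define D where "D = C * norm x * norm y"
  have D: "D \<ge> 0" using C_nonneg by (simp add: D_def)
  \<comment> \<open>With \<tau> = N / (m + 1), the Fejer weight 1 - n / (m + 1) at the sampling
    point r = n \<tau> is 1 - r/N.\<close>
  define \<psi> where "\<psi> N r = of_real (1 - r / N) * (hft h r * (c r * \<Theta> x y r))" for N r
  have step1: "Re (integral {0..N} (\<psi> N)) \<le> K * q / 2" if N: "N > 0" for N
  proof -
    define \<tau> where "\<tau> m = N / Suc m" for m
    have \<tau>: "\<tau> m > 0" for m using N by (simp add: \<tau>_def)
    define E where "E m = (LINT u|lborel. indicator {u. \<bar>\<tau> m * u\<bar> > pi} u * norm (f u)) / (2 * pi)" for m
    have E0: "E m \<ge> 0" for m by (simp add: E_def)
    have \<tau>0: "\<tau> \<longlonglongrightarrow> 0"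
      unfolding \<tau>_def by (rule LIMSEQ_Suc[OF lim_const_over_n])
    have Elim: "E \<longlonglongrightarrow> 0"
    proof -
      have "(\<lambda>m. LINT u|lborel. indicator {u. \<bar>\<tau> m * u\<bar> > pi} u * norm (f u)) \<longlonglongrightarrow> (LINT u::real|lborel. (0::real))"
      proof (rule integral_dominated_convergence)
        show "integrable lborel (\<lambda>u. norm (f u))" using f by simp
        show "AE u in lborel. norm (indicator {u. \<bar>\<tau> m * u\<bar> > pi} u * norm (f u)) \<le> norm (f u)" for m
          by (intro AE_I2) (auto simp: indicator_def)
        show "AE u in lborel. (\<lambda>m. indicator {u. \<bar>\<tau> m * u\<bar> > pi} u * norm (f u)) \<longlonglongrightarrow> 0"
        proof (rule AE_I2)
          fix u
          have "(\<lambda>m. \<bar>\<tau> m * u\<bar>) \<longlonglongrightarrow> \<bar>0 * u\<bar>" by (intro tendsto_intros \<tau>0)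
          then have "\<forall>\<^sub>F m in sequentially. \<bar>\<tau> m * u\<bar> < pi"
            by (rule order_tendstoD(2)) simp
          then have "\<forall>\<^sub>F m in sequentially. indicator {u. \<bar>\<tau> m * u\<bar> > pi} u * norm (f u) = 0"
            by eventually_elim simp
          then show "(\<lambda>m. indicator {u. \<bar>\<tau> m * u\<bar> > pi} u * norm (f u)) \<longlonglongrightarrow> 0"
            by (rule tendsto_eventually)
        qed
      qed measurable
      then have "(\<lambda>m. (LINT u|lborel. indicator {u. \<bar>\<tau> m * u\<bar> > pi} u * norm (f u)) / (2 * pi)) \<longlonglongrightarrow> 0 / (2 * pi)"
        by (intro tendsto_divide tendsto_const) auto
      then show ?thesis by (simp add: E_def[abs_def])
    qed
    \<comment> \<open>\<open>A\<close> is the Hankel form bounded by \<open>hankel_bound\<close>,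
      and \<open>R\<close> below is the Riemann sum. They differ in that \<open>fcoeff\<close> is
      replaced by \<tau> c (n \<tau>); each of the m + 1 terms costs at most \<tau> H D E, in total
      N H D E.\<close>
    define A where "A m = coeff_pairing (\<lambda>n. fcoeff (\<lambda>t. f (t / \<tau> m)) n * \<Theta> x y (real n * \<tau> m)) (fejer_poly h (\<tau> m) (Suc m))" for m
    define R where "R m = (\<Sum>n<Suc m. of_real (\<tau> m) * \<psi> N (real n * \<tau> m))" for m
    have A: "Re (A m) \<le> K * q / 2" for m
    proof -
      have g: "continuous_on {-pi..pi} (\<lambda>t. f (t / \<tau> m))"
        using \<tau>[of m] by (intro continuous_on_compose2[OF f(2)] continuous_intros) auto
      have "Re (A m) = Re (coeff_pairing (\<lambda>n. fcoeff (\<lambda>t. f (t / \<tau> m)) n * cinner J (T (real n * \<tau> m) x) y) (fejer_poly h (\<tau> m) (Suc m)))"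
        using \<tau>[of m] by (simp add: A_def \<Theta>_def max_def)
      also have "\<dots> \<le> supnorm f * C\<^sup>2 * circ_mean (\<lambda>t. norm (poly (fejer_poly h (\<tau> m) (Suc m)) (cis t))) * ((norm x)\<^sup>2 + (norm y)\<^sup>2) / 2"
        using \<tau>[of m]
        by (intro hankel_bound g norm_T norm_le_supnorm[OF f(1)] T_BH)
           (auto simp: distrib_right intro!: T_add)
      also have "\<dots> \<le> supnorm f * C\<^sup>2 * H * ((norm x)\<^sup>2 + (norm y)\<^sup>2) / 2"
        unfolding H_def using \<tau>[of m] supnorm_nonneg[OF f(1)]
        by (intro divide_right_mono mult_right_mono mult_left_mono circ_mean_fejer_poly h) auto
      also have "\<dots> = K * q / 2" by (simp only: K_def q_def mult_ac)
      finally show ?thesis .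
    qed
    have AR: "norm (A m - R m) \<le> N * H * D * E m" for m
    proof -
      have Aeq: "A m = (\<Sum>n<Suc m. of_real (1 - n / Suc m) * (hft h (real n * \<tau> m) * (fcoeff (\<lambda>t. f (t / \<tau> m)) n * \<Theta> x y (real n * \<tau> m))))"
        unfolding A_def using h(2)[of 0] by (intro coeff_pairing_fejer_poly) auto
      have "A m - R m = (\<Sum>n<Suc m. of_real (1 - n / Suc m) * (hft h (real n * \<tau> m) *
          ((fcoeff (\<lambda>t. f (t / \<tau> m)) n - of_real (\<tau> m) * c (real n * \<tau> m)) * \<Theta> x y (real n * \<tau> m))))"
      proof -
        have "of_real (\<tau> m) * \<psi> N (real n * \<tau> m) = of_real (1 - n / Suc m) * (hft h (real n * \<tau> m) *
          (of_real (\<tau> m) * c (real n * \<tau> m) * \<Theta> x y (real n * \<tau> m)))" for n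
        proof -
          have "real n * \<tau> m / N = n / Suc m" using N by (simp add: \<tau>_def)
          then show ?thesis by (simp only: \<psi>_def mult_ac)
        qed
        then show ?thesis
          unfolding R_def Aeq sum_subtractf[symmetric]
          by (simp only: right_diff_distrib left_diff_distrib)
      qed
      also have "norm \<dots> \<le> (\<Sum>n<Suc m. \<tau> m * (H * D * E m))"
      proof (rule sum_norm_le)
        fix n assume "n \<in> {..<Suc m}"
        then have w: "\<bar>1 - n / Suc m\<bar> \<le> 1" by (auto simp: field_simps)
        have d: "norm (fcoeff (\<lambda>t. f (t / \<tau> m)) n - of_real (\<tau> m) * c (real n * \<tau> m)) \<le> \<tau> m * E m"
          unfolding E_def by (rule fcoeff_scaled[OF f(2,3) \<tau> fc])
        have "norm (of_real (1 - n / Suc m) * (hft h (real n * \<tau> m) *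
          ((fcoeff (\<lambda>t. f (t / \<tau> m)) n - of_real (\<tau> m) * c (real n * \<tau> m)) * \<Theta> x y (real n * \<tau> m))))
          \<le> 1 * (H * ((\<tau> m * E m) * D))"
          unfolding norm_mult norm_of_real H_def D_def
          by (intro mult_mono w d norm_\<Theta> hft_bound[OF h(1)] mult_nonneg_nonneg less_imp_le[OF \<tau>] E0) (auto simp: C_nonneg)
        then show "norm (of_real (1 - n / Suc m) * (hft h (real n * \<tau> m) *
          ((fcoeff (\<lambda>t. f (t / \<tau> m)) n - of_real (\<tau> m) * c (real n * \<tau> m)) * \<Theta> x y (real n * \<tau> m))))
          \<le> \<tau> m * (H * D * E m)" by (simp only: mult_ac mult_1)
      qed
      also have "\<dots> = N * H * D * E m" by (simp add: \<tau>_def)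
      finally show ?thesis .
    qed
    have "R \<longlonglongrightarrow> integral {0..N} (\<psi> N)"
      unfolding R_def \<tau>_def
    proof (rule riemann_sum_limit[OF _ N])
      show "continuous_on {0..N} (\<psi> N)"
        unfolding \<psi>_def using N
        by (intro continuous_intros continuous_on_subset[OF continuous_hft[OF h(1)]]
            continuous_on_subset[OF c(2)] continuous_on_subset[OF continuous_\<Theta>]) auto
    qed
    then have "(\<lambda>m. Re (R m)) \<longlonglongrightarrow> Re (integral {0..N} (\<psi> N))" by (rule tendsto_Re)
    moreover have "(\<lambda>m. K * q / 2 + N * H * D * E m) \<longlonglongrightarrow> K * q / 2 + N * H * D * 0"
      by (intro tendsto_intros Elim)
    moreover have "Re (R m) \<le> K * q / 2 + N * H * D * E m" for m
      using A[of m] AR[of m] abs_Re_le_cmod[of "A m - R m"] by simp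
    ultimately have "Re (integral {0..N} (\<psi> N)) \<le> K * q / 2 + N * H * D * 0"
      by (intro LIMSEQ_le) auto
    then show ?thesis by simp
  qed
  \<comment> \<open>The weight 1 - r/N for N = k + 1, continued by 1 on the left and by 0 on the
    right. It stays in [0, 1] and tends to 1, so dominated convergence gives the second
    limit.\<close>
  define w where "w k r = complex_of_real (max 0 (1 - max 0 r / Suc k))" for k :: nat and r :: real
  have wlim: "(\<lambda>k. LINT r|lborel. b r * \<Theta> x y r * w k r) \<longlonglongrightarrow> (LINT r|lborel. b r * \<Theta> x y r)"
  proof (rule integral_dominated_convergence)
    show "integrable lborel (\<lambda>r. norm (b r * \<Theta> x y r))" using integrable_\<Theta>[OF bi] by simp
    show "AE r in lborel. norm (b r * \<Theta> x y r * w k r) \<le> norm (b r * \<Theta> x y r)" for k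
      by (intro AE_I2) (auto simp: norm_mult w_def intro!: mult_left_le)
    show "AE r in lborel. (\<lambda>k. b r * \<Theta> x y r * w k r) \<longlonglongrightarrow> b r * \<Theta> x y r"
    proof (rule AE_I2)
      fix r
      have "(\<lambda>k. max 0 r / Suc k) \<longlonglongrightarrow> 0" by (rule LIMSEQ_Suc[OF lim_const_over_n])
      then have "(\<lambda>k. w k r) \<longlonglongrightarrow> of_real (max 0 (1 - 0))"
        unfolding w_def by (intro tendsto_intros)
      from tendsto_mult[OF tendsto_const this, of "b r * \<Theta> x y r"]
      show "(\<lambda>k. b r * \<Theta> x y r * w k r) \<longlonglongrightarrow> b r * \<Theta> x y r" by simp
    qed
  qed (simp_all add: w_def)
  have weq: "(LINT r|lborel. b r * \<Theta> x y r * w k r) = integral {0..real (Suc k)} (\<psi> (real (Suc k)))" for k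
  proof -
    have "continuous_on {0..real (Suc k)} (\<psi> (real (Suc k)))"
      unfolding \<psi>_def
      by (intro continuous_intros continuous_on_subset[OF continuous_hft[OF h(1)]]
          continuous_on_subset[OF c(2)] continuous_on_subset[OF continuous_\<Theta>]) auto
    then have "integral {0..real (Suc k)} (\<psi> (real (Suc k))) = (LINT r:{0..real (Suc k)}|lborel. \<psi> (real (Suc k)) r)"
      by (intro set_borel_integral_eq_integral(2)[symmetric] borel_integrable_atLeastAtMost')
    also have "\<dots> = (LINT r|lborel. b r * \<Theta> x y r * w k r)"
      unfolding set_lebesgue_integral_def
    proof (rule Bochner_Integration.integral_cong[OF refl])
      fix r
      show "indicator {0..real (Suc k)} r *\<^sub>R \<psi> (real (Suc k)) r = b r * \<Theta> x y r * w k r"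
      proof (cases "0 \<le> r \<and> r \<le> real (Suc k)")
        case True
        then have "w k r = of_real (1 - r / real (Suc k))" by (simp add: w_def max_def field_simps)
        then show ?thesis using True by (simp add: \<psi>_def b_def mult_ac)
      next
        case False
        then consider "r < 0" | "r > real (Suc k)" by linarith
        then show ?thesis
        proof cases
          case 1
          then show ?thesis using h(2)[of r] by (simp add: b_def)
        next
          case 2
          then have "w k r = 0" by (simp add: w_def field_simps)
          then show ?thesis using 2 by simp
        qed
      qed
    qed
    finally show ?thesis by simp
  qed
  have "Re (LINT r|lborel. b r * \<Theta> x y r) \<le> K * q / 2"
  proof (rule LIMSEQ_le_const2[OF tendsto_Re[OF wlim]], intro exI allI impI)
    show "Re (LINT r|lborel. b r * \<Theta> x y r * w k r) \<le> K * q / 2" for k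
      unfolding weq by (rule step1) simp
  qed
  then show "inner (hp (\<lambda>r. c r * hft h r) x) y \<le> C\<^sup>2 * (supnorm f * (LINT s|lborel. norm (h s))) * ((norm x)\<^sup>2 + (norm y)\<^sup>2) / 2"
    using inner_hp[OF bi, of x y] by (simp add: b_def[abs_def] K_def H_def q_def)
qed

end

text \<open>Multiplication by exp (- \<delta> t) replaces A by A + \<delta>:
  \<open>hp (damp \<delta> b)\<close> is the operator of \<open>b\<close> for the semigroup exp (-
  \<delta> t) T_t.\<close>

definition damp :: "real \<Rightarrow> (real \<Rightarrow> complex) \<Rightarrow> real \<Rightarrow> complex" where
  "damp \<delta> b t = of_real (exp (- (\<delta> * max 0 t))) * b t"

lemma damp_0 [simp]: "damp 0 b = b"
  by (simp add: damp_def fun_eq_iff)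

lemma damp_linear:
  "damp \<delta> (\<lambda>t. a t + b t) = (\<lambda>t. damp \<delta> a t + damp \<delta> b t)"
  "damp \<delta> (\<lambda>t. a t - b t) = (\<lambda>t. damp \<delta> a t - damp \<delta> b t)"
  "damp \<delta> (\<lambda>t. c * b t) = (\<lambda>t. c * damp \<delta> b t)"
  "damp \<delta> (\<lambda>t. \<Sum>k\<in>A. g k t) = (\<lambda>t. \<Sum>k\<in>A. damp \<delta> (g k) t)"
  by (auto simp: damp_def fun_eq_iff algebra_simps sum_distrib_left sum_distrib_right)

lemma norm_damp_le: "\<delta> \<ge> 0 \<Longrightarrow> norm (damp \<delta> b t) \<le> norm (b t)"
  by (auto simp: damp_def norm_mult intro!: mult_left_le_one_le)

lemma integrable_damp:
  assumes "integrable lborel b" "\<delta> \<ge> 0" shows "integrable lborel (damp \<delta> b)"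
proof (rule Bochner_Integration.integrable_bound[OF assms(1)])
  have [measurable]: "b \<in> borel_measurable borel" using assms by (auto dest: borel_measurable_integrable)
  show "damp \<delta> b \<in> borel_measurable lborel" unfolding damp_def[abs_def] by measurable
  show "AE t in lborel. norm (damp \<delta> b t) \<le> norm (b t)" using norm_damp_le[OF assms(2)] by simp
qed

lemma damp_L1p: "b \<in> L1p \<Longrightarrow> \<delta> \<ge> 0 \<Longrightarrow> damp \<delta> b \<in> L1p"
  by (auto simp: L1p_def integrable_damp) (simp add: damp_def)

lemma bconv_L1p: "a \<in> L1p \<Longrightarrow> b \<in> L1p \<Longrightarrow> bconv a b \<in> L1p"
proof -
  assume ab: "a \<in> L1p" "b \<in> L1p"
  have "bconv a b r = 0" if r: "r < 0" for r
  proof -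
    have "a s * b (r - s) = 0" for s using ab r by (cases "s < 0") (auto simp: L1p_def)
    then show ?thesis unfolding bconv_def by (simp only: integral_zero)
  qed
  then show ?thesis using ab integrable_bconv by (auto simp: L1p_def)
qed

text \<open>The map t \<mapsto> exp (- \<delta> max 0 t) is multiplicative on pairs of nonnegative
  times, and the supports make the integrand vanish at all other pairs.\<close>

lemma damp_bconv:
  assumes ab: "a \<in> L1p" "b \<in> L1p"
  shows "damp \<delta> (bconv a b) = bconv (damp \<delta> a) (damp \<delta> b)"
proof
  fix r
  have "damp \<delta> (bconv a b) r = (LINT s|lborel. of_real (exp (- (\<delta> * max 0 r))) * (a s * b (r - s)))"
    by (simp add: damp_def bconv_def)
  also have "\<dots> = bconv (damp \<delta> a) (damp \<delta> b) r"
    unfolding bconv_def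
  proof (rule Bochner_Integration.integral_cong[OF refl])
    fix s
    show "of_real (exp (- (\<delta> * max 0 r))) * (a s * b (r - s)) = damp \<delta> a s * damp \<delta> b (r - s)"
    proof (cases "s < 0 \<or> r - s < 0")
      case True
      then show ?thesis using ab by (auto simp: L1p_def damp_def)
    next
      case False
      then have "exp (- (\<delta> * max 0 r)) = exp (- (\<delta> * max 0 s)) * exp (- (\<delta> * max 0 (r - s)))"
        by (simp add: max_def mult_exp_exp algebra_simps)
      then show ?thesis by (simp add: damp_def)
    qed
  qed
  finally show "damp \<delta> (bconv a b) r = bconv (damp \<delta> a) (damp \<delta> b) r" .
qed

lemma laplace_bconv:
  assumes a: "a \<in> L1p" and b: "b \<in> L1p" and z: "0 < Re z"
  shows "laplace (bconv a b) z = laplace a z * laplace b z"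
proof -
  let ?\<Phi> = "\<lambda>t. exp (- (complex_of_real (max 0 t) * z))"
  have ai: "integrable lborel a" and bi: "integrable lborel b" using a b by (auto simp: L1p_def)
  have "laplace (bconv a b) z = (LINT r|lborel. bconv a b r * ?\<Phi> r)"
    by (rule laplace_eq_LINT[OF bconv_L1p[OF a b] z])
  also have "\<dots> = (LINT s|lborel. LINT v|lborel. a s * b v * ?\<Phi> (s + v))"
    by (rule bconv_pairing[OF ai bi, where B = 1]) (use z in auto)
  also have "\<dots> = (LINT s|lborel. LINT v|lborel. (a s * ?\<Phi> s) * (b v * ?\<Phi> v))"
  proof (intro Bochner_Integration.integral_cong refl)
    fix s v
    show "a s * b v * ?\<Phi> (s + v) = (a s * ?\<Phi> s) * (b v * ?\<Phi> v)"
    proof (cases "s < 0 \<or> v < 0")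
      case True
      then show ?thesis using a b by (auto simp: L1p_def)
    next
      case False
      then have "?\<Phi> (s + v) = ?\<Phi> s * ?\<Phi> v"
        by (simp add: max_def mult_exp_exp algebra_simps)
      then show ?thesis by (simp only: mult_ac)
    qed
  qed
  also have "\<dots> = (LINT s|lborel. (a s * ?\<Phi> s) * laplace b z)"
    by (simp add: laplace_eq_LINT[OF b z])
  also have "\<dots> = laplace a z * laplace b z"
    unfolding laplace_eq_LINT[OF a z] by (rule integral_mult_left_zero)
  finally show ?thesis .
qed

lemma (in bdd_semigroup) damped_semigroup:
  assumes d: "\<delta> \<ge> 0"
  shows "bdd_semigroup J (\<lambda>t. exp (- (\<delta> * t)) *\<^sub>R T t) C"
proof unfold_locales
  have bound: "norm (exp (- (\<delta> * t)) *\<^sub>R T t) \<le> C" if t: "t \<ge> 0" for t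
  proof -
    have "exp (- (\<delta> * t)) * norm (T t) \<le> 1 * C"
      using d t norm_T[OF t] by (intro mult_mono) auto
    then show ?thesis by simp
  qed
  then show "norm (exp (- (\<delta> * t)) *\<^sub>R T t) \<le> C" if "t \<ge> 0" for t using that .
  show "bounded_C0_semigroup J (\<lambda>t. exp (- (\<delta> * t)) *\<^sub>R T t)"
    unfolding bounded_C0_semigroup_def
  proof (intro conjI allI impI)
    show "exp (- (\<delta> * t)) *\<^sub>R T t \<in> BH J" if "t \<ge> 0" for t
      using T_BH[OF that] by (simp add: BH_def blinfun.scaleR_left J.scaleR)
    show "exp (- (\<delta> * 0)) *\<^sub>R T 0 = id_blinfun" by (simp add: T_0)
    show "exp (- (\<delta> * (s + t))) *\<^sub>R T (s + t) = (exp (- (\<delta> * s)) *\<^sub>R T s) o\<^sub>L (exp (- (\<delta> * t)) *\<^sub>R T t)"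
      if "s \<ge> 0" "t \<ge> 0" for s t
      by (rule blinfun_eqI) (simp add: T_add[OF that] blinfun.scaleR_left blinfun.scaleR_right mult_exp_exp algebra_simps)
    show "continuous_on {0..} (\<lambda>t. (exp (- (\<delta> * t)) *\<^sub>R T t) x)" for x
      unfolding blinfun.scaleR_left by (intro continuous_intros T_cont)
    show "\<exists>M. \<forall>t\<ge>0. norm (exp (- (\<delta> * t)) *\<^sub>R T t) \<le> M" using bound by blast
  qed
qed

text \<open>Damping preserves the bound \<open>C\<close> of the semigroup, so the key estimate
  transfers with a constant independent of \<delta>. This gives the uniformity required by
  \<open>calc\<close>.\<close>

lemma (in bdd_semigroup) key_estimate_damped:
  assumes n: "fourier_pair f c" and h: "integrable lborel h" "\<And>u. u \<le> 0 \<Longrightarrow> hft h u = 0" and d: "\<delta> \<ge> 0"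
  shows "norm (hp (damp \<delta> (\<lambda>r. c r * hft h r))) \<le> C\<^sup>2 * (supnorm f * (LINT s|lborel. norm (h s)))"
proof -
  interpret D: bdd_semigroup J "\<lambda>t. exp (- (\<delta> * t)) *\<^sub>R T t" C by (rule damped_semigroup[OF d])
  have b: "integrable lborel (\<lambda>r. c r * hft h r)"
    using fourier_pair_hft_L1p[OF n h] by (simp add: L1p_def)
  have "D.hp (\<lambda>r. c r * hft h r) = hp (damp \<delta> (\<lambda>r. c r * hft h r))"
  proof (rule hp_unique[OF integrable_damp[OF b d]])
    have "D.\<Theta> x y t = of_real (exp (- (\<delta> * max 0 t))) * \<Theta> x y t" for x y t
      by (simp add: D.\<Theta>_def \<Theta>_def blinfun.scaleR_left cinner_scaleR scaleR_conv_of_real)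
    then show "cinner J (D.hp (\<lambda>r. c r * hft h r) x) y = (LINT t|lborel. damp \<delta> (\<lambda>r. c r * hft h r) t * \<Theta> x y t)" for x y
      unfolding D.cinner_hp[OF b] damp_def by (simp only: mult_ac)
  qed
  then show ?thesis using D.key_estimate[OF n h] by simp
qed

section \<open>The closed functional calculus\<close>

lemma nonpos_of_le_epsilon_mult:
  fixes a K :: real
  assumes "\<And>e. e > 0 \<Longrightarrow> a \<le> e * K"
  shows "a \<le> 0"
proof (cases "K > 0")
  case True
  show ?thesis
  proof (rule field_le_epsilon)
    fix e :: real assume "e > 0"
    then show "a \<le> 0 + e" using assms[of "e / K"] True by simp
  qed
next
  case False
  then show ?thesis using assms[of 1] by simp
qed

context bdd_semigroup
begin

lemma norm_hp_damp_le:
  assumes b: "integrable lborel b" and d: "\<delta> \<ge> 0"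
  shows "norm (hp (damp \<delta> b)) \<le> C * (LINT t|lborel. norm (b t))"
proof -
  have "norm (hp (damp \<delta> b)) \<le> C * (LINT t|lborel. norm (damp \<delta> b t))"
    by (rule norm_hp_le[OF integrable_damp[OF b d]])
  also have "\<dots> \<le> C * (LINT t|lborel. norm (b t))"
    by (rule mult_left_mono[OF integral_mono[OF integrable_norm[OF integrable_damp[OF b d]] integrable_norm[OF b] norm_damp_le[OF d]] C_nonneg])
  finally show ?thesis .
qed

text \<open>\<open>calc \<phi> \<beta>\<close> says that \<open>(\<phi>, \<beta>)\<close> is a limit of pairs \<open>(L\<^sub>b, \<delta> \<mapsto> L\<^sub>b(A + \<delta>))\<close>, uniformly
  on the half-plane and uniformly in \<open>\<delta> \<ge> 0\<close>; then \<open>\<phi>(A)\<close> is \<open>\<beta> 0\<close>. The family in \<open>\<delta>\<close>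
  is what makes the calculus single-valued: \<open>\<beta> \<delta>\<close> for \<open>\<delta> > 0\<close> is determined by \<open>\<phi>\<close>.
  Products of elements of \<open>\<A>\<^sub>0\<close> belong to the domain without showing that \<open>\<A>\<^sub>0\<close> is an algebra.\<close>

definition calc :: "(complex \<Rightarrow> complex) \<Rightarrow> (real \<Rightarrow> 'h \<Rightarrow>\<^sub>L 'h) \<Rightarrow> bool" where
  "calc \<phi> \<beta> \<longleftrightarrow> (\<forall>e>0. \<exists>b\<in>L1p. (\<forall>z. 0 < Re z \<longrightarrow> norm (\<phi> z - laplace b z) \<le> e) \<and>
     (\<forall>\<delta>\<ge>0. norm (\<beta> \<delta> - hp (damp \<delta> b)) \<le> e))"

lemma calcE:
  assumes "calc \<phi> \<beta>" "e > 0"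
  obtains b where "b \<in> L1p" "integrable lborel b" "\<And>z. 0 < Re z \<Longrightarrow> norm (\<phi> z - laplace b z) \<le> e"
    "\<And>\<delta>. \<delta> \<ge> 0 \<Longrightarrow> norm (\<beta> \<delta> - hp (damp \<delta> b)) \<le> e"
proof -
  obtain b where "b \<in> L1p" and b: "\<forall>z. 0 < Re z \<longrightarrow> norm (\<phi> z - laplace b z) \<le> e"
    "\<forall>\<delta>\<ge>0. norm (\<beta> \<delta> - hp (damp \<delta> b)) \<le> e"
    using assms(1)[unfolded calc_def, rule_format, OF assms(2)] by auto
  moreover have "integrable lborel b" using \<open>b \<in> L1p\<close> by (simp add: L1p_def)
  ultimately show ?thesis using that by simp
qed

lemma calc_add:
  assumes "calc \<phi> \<beta>" "calc \<psi> \<gamma>"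
  shows "calc (\<lambda>z. \<phi> z + \<psi> z) (\<lambda>\<delta>. \<beta> \<delta> + \<gamma> \<delta>)"
  unfolding calc_def
proof (intro allI impI)
  fix e :: real assume "e > 0"
  then have e2: "e / 2 > 0" by simp
  obtain a where a: "a \<in> L1p" "integrable lborel a" "\<And>z. 0 < Re z \<Longrightarrow> norm (\<phi> z - laplace a z) \<le> e / 2"
    "\<And>\<delta>. \<delta> \<ge> 0 \<Longrightarrow> norm (\<beta> \<delta> - hp (damp \<delta> a)) \<le> e / 2" using calcE[OF assms(1) e2] by blast
  obtain b where b: "b \<in> L1p" "integrable lborel b" "\<And>z. 0 < Re z \<Longrightarrow> norm (\<psi> z - laplace b z) \<le> e / 2"
    "\<And>\<delta>. \<delta> \<ge> 0 \<Longrightarrow> norm (\<gamma> \<delta> - hp (damp \<delta> b)) \<le> e / 2" using calcE[OF assms(2) e2] by blast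
  show "\<exists>b\<in>L1p. (\<forall>z. 0 < Re z \<longrightarrow> norm (\<phi> z + \<psi> z - laplace b z) \<le> e) \<and>
     (\<forall>\<delta>\<ge>0. norm (\<beta> \<delta> + \<gamma> \<delta> - hp (damp \<delta> b)) \<le> e)"
  proof (intro bexI[of _ "\<lambda>t. a t + b t"] conjI allI impI)
    show "(\<lambda>t. a t + b t) \<in> L1p" using a b by (auto simp: L1p_def)
    fix z assume z: "0 < Re z"
    show "norm (\<phi> z + \<psi> z - laplace (\<lambda>t. a t + b t) z) \<le> e"
      unfolding laplace_add[OF a(1) b(1) z] add_diff_add
      using norm_triangle_mono[OF a(3)[OF z] b(3)[OF z]] by simp
  next
    fix \<delta> :: real assume d: "\<delta> \<ge> 0"
    show "norm (\<beta> \<delta> + \<gamma> \<delta> - hp (damp \<delta> (\<lambda>t. a t + b t))) \<le> e"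
      unfolding damp_linear hp_add[OF integrable_damp[OF a(2) d] integrable_damp[OF b(2) d]] add_diff_add
      using norm_triangle_mono[OF a(4)[OF d] b(4)[OF d]] by simp
  qed
qed

lemma calc_cmult:
  assumes "calc \<phi> \<beta>"
  shows "calc (\<lambda>z. c * \<phi> z) (\<lambda>\<delta>. Blinfun (cscale J c) o\<^sub>L \<beta> \<delta>)"
  unfolding calc_def
proof (intro allI impI)
  fix e :: real assume e: "e > 0"
  define e' where "e' = e / (norm c + 1)"
  have e': "e' > 0" using e by (simp add: e'_def add_nonneg_pos)
  have ce: "norm c * e' \<le> e"
  proof -
    have "norm c * e' \<le> (norm c + 1) * e'" using e' by (intro mult_right_mono) auto
    also have "\<dots> = e" using norm_ge_zero[of c] by (simp add: e'_def add_nonneg_eq_0_iff)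
    finally show ?thesis .
  qed
  obtain a where a: "a \<in> L1p" "integrable lborel a" "\<And>z. 0 < Re z \<Longrightarrow> norm (\<phi> z - laplace a z) \<le> e'"
    "\<And>\<delta>. \<delta> \<ge> 0 \<Longrightarrow> norm (\<beta> \<delta> - hp (damp \<delta> a)) \<le> e'" using calcE[OF assms e'] by blast
  have cs: "norm (Blinfun (cscale J c)) \<le> norm c"
    by (rule norm_blinfun_bound) (auto simp: bounded_linear_Blinfun_apply[OF bounded_linear_cscale] norm_cscale)
  show "\<exists>b\<in>L1p. (\<forall>z. 0 < Re z \<longrightarrow> norm (c * \<phi> z - laplace b z) \<le> e) \<and>
     (\<forall>\<delta>\<ge>0. norm ((Blinfun (cscale J c) o\<^sub>L \<beta> \<delta>) - hp (damp \<delta> b)) \<le> e)"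
  proof (intro bexI[of _ "\<lambda>t. c * a t"] conjI allI impI)
    show "(\<lambda>t. c * a t) \<in> L1p" using a by (auto simp: L1p_def)
    fix z assume z: "0 < Re z"
    have "norm (c * \<phi> z - laplace (\<lambda>t. c * a t) z) = norm c * norm (\<phi> z - laplace a z)"
      by (simp only: laplace_cmult[OF a(1) z] right_diff_distrib[symmetric] norm_mult)
    also have "\<dots> \<le> norm c * e'" by (intro mult_left_mono a(3) z) simp
    finally show "norm (c * \<phi> z - laplace (\<lambda>t. c * a t) z) \<le> e" using ce by linarith
  next
    fix \<delta> :: real assume d: "\<delta> \<ge> 0"
    have "hp (damp \<delta> (\<lambda>t. c * a t)) = Blinfun (cscale J c) o\<^sub>L hp (damp \<delta> a)"
      unfolding damp_linear
      by (rule blinfun_eqI) (simp add: hp_cmult[OF integrable_damp[OF a(2) d]] bounded_linear_Blinfun_apply[OF bounded_linear_cscale])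
    then have "(Blinfun (cscale J c) o\<^sub>L \<beta> \<delta>) - hp (damp \<delta> (\<lambda>t. c * a t)) = Blinfun (cscale J c) o\<^sub>L (\<beta> \<delta> - hp (damp \<delta> a))"
      by (simp add: bounded_bilinear.diff_right[OF bounded_bilinear_blinfun_compose])
    then have "norm ((Blinfun (cscale J c) o\<^sub>L \<beta> \<delta>) - hp (damp \<delta> (\<lambda>t. c * a t))) \<le> norm (Blinfun (cscale J c)) * norm (\<beta> \<delta> - hp (damp \<delta> a))"
      using norm_blinfun_compose[of "Blinfun (cscale J c)" "\<beta> \<delta> - hp (damp \<delta> a)"] by simp
    also have "\<dots> \<le> norm c * e'" by (intro mult_mono cs a(4) d) auto
    finally show "norm ((Blinfun (cscale J c) o\<^sub>L \<beta> \<delta>) - hp (damp \<delta> (\<lambda>t. c * a t))) \<le> e" using ce by linarith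
  qed
qed

lemma calc_bounded:
  assumes "calc \<phi> \<beta>"
  obtains W where "W > 0" "\<And>z. 0 < Re z \<Longrightarrow> norm (\<phi> z) \<le> W" "\<And>\<delta>. \<delta> \<ge> 0 \<Longrightarrow> norm (\<beta> \<delta>) \<le> W"
proof -
  obtain b where b: "b \<in> L1p" "integrable lborel b" "\<And>z. 0 < Re z \<Longrightarrow> norm (\<phi> z - laplace b z) \<le> 1"
    "\<And>\<delta>. \<delta> \<ge> 0 \<Longrightarrow> norm (\<beta> \<delta> - hp (damp \<delta> b)) \<le> 1" using calcE[OF assms zero_less_one] by blast
  define n where "n = (LINT t|lborel. norm (b t))"
  have n: "n \<ge> 0" by (simp add: n_def)
  define W where "W = 1 + n + C * n"
  have Cn: "C * n \<ge> 0" using C_nonneg n by simp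
  show ?thesis
  proof (rule that[of W])
    show "W > 0" using n Cn by (simp add: W_def)
    show "norm (\<phi> z) \<le> W" if "0 < Re z" for z
      using b(3)[OF that] norm_laplace_le[OF b(1), of z] norm_triangle_ineq2[of "\<phi> z" "laplace b z"] Cn
      unfolding W_def n_def[symmetric] by linarith
    show "norm (\<beta> \<delta>) \<le> W" if "\<delta> \<ge> 0" for \<delta>
      using b(4)[OF that] norm_hp_damp_le[OF b(2) that] norm_triangle_ineq2[of "\<beta> \<delta>" "hp (damp \<delta> b)"] n
      unfolding W_def n_def[symmetric] by linarith
  qed
qed

text \<open>Convolutions of approximants approximate the product, since both the Laplace transform
  and \<open>hp\<close> turn them into products. The error is split as \<phi> (\<psi> - L_b) +
  (\<phi> - L_a) L_b, and likewise for operators, with bounds from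
  \<open>calc_bounded\<close>.\<close>

lemma calc_mult:
  assumes "calc \<phi> \<beta>" "calc \<psi> \<gamma>"
  shows "calc (\<lambda>z. \<phi> z * \<psi> z) (\<lambda>\<delta>. \<beta> \<delta> o\<^sub>L \<gamma> \<delta>)"
  unfolding calc_def
proof (intro allI impI)
  fix e :: real assume e: "e > 0"
  obtain W where W: "W > 0" "\<And>z. 0 < Re z \<Longrightarrow> norm (\<phi> z) \<le> W" "\<And>\<delta>. \<delta> \<ge> 0 \<Longrightarrow> norm (\<beta> \<delta>) \<le> W"
    using calc_bounded[OF assms(1)] by blast
  obtain V where V: "V > 0" "\<And>z. 0 < Re z \<Longrightarrow> norm (\<psi> z) \<le> V" "\<And>\<delta>. \<delta> \<ge> 0 \<Longrightarrow> norm (\<gamma> \<delta>) \<le> V"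
    using calc_bounded[OF assms(2)] by blast
  \<comment> \<open>An error of at most 1 keeps the approximants of the second factor below
    \<open>V + 1\<close>; the other bound makes W \<eta> + \<eta> (V + 1) at most e.\<close>
  define \<eta> where "\<eta> = min 1 (e / (W + V + 1))"
  have \<eta>: "\<eta> > 0" "\<eta> \<le> 1" using e W V by (auto simp: \<eta>_def)
  have \<eta>e: "W * \<eta> + \<eta> * (V + 1) \<le> e"
  proof -
    have "(W + V + 1) * \<eta> \<le> (W + V + 1) * (e / (W + V + 1))"
      using W V by (intro mult_left_mono) (auto simp: \<eta>_def)
    also have "\<dots> = e" using W V by simp
    finally show ?thesis by (simp add: algebra_simps)
  qed
  obtain a where a: "a \<in> L1p" "integrable lborel a" "\<And>z. 0 < Re z \<Longrightarrow> norm (\<phi> z - laplace a z) \<le> \<eta>"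
    "\<And>\<delta>. \<delta> \<ge> 0 \<Longrightarrow> norm (\<beta> \<delta> - hp (damp \<delta> a)) \<le> \<eta>" using calcE[OF assms(1) \<eta>(1)] by blast
  obtain b where b: "b \<in> L1p" "integrable lborel b" "\<And>z. 0 < Re z \<Longrightarrow> norm (\<psi> z - laplace b z) \<le> \<eta>"
    "\<And>\<delta>. \<delta> \<ge> 0 \<Longrightarrow> norm (\<gamma> \<delta> - hp (damp \<delta> b)) \<le> \<eta>" using calcE[OF assms(2) \<eta>(1)] by blast
  show "\<exists>b\<in>L1p. (\<forall>z. 0 < Re z \<longrightarrow> norm (\<phi> z * \<psi> z - laplace b z) \<le> e) \<and>
     (\<forall>\<delta>\<ge>0. norm ((\<beta> \<delta> o\<^sub>L \<gamma> \<delta>) - hp (damp \<delta> b)) \<le> e)"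
  proof (intro bexI[of _ "bconv a b"] conjI allI impI)
    show "bconv a b \<in> L1p" by (rule bconv_L1p[OF a(1) b(1)])
    fix z assume z: "0 < Re z"
    have Lb: "norm (laplace b z) \<le> V + 1"
      using norm_triangle_ineq3[of "laplace b z" "\<psi> z"] b(3)[OF z] V(2)[OF z] \<eta> by (simp add: norm_minus_commute)
    have "\<phi> z * \<psi> z - laplace (bconv a b) z = \<phi> z * (\<psi> z - laplace b z) + (\<phi> z - laplace a z) * laplace b z"
      by (simp add: laplace_bconv[OF a(1) b(1) z] algebra_simps)
    also have "norm \<dots> \<le> W * \<eta> + \<eta> * (V + 1)"
      using W V by (intro norm_triangle_mono) (auto simp: norm_mult intro!: mult_mono W(2) a(3) b(3) z Lb less_imp_le[OF \<eta>(1)])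
    finally show "norm (\<phi> z * \<psi> z - laplace (bconv a b) z) \<le> e" using \<eta>e by linarith
  next
    fix \<delta> :: real assume d: "\<delta> \<ge> 0"
    let ?A = "hp (damp \<delta> a)" and ?B = "hp (damp \<delta> b)"
    have B: "norm ?B \<le> V + 1"
      using norm_triangle_ineq3[of ?B "\<gamma> \<delta>"] b(4)[OF d] V(3)[OF d] \<eta> by (simp add: norm_minus_commute)
    have "hp (damp \<delta> (bconv a b)) = ?A o\<^sub>L ?B"
      unfolding damp_bconv[OF a(1) b(1)] by (rule hp_mult[OF damp_L1p[OF a(1) d] damp_L1p[OF b(1) d]])
    then have "(\<beta> \<delta> o\<^sub>L \<gamma> \<delta>) - hp (damp \<delta> (bconv a b)) = (\<beta> \<delta> o\<^sub>L (\<gamma> \<delta> - ?B)) + ((\<beta> \<delta> - ?A) o\<^sub>L ?B)"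
      by (simp add: bounded_bilinear.diff_right[OF bounded_bilinear_blinfun_compose]
          bounded_bilinear.diff_left[OF bounded_bilinear_blinfun_compose])
    also have "norm \<dots> \<le> W * \<eta> + \<eta> * (V + 1)"
      using W V by (intro norm_triangle_mono order_trans[OF norm_blinfun_compose] mult_mono W(3) a(4) b(4) d B less_imp_le[OF \<eta>(1)]) auto
    finally show "norm ((\<beta> \<delta> o\<^sub>L \<gamma> \<delta>) - hp (damp \<delta> (bconv a b))) \<le> e" using \<eta>e by linarith
  qed
qed

lemma calc_laplace: "b \<in> L1p \<Longrightarrow> calc (laplace b) (\<lambda>\<delta>. hp (damp \<delta> b))"
  unfolding calc_def by (intro allI impI bexI[of _ b]) auto

lemma calc_BH:
  assumes "calc \<phi> \<beta>" shows "\<beta> 0 \<in> BH J"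
  unfolding BH_def
proof (intro CollectI allI)
  fix x
  have "norm (\<beta> 0 (J x) - J (\<beta> 0 x)) \<le> e * (2 * norm x)" if e: "e > 0" for e
  proof -
    obtain b where b: "b \<in> L1p" "integrable lborel b" "\<And>\<delta>. \<delta> \<ge> 0 \<Longrightarrow> norm (\<beta> \<delta> - hp (damp \<delta> b)) \<le> e"
      by (rule calcE[OF assms e]) (assumption | rule that)+
    let ?D = "\<beta> 0 - hp b"
    have "norm ?D \<le> e" using b(3)[of 0] by simp
    then have D: "norm (?D v) \<le> e * norm v" for v
      by (rule order_trans[OF norm_blinfun mult_right_mono]) simp
    have "\<beta> 0 (J x) - J (\<beta> 0 x) = ?D (J x) - J (?D x)"
      using hp_BH[OF b(2)] by (simp add: BH_def blinfun.diff_left J.diff)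
    also have "norm \<dots> \<le> norm (?D (J x)) + norm (J (?D x))" by (rule norm_triangle_ineq4)
    also have "\<dots> \<le> e * norm x + e * norm x" using D[of "J x"] D[of x] by simp
    finally show ?thesis by (simp add: algebra_simps)
  qed
  then have "norm (\<beta> 0 (J x) - J (\<beta> 0 x)) \<le> 0"
    by (rule nonpos_of_le_epsilon_mult)
  then show "\<beta> 0 (J x) = J (\<beta> 0 x)" by simp
qed

end

text \<open>Boundary values: along z = 1 / (n + 1) - i u the Laplace transform tends to the Fourier
  integral at u, by dominated convergence.\<close>

lemma norm_fourier_le_of_laplace:
  assumes b: "b \<in> L1p" and e: "\<And>z. 0 < Re z \<Longrightarrow> norm (laplace b z) \<le> e"
  shows "norm (LINT t|lborel. b t * cis (u * t)) \<le> e"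
proof -
  have bi: "integrable lborel b" using b by (simp add: L1p_def)
  then have [measurable]: "b \<in> borel_measurable borel" by (auto dest: borel_measurable_integrable)
  define z where "z n = Complex (1 / real (Suc n)) (- u)" for n
  have "(\<lambda>n. LINT t|lborel. b t * exp (- (of_real (max 0 t) * z n))) \<longlonglongrightarrow> (LINT t|lborel. b t * cis (u * t))"
  proof (rule integral_dominated_convergence)
    show "integrable lborel (\<lambda>t. norm (b t))" using bi by simp
    show "AE t in lborel. norm (b t * exp (- (of_real (max 0 t) * z n))) \<le> norm (b t)" for n
      by (intro AE_I2) (auto simp: norm_mult z_def intro!: mult_left_le)
    show "AE t in lborel. (\<lambda>n. b t * exp (- (of_real (max 0 t) * z n))) \<longlonglongrightarrow> b t * cis (u * t)"
    proof (rule AE_I2)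
      fix t
      show "(\<lambda>n. b t * exp (- (of_real (max 0 t) * z n))) \<longlonglongrightarrow> b t * cis (u * t)"
      proof (cases "t < 0")
        case True
        then show ?thesis using b by (simp add: L1p_def)
      next
        case False
        have "(\<lambda>n. 1 / real (Suc n)) \<longlonglongrightarrow> 0"
          using LIMSEQ_inverse_real_of_nat by (simp add: inverse_eq_divide)
        then have "(\<lambda>n. of_real (1 / real (Suc n)) + \<i> * of_real (- u)) \<longlonglongrightarrow> of_real 0 + \<i> * of_real (- u)"
          by (intro tendsto_intros)
        then have "z \<longlonglongrightarrow> of_real 0 + \<i> * of_real (- u)" by (simp add: z_def[abs_def] Complex_eq)
        then have "(\<lambda>n. b t * exp (- (of_real (max 0 t) * z n))) \<longlonglongrightarrow> b t * exp (- (of_real (max 0 t) * (of_real 0 + \<i> * of_real (- u))))"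
          by (intro tendsto_intros)
        moreover have "exp (- (of_real (max 0 t) * (of_real 0 + \<i> * of_real (- u)))) = cis (u * t)"
          using False by (simp add: cis_conv_exp max_def mult_ac)
        ultimately show ?thesis by (simp only:)
      qed
    qed
  qed measurable
  from tendsto_norm[OF this] show ?thesis
  proof (rule LIMSEQ_le_const2, intro exI allI impI)
    fix n
    have "0 < Re (z n)" by (simp add: z_def)
    then show "norm (LINT t|lborel. b t * exp (- (of_real (max 0 t) * z n))) \<le> e"
      using e[of "z n"] laplace_eq_LINT[OF b, of "z n"] by simp
  qed
qed

text \<open>As \<open>gamma2 l\<close> is the transform of an integrable G, the smoothed density is
  an integral of G against the Fourier transform of \<open>b\<close>, so K can be the L^1 norm of G.
  Since K depends on \<open>l\<close> only, a small Laplace transform forces a uniformly small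
  smoothed density, whatever the L^1 norm of \<open>b\<close>.\<close>

lemma norm_bconv_gamma2_le:
  assumes l: "l > 0"
  obtains K where "K \<ge> 0"
    "\<And>b e r. b \<in> L1p \<Longrightarrow> (\<And>z. 0 < Re z \<Longrightarrow> norm (laplace b z) \<le> e) \<Longrightarrow> norm (bconv b (gamma2 l) r) \<le> K * e"
proof -
  obtain G where G: "integrable lborel G" "\<And>t. gamma2 l t = (LINT u|lborel. G u * cis (- (u * t)))"
    using gamma2_inversion[OF l] by blast
  show ?thesis
  proof (rule that[of "LINT u|lborel. norm (G u)"])
    fix b e r assume b: "b \<in> L1p" and e: "\<And>z. 0 < Re z \<Longrightarrow> norm (laplace b z) \<le> e"
    have bi: "integrable lborel b" using b by (simp add: L1p_def)
    then have [measurable]: "b \<in> borel_measurable borel" by (auto dest: borel_measurable_integrable)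
    have "bconv b (gamma2 l) r = (LINT s|lborel. LINT u|lborel. b s * G u * cis (- (u * (r - s))))"
      unfolding bconv_def G(2) by (simp add: mult.assoc)
    also have "\<dots> = (LINT u|lborel. LINT s|lborel. b s * G u * cis (- (u * (r - s))))"
      using integrable_pair_mult[OF bi G(1), of "\<lambda>(s, u). cis (- (u * (r - s)))" 1]
      by (intro lborel_pair.Fubini_integral[symmetric]) simp
    also have "\<dots> = (LINT u|lborel. G u * (cis (- (u * r)) * (LINT s|lborel. b s * cis (u * s))))"
    proof (rule Bochner_Integration.integral_cong[OF refl])
      fix u
      have "cis (- (u * (r - s))) = cis (- (u * r)) * cis (u * s)" for s
        unfolding cis_mult by (rule arg_cong[of _ _ cis]) (simp add: algebra_simps)
      then have "(LINT s|lborel. b s * G u * cis (- (u * (r - s)))) = (LINT s|lborel. (G u * cis (- (u * r))) * (b s * cis (u * s)))"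
        by (simp only: mult_ac)
      then show "(LINT s|lborel. b s * G u * cis (- (u * (r - s)))) = G u * (cis (- (u * r)) * (LINT s|lborel. b s * cis (u * s)))"
        by (simp only: integral_mult_right_zero mult.assoc)
    qed
    also have "norm \<dots> \<le> (LINT u|lborel. norm (G u)) * e"
    proof (rule norm_integral_mult_le[OF G(1)])
      show "norm (cis (- (u * r)) * (LINT s|lborel. b s * cis (u * s))) \<le> e" for u
        using norm_fourier_le_of_laplace[OF b e, of u] by (simp add: norm_mult)
    qed measurable
    finally show "norm (bconv b (gamma2 l) r) \<le> (LINT u|lborel. norm (G u)) * e" .
  qed simp
qed

text \<open>By scaling, gamma2 l (s / l) / l = gamma2 1 s, and the mass of \<open>gamma2 1\<close>
  is its transform at 0.\<close>

lemma gamma2_approx_identity: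
  fixes g :: "real \<Rightarrow> complex"
  assumes g: "continuous_on UNIV g" and B: "\<And>t. norm (g t) \<le> B"
  shows "(\<lambda>n. LINT t|lborel. gamma2 (real (Suc n)) t * g t) \<longlonglongrightarrow> g 0"
proof -
  have [measurable]: "g \<in> borel_measurable borel" using g by (rule borel_measurable_continuous_onI)
  have g1: "integrable lborel (gamma2 1)" by (rule integrable_gamma2) simp
  then have [measurable]: "gamma2 1 \<in> borel_measurable borel" by (auto dest: borel_measurable_integrable)
  have eq: "(LINT t|lborel. gamma2 (real (Suc n)) t * g t) = (LINT s|lborel. gamma2 1 s * g (s / Suc n))" for n
  proof -
    define l where "l = real (Suc n)"
    have l: "l > 0" by (simp add: l_def)
    have "(LINT t|lborel. gamma2 l t * g t) = (1 / l) *\<^sub>R (LINT s|lborel. gamma2 l (0 + 1 / l * s) * g (0 + 1 / l * s))"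
      by (rule integral_affine) (use l in simp)
    also have "\<dots> = (LINT s|lborel. (1 / l) *\<^sub>R (gamma2 l (0 + 1 / l * s) * g (0 + 1 / l * s)))"
      by simp
    also have "\<dots> = (LINT s|lborel. gamma2 1 s * g (s / l))"
    proof (rule Bochner_Integration.integral_cong[OF refl])
      fix s
      have "max 0 (1 / l * s) = max 0 s / l" using l by (auto simp: max_def field_simps)
      then have "(1 / l) * (l\<^sup>2 * max 0 (1 / l * s) * exp (- (l * max 0 (1 / l * s)))) = 1\<^sup>2 * max 0 s * exp (- (1 * max 0 s))"
        using l by (simp add: power2_eq_square)
      then have "(1 / l) *\<^sub>R gamma2 l (0 + 1 / l * s) = gamma2 1 s"
        unfolding gamma2_def by (metis add_0 scaleR_conv_of_real of_real_mult)
      moreover have "0 + 1 / l * s = s / l" by simp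
      ultimately show "(1 / l) *\<^sub>R (gamma2 l (0 + 1 / l * s) * g (0 + 1 / l * s)) = gamma2 1 s * g (s / l)"
        by (metis mult_scaleR_left)
    qed
    finally show ?thesis by (simp add: l_def)
  qed
  have "(\<lambda>n. LINT s|lborel. gamma2 1 s * g (s / Suc n)) \<longlonglongrightarrow> (LINT s|lborel. gamma2 1 s * g 0)"
  proof (rule integral_dominated_convergence)
    show "integrable lborel (\<lambda>s. norm (gamma2 1 s) * B)" using g1 by simp
    show "AE s in lborel. norm (gamma2 1 s * g (s / Suc n)) \<le> norm (gamma2 1 s) * B" for n
      by (intro AE_I2) (auto simp: norm_mult B intro!: mult_left_mono)
    show "AE s in lborel. (\<lambda>n. gamma2 1 s * g (s / Suc n)) \<longlonglongrightarrow> gamma2 1 s * g 0"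
    proof (rule AE_I2)
      fix s
      have "(\<lambda>n. s / Suc n) \<longlonglongrightarrow> 0" by (rule LIMSEQ_Suc[OF lim_const_over_n])
      then have "(\<lambda>n. g (s / Suc n)) \<longlonglongrightarrow> g 0"
        using g by (intro continuous_on_tendsto_compose[where s = UNIV and f = g]) auto
      then show "(\<lambda>n. gamma2 1 s * g (s / Suc n)) \<longlonglongrightarrow> gamma2 1 s * g 0" by (intro tendsto_intros)
    qed
  qed measurable
  moreover have "(LINT s|lborel. gamma2 1 s) = 1"
  proof -
    have "Complex 1 0 = 1" by (simp add: complex_eq_iff)
    then show ?thesis using gamma2_fourier[of 1 0] by simp
  qed
  ultimately show ?thesis by (simp add: eq del: of_nat_Suc)
qed

context bdd_semigroup
begin

text \<open>The operators of the damped approximate identity tend weakly to the identity, which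
  removes the smoothing factor in \<open>calc_zero\<close>.\<close>

lemma hp_damp_gamma2_limit:
  assumes d: "\<delta> \<ge> 0"
  shows "(\<lambda>n. inner (hp (damp \<delta> (gamma2 (real (Suc n)))) x) y) \<longlonglongrightarrow> inner x y"
proof -
  define g where "g t = of_real (exp (- (\<delta> * max 0 t))) * \<Theta> x y t" for t
  have "(\<lambda>n. LINT t|lborel. gamma2 (real (Suc n)) t * g t) \<longlonglongrightarrow> g 0"
  proof (rule gamma2_approx_identity)
    show "continuous_on UNIV g" unfolding g_def by (intro continuous_intros continuous_\<Theta>)
    show "norm (g t) \<le> 1 * (C * norm x * norm y)" for t
      unfolding g_def norm_mult using d by (intro mult_mono norm_\<Theta>) auto
  qed
  from tendsto_Re[OF this]
  have "(\<lambda>n. Re (LINT t|lborel. gamma2 (real (Suc n)) t * g t)) \<longlonglongrightarrow> inner x y"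
    by (simp add: g_def \<Theta>_def T_0 cinner_def)
  moreover have "inner (hp (damp \<delta> (gamma2 (real (Suc n)))) x) y = Re (LINT t|lborel. gamma2 (real (Suc n)) t * g t)" for n
    by (subst inner_hp, intro integrable_damp integrable_gamma2 d, simp)
       (simp only: damp_def g_def mult_ac)
  ultimately show ?thesis by (simp only:)
qed

text \<open>For \<delta> > 0, smoothing makes the approximating densities uniformly small and
  damping makes them small in L^1, so \<beta> \<delta> annihilates every smoothing operator and
  hence is 0. The case \<delta> = 0 follows because the approximation in \<open>calc\<close> is
  uniform in \<delta>.\<close>

lemma calc_zero:
  assumes calc: "calc \<phi> \<beta>" and \<phi>: "\<And>z. 0 < Re z \<Longrightarrow> \<phi> z = 0"
  shows "\<beta> 0 = 0"
proof -
  have approx: "\<exists>b. b \<in> L1p \<and> integrable lborel b \<and> (\<forall>z. 0 < Re z \<longrightarrow> norm (laplace b z) \<le> e) \<and>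
      (\<forall>\<delta>\<ge>0. norm (\<beta> \<delta> - hp (damp \<delta> b)) \<le> e)" if "e > 0" for e
    by (rule calcE[OF calc that]) (use \<phi> in auto)
  have zero: "\<beta> \<delta> = 0" if d: "\<delta> > 0" for \<delta>
  proof -
    \<comment> \<open>The integral of exp (- r \<delta>), finite because \<delta> > 0; the factor
      \<open>r ^ 0\<close> only matches \<open>integrable_power_exp_halfline\<close>.\<close>
    define V where "V = (LINT r:{0<..}|lborel. r ^ 0 * exp (- (r * \<delta>)))"
    have Vi: "integrable lborel (\<lambda>r. indicator {0<..} r *\<^sub>R (r ^ 0 * exp (- (r * \<delta>))))"
      using integrable_power_exp_halfline[OF d, of 0] by (simp only: set_integrable_def)
    have comp: "\<beta> \<delta> o\<^sub>L hp (damp \<delta> (gamma2 l)) = 0" if l: "l > 0" for l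
    proof -
      have \<gamma>: "gamma2 l \<in> L1p" using integrable_gamma2[OF l] by (simp add: L1p_def gamma2_neg)
      obtain K where K: "K \<ge> 0" "\<And>b e r. b \<in> L1p \<Longrightarrow> (\<And>z. 0 < Re z \<Longrightarrow> norm (laplace b z) \<le> e) \<Longrightarrow> norm (bconv b (gamma2 l) r) \<le> K * e"
        using norm_bconv_gamma2_le[OF l] by blast
      let ?G = "hp (damp \<delta> (gamma2 l))"
      \<comment> \<open>The smoothed density is at most K e in modulus, so its damped version has
        L^1 norm at most K e V. The other summand comes from replacing \<beta> \<delta> by the
        operator of \<open>damp \<delta> b\<close>.\<close>
      have "norm (\<beta> \<delta> o\<^sub>L ?G) \<le> e * (norm ?G + C * (K * V))" if e: "e > 0" for e
      proof -
        obtain b where b: "b \<in> L1p" "integrable lborel b" "\<And>z. 0 < Re z \<Longrightarrow> norm (laplace b z) \<le> e"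
          "\<And>\<delta>. \<delta> \<ge> 0 \<Longrightarrow> norm (\<beta> \<delta> - hp (damp \<delta> b)) \<le> e" using approx[OF e] by blast
        have d0: "\<delta> \<ge> 0" using d by simp
        let ?c = "damp \<delta> (bconv b (gamma2 l))"
        have cL: "?c \<in> L1p" by (intro damp_L1p bconv_L1p b \<gamma> d0)
        then have ci: "integrable lborel ?c" by (simp add: L1p_def)
        have "norm (hp ?c) \<le> C * (LINT r|lborel. norm (?c r))" by (rule norm_hp_le[OF ci])
        also have "(LINT r|lborel. norm (?c r)) \<le> (LINT r|lborel. (K * e) * (indicator {0<..} r *\<^sub>R (r ^ 0 * exp (- (r * \<delta>)))))"
        proof (rule integral_mono_AE)
          show "integrable lborel (\<lambda>r. norm (?c r))" using ci by simp
          show "integrable lborel (\<lambda>r. (K * e) * (indicator {0<..} r *\<^sub>R (r ^ 0 * exp (- (r * \<delta>)))))"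
            by (rule integrable_mult_right[OF Vi])
          show "AE r in lborel. norm (?c r) \<le> (K * e) * (indicator {0<..} r *\<^sub>R (r ^ 0 * exp (- (r * \<delta>))))"
          proof (rule AE_mp[OF AE_lborel_singleton[of 0]], rule AE_I2, rule impI)
            fix r :: real assume r: "r \<noteq> 0"
            show "norm (?c r) \<le> (K * e) * (indicator {0<..} r *\<^sub>R (r ^ 0 * exp (- (r * \<delta>))))"
            proof (cases "r < 0")
              case True
              then show ?thesis using cL by (simp add: L1p_def)
            next
              case False
              then have "norm (?c r) = exp (- (r * \<delta>)) * norm (bconv b (gamma2 l) r)"
                using r by (simp add: damp_def norm_mult max_def mult.commute)
              also have "\<dots> \<le> exp (- (r * \<delta>)) * (K * e)" by (intro mult_left_mono K(2) b) auto
              finally show ?thesis using r False by (simp add: mult.commute)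
            qed
          qed
        qed
        also have "\<dots> = (K * e) * V"
          unfolding V_def set_lebesgue_integral_def by (rule integral_mult_right_zero)
        finally have hpc: "norm (hp ?c) \<le> C * ((K * e) * V)" using C_nonneg by (simp add: mult_left_mono)
        have "\<beta> \<delta> o\<^sub>L ?G = ((\<beta> \<delta> - hp (damp \<delta> b)) o\<^sub>L ?G) + (hp (damp \<delta> b) o\<^sub>L ?G)"
          by (simp add: bounded_bilinear.diff_left[OF bounded_bilinear_blinfun_compose])
        also have "hp (damp \<delta> b) o\<^sub>L ?G = hp ?c"
          unfolding damp_bconv[OF b(1) \<gamma>] by (rule hp_mult[OF damp_L1p[OF b(1) d0] damp_L1p[OF \<gamma> d0], symmetric])
        also have "norm (((\<beta> \<delta> - hp (damp \<delta> b)) o\<^sub>L ?G) + hp ?c) \<le> e * norm ?G + C * ((K * e) * V)"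
          by (intro norm_triangle_mono order_trans[OF norm_blinfun_compose] mult_right_mono b(4) d0 hpc norm_ge_zero)
        finally show ?thesis by (simp only: distrib_left mult_ac)
      qed
      then have "norm (\<beta> \<delta> o\<^sub>L ?G) \<le> 0" by (rule nonpos_of_le_epsilon_mult)
      then show ?thesis by simp
    qed
    show ?thesis
    proof (rule blinfun_eqI)
      fix x
      have "inner (\<beta> \<delta> x) y = 0" for y
      proof -
        obtain z where z: "\<And>w. inner (\<beta> \<delta> w) y = inner w z" using blinfun_adjoint_exists[of "\<beta> \<delta>" y] by blast
        have "inner (hp (damp \<delta> (gamma2 (real (Suc n)))) x) z = 0" for n
        proof -
          have "(\<beta> \<delta> o\<^sub>L hp (damp \<delta> (gamma2 (real (Suc n))))) x = 0" by (simp add: comp del: of_nat_Suc)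
          then show ?thesis by (simp flip: z)
        qed
        then have "inner x z = 0"
          using LIMSEQ_unique[OF hp_damp_gamma2_limit[of \<delta> x z]] d by (simp del: of_nat_Suc)
        then show ?thesis by (simp add: z)
      qed
      then show "\<beta> \<delta> x = blinfun_apply 0 x" by (metis inner_eq_zero_iff zero_blinfun.rep_eq)
    qed
  qed
  \<comment> \<open>Now \<delta> decreases to 0 with \<open>b\<close> fixed: as \<beta> vanishes at
    positive \<delta>, the damped operators have norm at most e, and so has their weak limit
    \<open>hp b\<close>.\<close>
  have "norm (\<beta> 0) \<le> e * 2" if e: "e > 0" for e
  proof -
    obtain b where b: "b \<in> L1p" "integrable lborel b" "\<And>\<delta>. \<delta> \<ge> 0 \<Longrightarrow> norm (\<beta> \<delta> - hp (damp \<delta> b)) \<le> e"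
      using approx[OF e] by blast
    have [measurable]: "b \<in> borel_measurable borel" using b(2) by (auto dest: borel_measurable_integrable)
    have "norm (hp b) \<le> e"
    proof (rule norm_blinfun_le_of_inner)
      fix x y
      define \<delta> where "\<delta> n = 1 / real (Suc n)" for n
      have \<delta>: "\<delta> n > 0" for n by (simp add: \<delta>_def)
      have "(\<lambda>n. LINT t|lborel. damp (\<delta> n) b t * \<Theta> x y t) \<longlonglongrightarrow> (LINT t|lborel. b t * \<Theta> x y t)"
      proof (rule integral_dominated_convergence)
        show "integrable lborel (\<lambda>t. norm (b t * \<Theta> x y t))" using integrable_\<Theta>[OF b(2)] by simp
        show "AE t in lborel. norm (damp (\<delta> n) b t * \<Theta> x y t) \<le> norm (b t * \<Theta> x y t)" for n
          unfolding norm_mult using norm_damp_le[of "\<delta> n" b] \<delta>[of n] by (intro AE_I2 mult_right_mono) auto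
        show "AE t in lborel. (\<lambda>n. damp (\<delta> n) b t * \<Theta> x y t) \<longlonglongrightarrow> b t * \<Theta> x y t"
        proof (rule AE_I2)
          fix t
          have "\<delta> \<longlonglongrightarrow> 0" using LIMSEQ_inverse_real_of_nat by (simp add: \<delta>_def[abs_def] inverse_eq_divide)
          then have "(\<lambda>n. damp (\<delta> n) b t * \<Theta> x y t) \<longlonglongrightarrow> of_real (exp (- (0 * max 0 t))) * b t * \<Theta> x y t"
            unfolding damp_def by (intro tendsto_intros)
          then show "(\<lambda>n. damp (\<delta> n) b t * \<Theta> x y t) \<longlonglongrightarrow> b t * \<Theta> x y t" by simp
        qed
      qed (auto simp: damp_def)
      from tendsto_rabs[OF tendsto_Re[OF this]]
      have lim: "(\<lambda>n. \<bar>inner (hp (damp (\<delta> n) b) x) y\<bar>) \<longlonglongrightarrow> \<bar>inner (hp b x) y\<bar>"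
        using inner_hp[OF integrable_damp[OF b(2) less_imp_le[OF \<delta>]]] inner_hp[OF b(2)] by simp
      show "\<bar>inner (hp b x) y\<bar> \<le> e * norm x * norm y"
      proof (rule LIMSEQ_le_const2[OF lim], intro exI allI impI)
        fix n
        have "norm (hp (damp (\<delta> n) b)) \<le> e" using b(3)[of "\<delta> n"] zero[OF \<delta>, of n] \<delta>[of n] by simp
        then have "norm (hp (damp (\<delta> n) b)) * norm x * norm y \<le> e * norm x * norm y"
          by (intro mult_right_mono) auto
        then show "\<bar>inner (hp (damp (\<delta> n) b) x) y\<bar> \<le> e * norm x * norm y"
          by (rule order_trans[OF inner_blinfun_le])
      qed
    qed (use e in simp)
    moreover have "norm (\<beta> 0 - hp b) \<le> e" using b(3)[of 0] by simp
    ultimately show ?thesis using norm_triangle_ineq2[of "\<beta> 0" "hp b"] by linarith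
  qed
  then have "norm (\<beta> 0) \<le> 0" by (rule nonpos_of_le_epsilon_mult)
  then show ?thesis by simp
qed

lemma calc_unique:
  assumes "calc \<phi> \<beta>" "calc \<phi> \<gamma>"
  shows "\<beta> 0 = \<gamma> 0"
proof -
  have "(\<beta> 0) + (Blinfun (cscale J (-1)) o\<^sub>L \<gamma> 0) = 0"
    using calc_zero[OF calc_add[OF assms(1) calc_cmult[OF assms(2), of "-1"]]] by simp
  moreover have "Blinfun (cscale J (-1)) o\<^sub>L \<gamma> 0 = - \<gamma> 0"
    by (rule blinfun_eqI) (simp add: bounded_linear_Blinfun_apply[OF bounded_linear_cscale] blinfun.minus_left, simp add: cscale_def)
  ultimately show ?thesis by simp
qed

end

section \<open>The strong integral\<close>

context bdd_semigroup
begin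

text \<open>The integrand is a merely integrable scalar function times a continuous orbit, and its
  Riemann sums are compared with \<open>hp\<close> directly: Henstock's lemma handles the scalar
  factor, uniform continuity the orbit. Testing against a vector \<open>v\<close>, with errors
  proportional to |v|, reduces everything to scalar integrals.\<close>

lemma hp_has_integral_interval:
  assumes b: "integrable lborel b"
  shows "((\<lambda>t. cscale J (b t) (T (max 0 t) x)) has_integral hp (\<lambda>t. indicator {a..d} t *\<^sub>R b t) x) (cbox a d)"
  unfolding has_integral
proof (intro allI impI)
  fix e :: real assume e: "e > 0"
  define k where "k t = T (max 0 t) x" for t
  have kc: "continuous_on UNIV k"
    unfolding k_def by (rule continuous_on_compose2[OF T_cont]) (auto intro!: continuous_intros)
  have kb: "norm (k t) \<le> C * norm x" for t unfolding k_def by (rule norm_T_apply) simp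
  define B where "B = C * norm x + 1"
  have B: "B > 0" using C_nonneg by (simp add: B_def add_nonneg_pos)
  define n where "n = (LINT t|lborel. norm (b t)) + 1"
  have n: "n > 0" by (simp add: n_def add_nonneg_pos)
  have bcb: "b integrable_on cbox u v" and nbcb: "(\<lambda>t. norm (b t)) integrable_on cbox u v" for u v
    by (rule integrable_on_subcbox[OF integrable_on_lborel[OF b]], simp)
       (rule integrable_on_subcbox[OF integrable_on_lborel[OF integrable_norm[OF b]]], simp)
  \<comment> \<open>The tolerance e / (4 B) is later multiplied by the bound \<open>B\<close> of the
    orbit, and e / (4 n) by the integral of |b|, which is at most \<open>n\<close>. The total is e /
    2, hence below e.\<close>
  obtain \<gamma>1 where \<gamma>1: "gauge \<gamma>1" "\<And>p. p tagged_partial_division_of (cbox a d) \<Longrightarrow> \<gamma>1 fine p \<Longrightarrow>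
      (\<Sum>(t, K)\<in>p. norm (measure lborel K *\<^sub>R b t - integral K b)) < e / (4 * B)"
    using Henstock_lemma[OF bcb, of "e / (4 * B)" a d] e B by auto
  have "uniformly_continuous_on (cbox a d) k"
    by (intro compact_uniformly_continuous continuous_on_subset[OF kc]) auto
  then obtain \<eta> where \<eta>: "\<eta> > 0"
    "\<And>s t. s \<in> cbox a d \<Longrightarrow> t \<in> cbox a d \<Longrightarrow> dist s t < \<eta> \<Longrightarrow> dist (k s) (k t) < e / (4 * n)"
    using e n unfolding uniformly_continuous_on_def by (metis divide_pos_pos mult_pos_pos zero_less_numeral)
  let ?y = "hp (\<lambda>t. indicator {a..d} t *\<^sub>R b t) x"
  show "\<exists>\<gamma>. gauge \<gamma> \<and> (\<forall>D. D tagged_division_of cbox a d \<and> \<gamma> fine D \<longrightarrow>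
      norm ((\<Sum>(t, K)\<in>D. measure lborel K *\<^sub>R cscale J (b t) (T (max 0 t) x)) - ?y) < e)"
  proof (intro exI[of _ "\<lambda>t. \<gamma>1 t \<inter> ball t \<eta>"] conjI allI impI)
    show "gauge (\<lambda>t. \<gamma>1 t \<inter> ball t \<eta>)" using \<gamma>1(1) \<eta>(1) by (intro gauge_Int gauge_ball)
    fix D assume D: "D tagged_division_of cbox a d \<and> (\<lambda>t. \<gamma>1 t \<inter> ball t \<eta>) fine D"
    then have Dt: "D tagged_division_of cbox a d" and f1: "\<gamma>1 fine D" and f2: "(\<lambda>t. ball t \<eta>) fine D"
      by (auto simp: fine_Int)
    define S where "S = (\<Sum>(t, K)\<in>D. measure lborel K *\<^sub>R cscale J (b t) (k t))"
    have hen: "(\<Sum>(t, K)\<in>D. norm (measure lborel K *\<^sub>R b t - integral K b)) \<le> e / (4 * B)"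
      using \<gamma>1(2)[OF _ f1] Dt by (simp add: tagged_division_of_def less_imp_le)
    have indb: "integrable lborel (\<lambda>t. indicator {a..d} t *\<^sub>R b t)"
      using b by (intro integrable_mult_indicator) auto
    have main: "inner (S - ?y) v \<le> e / 2 * norm v" for v
    proof -
      define \<theta> where "\<theta> t = cinner J (k t) v" for t
      have \<theta>: "\<theta> = \<Theta> x v" by (simp add: \<theta>_def \<Theta>_def k_def fun_eq_iff)
      have \<theta>b: "norm (\<theta> t) \<le> B * norm v" for t
      proof -
        have "norm (\<theta> t) \<le> C * norm x * norm v" unfolding \<theta> by (rule norm_\<Theta>)
        also have "\<dots> \<le> B * norm v" by (intro mult_right_mono) (auto simp: B_def)
        finally show ?thesis .
      qed
      have ib\<theta>: "integrable lborel (\<lambda>t. b t * \<theta> t)" unfolding \<theta> by (rule integrable_\<Theta>[OF b])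
      have b\<theta>cb: "(\<lambda>t. b t * \<theta> t) integrable_on cbox u w" for u w
        using integrable_on_lborel[OF ib\<theta>] by (rule integrable_on_subcbox) auto
      have "inner ?y v = Re (LINT t|lborel. indicator {a..d} t *\<^sub>R b t * \<Theta> x v t)"
        by (rule inner_hp[OF indb])
      also have "(LINT t|lborel. indicator {a..d} t *\<^sub>R b t * \<Theta> x v t) = (LINT t:{a..d}|lborel. b t * \<theta> t)"
        by (simp add: set_lebesgue_integral_def \<theta>)
      also have "\<dots> = integral (cbox a d) (\<lambda>t. b t * \<theta> t)"
        unfolding cbox_interval
        by (rule set_borel_integral_eq_integral(2))
           (unfold set_integrable_def, rule integrable_mult_indicator[OF _ ib\<theta>], simp)
      also have "\<dots> = (\<Sum>(t, K)\<in>D. integral K (\<lambda>t. b t * \<theta> t))"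
        by (rule integral_combine_tagged_division_topdown[OF b\<theta>cb Dt])
      finally have y: "inner ?y v = Re (\<Sum>(t, K)\<in>D. integral K (\<lambda>t. b t * \<theta> t))" .
      have S: "inner S v = Re (\<Sum>(t, K)\<in>D. measure lborel K *\<^sub>R b t * \<theta> t)"
        unfolding S_def inner_sum_left Re_sum
        by (intro sum.cong refl) (auto simp: Re_mult_cinner[symmetric] \<theta>_def simp del: times_complex.sel)
      have "inner (S - ?y) v = Re (\<Sum>(t, K)\<in>D. measure lborel K *\<^sub>R b t * \<theta> t - integral K (\<lambda>t. b t * \<theta> t))"
        by (simp add: inner_diff_left y S sum_subtractf split_def)
      also have "\<dots> \<le> norm (\<Sum>(t, K)\<in>D. measure lborel K *\<^sub>R b t * \<theta> t - integral K (\<lambda>t. b t * \<theta> t))"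
        by (rule complex_Re_le_cmod)
      also have "\<dots> \<le> (\<Sum>(t, K)\<in>D. norm (measure lborel K *\<^sub>R b t - integral K b) * (B * norm v)
          + integral K (\<lambda>s. norm (b s)) * (e / (4 * n) * norm v))"
      proof (rule sum_norm_le, clarify)
        fix t K assume tK: "(t, K) \<in> D"
        obtain u w where K: "K = cbox u w" using tagged_division_ofD(4)[OF Dt tK] by blast
        have tin: "t \<in> K" "K \<subseteq> cbox a d" using tagged_division_ofD(2,3)[OF Dt tK] by auto
        have Kball: "K \<subseteq> ball t \<eta>" using f2 tK by (auto simp: fine_def)
        \<comment> \<open>Freezing the orbit at the tag t separates the Riemann error of
          \<open>b\<close> on K from the oscillation of the orbit on K.\<close>
        have "measure lborel K *\<^sub>R b t * \<theta> t - integral K (\<lambda>t. b t * \<theta> t)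
            = (measure lborel K *\<^sub>R b t - integral K b) * \<theta> t + integral K (\<lambda>s. b s * (\<theta> t - \<theta> s))"
        proof -
          have "integral K (\<lambda>s. b s * (\<theta> t - \<theta> s)) = integral K (\<lambda>s. b s * \<theta> t - b s * \<theta> s)"
            by (simp only: right_diff_distrib)
          also have "\<dots> = integral K (\<lambda>s. b s * \<theta> t) - integral K (\<lambda>s. b s * \<theta> s)"
            unfolding K by (intro Henstock_Kurzweil_Integration.integral_diff b\<theta>cb integrable_on_mult_left bcb)
          also have "integral K (\<lambda>s. b s * \<theta> t) = integral K b * \<theta> t" by (rule integral_mult_left)
          finally show ?thesis by (simp add: left_diff_distrib)
        qed
        also have "norm \<dots> \<le> norm (measure lborel K *\<^sub>R b t - integral K b) * (B * norm v)
          + integral K (\<lambda>s. norm (b s)) * (e / (4 * n) * norm v)"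
        proof (rule norm_triangle_mono)
          show "norm ((measure lborel K *\<^sub>R b t - integral K b) * \<theta> t) \<le> norm (measure lborel K *\<^sub>R b t - integral K b) * (B * norm v)"
            unfolding norm_mult by (intro mult_left_mono \<theta>b) simp
          have "norm (integral K (\<lambda>s. b s * (\<theta> t - \<theta> s))) \<le> integral K (\<lambda>s. norm (b s) * (e / (4 * n) * norm v))"
          proof (rule integral_norm_bound_integral)
            show "(\<lambda>s. b s * (\<theta> t - \<theta> s)) integrable_on K"
              unfolding K right_diff_distrib by (intro Henstock_Kurzweil_Integration.integrable_diff b\<theta>cb integrable_on_mult_left bcb)
            show "(\<lambda>s. norm (b s) * (e / (4 * n) * norm v)) integrable_on K"
              unfolding K by (intro integrable_on_mult_left nbcb)
            fix s assume s: "s \<in> K"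
            have "dist (k t) (k s) < e / (4 * n)"
              using s tin Kball by (intro \<eta>(2)) auto
            moreover have "\<theta> t - \<theta> s = cinner J (k t - k s) v"
              by (simp add: \<theta>_def cinner_def complex_eq_iff J.diff inner_diff_left)
            ultimately have "norm (\<theta> t - \<theta> s) \<le> e / (4 * n) * norm v"
              using norm_cinner_le[of "k t - k s" v] mult_right_mono[of "norm (k t - k s)" "e / (4 * n)" "norm v"]
              by (simp add: dist_norm)
            then show "norm (b s * (\<theta> t - \<theta> s)) \<le> norm (b s) * (e / (4 * n) * norm v)"
              unfolding norm_mult by (intro mult_left_mono) auto
          qed
          also have "\<dots> = integral K (\<lambda>s. norm (b s)) * (e / (4 * n) * norm v)" by (rule integral_mult_left)
          finally show "norm (integral K (\<lambda>s. b s * (\<theta> t - \<theta> s))) \<le> integral K (\<lambda>s. norm (b s)) * (e / (4 * n) * norm v)" .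
        qed
        finally show "norm (measure lborel K *\<^sub>R b t * \<theta> t - integral K (\<lambda>t. b t * \<theta> t)) \<le>
          norm (measure lborel K *\<^sub>R b t - integral K b) * (B * norm v) + integral K (\<lambda>s. norm (b s)) * (e / (4 * n) * norm v)" .
      qed
      also have "\<dots> = (\<Sum>(t, K)\<in>D. norm (measure lborel K *\<^sub>R b t - integral K b)) * (B * norm v)
          + (\<Sum>(t, K)\<in>D. integral K (\<lambda>s. norm (b s))) * (e / (4 * n) * norm v)"
        by (simp only: split_def sum.distrib sum_distrib_right)
      also have "(\<Sum>(t, K)\<in>D. integral K (\<lambda>s. norm (b s))) = integral (cbox a d) (\<lambda>s. norm (b s))"
        by (rule integral_combine_tagged_division_topdown[OF nbcb Dt, symmetric])
      also have "(\<Sum>(t, K)\<in>D. norm (measure lborel K *\<^sub>R b t - integral K b)) * (B * norm v)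
          + integral (cbox a d) (\<lambda>s. norm (b s)) * (e / (4 * n) * norm v)
          \<le> e / (4 * B) * (B * norm v) + n * (e / (4 * n) * norm v)"
      proof (intro add_mono mult_right_mono hen)
        have "integral (cbox a d) (\<lambda>s. norm (b s)) \<le> integral UNIV (\<lambda>s. norm (b s))"
          using nbcb integrable_on_lborel[OF integrable_norm[OF b]] by (intro integral_subset_le) auto
        also have "\<dots> = (LINT t|lborel. norm (b t))" using b by (intro integral_lborel integrable_norm)
        finally show "integral (cbox a d) (\<lambda>s. norm (b s)) \<le> n" by (simp add: n_def)
      qed (use e B n in auto)
      also have "\<dots> = e / 2 * norm v" using B n by (simp add: field_simps)
      finally show ?thesis .
    qed
    \<comment> \<open>The estimate holds for every v with the same gauge, so v may be the error
      vector itself.\<close>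
    have "norm (S - ?y) \<le> e / 2"
    proof (cases "S - ?y = 0")
      case False
      have "norm (S - ?y) * norm (S - ?y) \<le> e / 2 * norm (S - ?y)"
        using main[of "S - ?y"] by (simp only: dot_square_norm power2_eq_square)
      then show ?thesis using False by simp
    qed (use e in simp)
    then show "norm ((\<Sum>(t, K)\<in>D. measure lborel K *\<^sub>R cscale J (b t) (T (max 0 t) x)) - ?y) < e"
      using e by (simp add: S_def k_def)
  qed
qed

text \<open>On an interval containing the ball of radius m, the operator of the truncated density
  differs from \<open>hp b\<close> at x by at most C |x| times the integral of |b| over |t| \<ge>
  m.\<close>

lemma hp_has_integral:
  assumes b: "b \<in> L1p"
  shows "((\<lambda>t. cscale J (b t) (T t x)) has_integral hp b x) {0..}"
proof -
  have bi: "integrable lborel b" using b by (simp add: L1p_def)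
  have g: "(if t \<in> {0..} then cscale J (b t) (T t x) else 0) = cscale J (b t) (T (max 0 t) x)" for t
    using b by (auto simp: L1p_def cscale_def max_def)
  \<comment> \<open>\<open>has_integral\<close> has a limiting definition on sets that are not
    compact boxes; the half-line must be shown to be such a set.\<close>
  have nb: "\<not> (\<exists>u v. {0..} = cbox u (v::real))"
  proof
    assume "\<exists>u v. {0..} = cbox u (v::real)"
    then obtain u v where uv: "{0..} = {u..v :: real}" by (auto simp: cbox_interval)
    have "max 0 v + 1 \<in> {0..}" by simp
    then have "max 0 v + 1 \<in> {u..v}" using uv by blast
    then show False by (auto simp: max_def split: if_splits)
  qed
  have "\<exists>B>0. \<forall>u v. ball 0 B \<subseteq> cbox u v \<longrightarrow>
     (\<exists>z. ((\<lambda>t. if t \<in> {0..} then cscale J (b t) (T t x) else 0) has_integral z) (cbox u v) \<and> norm (z - hp b x) < e)"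
    if e: "e > 0" for e
  proof -
    have "(\<lambda>m. LINT t|lborel. indicator {t. \<bar>t\<bar> \<ge> real m} t *\<^sub>R norm (b t)) \<longlonglongrightarrow> (LINT t::real|lborel. (0::real))"
    proof (rule integral_dominated_convergence)
      show "integrable lborel (\<lambda>t. norm (b t))" using bi by simp
      show "AE t in lborel. norm (indicator {t. \<bar>t\<bar> \<ge> real m} t *\<^sub>R norm (b t)) \<le> norm (b t)" for m
        by (intro AE_I2) (auto simp: indicator_def)
      show "AE t in lborel. (\<lambda>m. indicator {t. \<bar>t\<bar> \<ge> real m} t *\<^sub>R norm (b t)) \<longlonglongrightarrow> 0"
      proof (rule AE_I2)
        fix t :: real
        obtain m0 where "\<bar>t\<bar> < real m0" using reals_Archimedean2 by blast
        then have "\<forall>\<^sub>F m in sequentially. indicator {t. \<bar>t\<bar> \<ge> real m} t *\<^sub>R norm (b t) = 0"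
          by (intro eventually_sequentiallyI[of m0]) (auto simp: indicator_def)
        then show "(\<lambda>m. indicator {t. \<bar>t\<bar> \<ge> real m} t *\<^sub>R norm (b t)) \<longlonglongrightarrow> 0" by (rule tendsto_eventually)
      qed
    qed (use borel_measurable_integrable[OF bi] in measurable)
    then have "(\<lambda>m. (C * norm x) * (LINT t|lborel. indicator {t. \<bar>t\<bar> \<ge> real m} t *\<^sub>R norm (b t))) \<longlonglongrightarrow> (C * norm x) * 0"
      by (intro tendsto_mult tendsto_const) simp
    then have "\<forall>\<^sub>F m in sequentially. (C * norm x) * (LINT t|lborel. indicator {t. \<bar>t\<bar> \<ge> real m} t *\<^sub>R norm (b t)) < e"
      using e by (intro order_tendstoD(2)[where y = "(C * norm x) * 0"]) auto
    then have "\<forall>\<^sub>F m in sequentially. (C * norm x) * (LINT t|lborel. indicator {t. \<bar>t\<bar> \<ge> real m} t *\<^sub>R norm (b t)) < e \<and> m > 0"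
      by (intro eventually_conj eventually_gt_at_top)
    then obtain m where m: "(C * norm x) * (LINT t|lborel. indicator {t. \<bar>t\<bar> \<ge> real m} t *\<^sub>R norm (b t)) < e" "m > 0"
      by (auto simp: eventually_sequentially)
    show ?thesis
    proof (intro exI[of _ "real m"] conjI allI impI)
      show "real m > 0" using m by simp
      fix u v assume sub: "ball 0 (real m) \<subseteq> cbox u (v::real)"
      let ?b = "\<lambda>t. indicator {u..v} t *\<^sub>R b t"
      have ib: "integrable lborel ?b" using bi by (intro integrable_mult_indicator) auto
      have dist: "norm (hp ?b x - hp b x) < e"
      proof -
        have idiff: "integrable lborel (\<lambda>t. ?b t - b t)" using ib bi by simp
        have "norm (hp ?b x - hp b x) = norm (hp (\<lambda>t. ?b t - b t) x)"
          unfolding hp_diff[OF ib bi] by (simp add: blinfun.diff_left)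
        also have "\<dots> \<le> C * (LINT t|lborel. norm (?b t - b t)) * norm x"
          by (rule order_trans[OF norm_blinfun mult_right_mono[OF norm_hp_le[OF idiff]]]) simp
        also have "\<dots> \<le> C * (LINT t|lborel. indicator {t. \<bar>t\<bar> \<ge> real m} t *\<^sub>R norm (b t)) * norm x"
        proof (intro mult_right_mono mult_left_mono integral_mono)
          show "integrable lborel (\<lambda>t. norm (?b t - b t))" using idiff by simp
          show "integrable lborel (\<lambda>t. indicator {t. \<bar>t\<bar> \<ge> real m} t *\<^sub>R norm (b t))"
            using bi by (intro integrable_mult_indicator) auto
          show "norm (?b t - b t) \<le> indicator {t. \<bar>t\<bar> \<ge> real m} t *\<^sub>R norm (b t)" for t
          proof (cases "t \<in> {u..v}")
            case False
            then have "t \<notin> ball 0 (real m)" using sub by (auto simp: cbox_interval)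
            then have "\<bar>t\<bar> \<ge> real m" by simp
            then show ?thesis using False by simp
          qed simp
        qed (use C_nonneg in auto)
        also have "\<dots> < e" using m(1) by (simp add: mult_ac)
        finally show ?thesis .
      qed
      have "((\<lambda>t. if t \<in> {0..} then cscale J (b t) (T t x) else 0) has_integral hp ?b x) (cbox u v)"
        unfolding g by (rule hp_has_integral_interval[OF bi])
      then show "\<exists>z. ((\<lambda>t. if t \<in> {0..} then cscale J (b t) (T t x) else 0) has_integral z) (cbox u v) \<and> norm (z - hp b x) < e"
        using dist by blast
    qed
  qed
  then show ?thesis by (subst has_integral_alt) (use nb in auto)
qed

end

text \<open>The hypothesis concerns the half-line only, so \<open>b\<close> is first extended by 0
  and then replaced by a Borel function; this moves the theorem's class of densities into
  \<open>L1p\<close>.\<close>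

lemma L1p_representative:
  fixes b :: "real \<Rightarrow> complex"
  assumes "b absolutely_integrable_on {0..}"
  shows "\<exists>b'\<in>L1p. laplace b = laplace b' \<and> negligible {t \<in> {0..}. b t \<noteq> b' t}"
proof -
  have "(\<lambda>t. if t \<in> {0..} then b t else 0) absolutely_integrable_on UNIV"
    using assms by (simp only: absolutely_integrable_restrict_UNIV)
  then obtain b0 where b0: "integrable lborel b0" "negligible {t. (if t \<in> {0..} then b t else 0) \<noteq> b0 t}"
    using borel_representative by blast
  define b' where "b' t = indicator {0..} t *\<^sub>R b0 t" for t
  have "b' \<in> L1p"
    unfolding L1p_def b'_def using b0 by (auto intro!: integrable_mult_indicator)
  moreover have neg: "negligible {t \<in> {0..}. b t \<noteq> b' t}"
    by (rule negligible_subset[OF b0(2)]) (auto simp: b'_def)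
  moreover have "laplace b = laplace b'"
  proof
    fix z
    have "integral {0..} (\<lambda>t. exp (- (complex_of_real t * z)) * b t) = integral {0..} (\<lambda>t. exp (- (complex_of_real t * z)) * b' t)"
      by (rule integral_spike[OF neg]) auto
    then show "laplace b z = laplace b' z" by (simp add: laplace_def)
  qed
  ultimately show ?thesis by blast
qed

section \<open>Approximation in \<open>\<A>\<^sub>0\<close>\<close>

lemma C0fun_diff: "C0fun f \<Longrightarrow> C0fun g \<Longrightarrow> C0fun (\<lambda>t. f t - g t)"
  unfolding C0fun_def using tendsto_diff[of f 0 at_infinity g 0] by (auto intro!: continuous_intros)

lemma C0fun_zero: "C0fun (\<lambda>_. 0)"
  by (simp add: C0fun_def)

lemma supnorm_zero: "supnorm (\<lambda>_. 0) = 0"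
  by (simp add: supnorm_def)

lemma fourier_pair_zero: "fourier_pair (\<lambda>_. 0) (\<lambda>_. 0)"
  by (simp add: fourier_pair_def C0fun_zero)

lemma fourier_pair_C0fun: "fourier_pair f c \<Longrightarrow> C0fun f"
  by (simp add: fourier_pair_def)

lemma fourier_pair_diff:
  assumes "fourier_pair f c" "fourier_pair f' c'"
  shows "fourier_pair (\<lambda>t. f t - f' t) (\<lambda>t. c t - c' t)"
proof -
  have i: "integrable lborel (\<lambda>t. g t * cis (w t))" if "integrable lborel g" "w \<in> borel_measurable borel" for g :: "real \<Rightarrow> complex" and w :: "real \<Rightarrow> real"
    by (rule integrable_mult_bounded[OF that(1), where B = 1]) (use that in auto)
  have 1: "C0fun f" "C0fun f'" "integrable lborel f" "integrable lborel f'" "integrable lborel c" "integrable lborel c'"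
    "continuous_on UNIV c" "continuous_on UNIV c'"
    and u: "\<And>u. f u = (LINT t|lborel. c t * cis (u * t))" "\<And>u. f' u = (LINT t|lborel. c' t * cis (u * t))"
    and t: "\<And>t. (LINT u|lborel. f u * cis (- (u * t))) = 2 * complex_of_real pi * c t"
      "\<And>t. (LINT u|lborel. f' u * cis (- (u * t))) = 2 * complex_of_real pi * c' t"
    using assms unfolding fourier_pair_def by blast+
  show ?thesis
    unfolding fourier_pair_def
  proof (intro conjI allI)
    show "f u - f' u = (LINT t|lborel. (c t - c' t) * cis (u * t))" for u
      unfolding left_diff_distrib u
      by (rule Bochner_Integration.integral_diff[symmetric]) (intro i 1; measurable)+
    have "(LINT u|lborel. (f u - f' u) * cis (- (u * t)))
        = (LINT u|lborel. f u * cis (- (u * t))) - (LINT u|lborel. f' u * cis (- (u * t)))" for t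
      unfolding left_diff_distrib
      by (rule Bochner_Integration.integral_diff) (intro i 1; measurable)+
    then show "(LINT u|lborel. (f u - f' u) * cis (- (u * t))) = 2 * complex_of_real pi * (c t - c' t)" for t
      by (simp only: t right_diff_distrib)
  qed (intro C0fun_diff Bochner_Integration.integrable_diff continuous_intros 1)+
qed

lemma conv_zero: "conv (\<lambda>_. 0) h t = 0"
  by (simp add: conv_def)

lemma conv_diff:
  assumes f: "C0fun f" and g: "C0fun g" and h: "H1fun h"
  shows "conv (\<lambda>t. f t - g t) h t = conv f h t - conv g h t"
proof -
  obtain h' where h': "integrable lborel h'" "\<forall>f. conv f h = conv f h'"
    using H1fun_representative[OF h] by blast
  have i: "integrable lborel (\<lambda>s. h' s * f (t - s))" if "C0fun f" for f
  proof (rule integrable_mult_bounded[OF h'(1)])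
    show "(\<lambda>s. f (t - s)) \<in> borel_measurable borel" using C0fun_measurable[OF that] by measurable
  qed (rule norm_le_supnorm[OF that])
  show ?thesis
    using i[OF f] i[OF g] h'(2)
    by (simp add: conv_eq_LINT[OF f h'(1)] conv_eq_LINT[OF g h'(1)] conv_eq_LINT[OF C0fun_diff[OF f g] h'(1)]
        right_diff_distrib)
qed

lemma A0R_rep_measurable:
  assumes rep: "A0R_rep F fs hs"
  shows "F \<in> borel_measurable borel"
proof (rule borel_measurable_LIMSEQ_metric)
  show "(\<lambda>n. \<Sum>k<n. conv (fs k) (hs k) t) \<longlonglongrightarrow> F t" for t
    using rep by (simp add: A0R_rep_def sums_def)
  show "(\<lambda>t. \<Sum>k<n. conv (fs k) (hs k) t) \<in> borel_measurable borel" for n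
    using rep by (intro borel_measurable_sum conv_measurable) (auto simp: A0R_rep_def)
qed

lemma A0R_rep_bound:
  assumes rep: "A0R_rep F fs hs"
  shows "norm (F t) \<le> (\<Sum>k. supnorm (fs k) * L1norm (hs k))"
proof -
  have "F t = (\<Sum>k. conv (fs k) (hs k) t)"
    using rep sums_unique by (auto simp: A0R_rep_def)
  also have "norm \<dots> \<le> (\<Sum>k. supnorm (fs k) * L1norm (hs k))"
    using rep by (intro norm_suminf_le norm_conv_le) (auto simp: A0R_rep_def)
  finally show ?thesis .
qed

lemma A0R_rep_nonneg:
  assumes rep: "A0R_rep F fs hs"
  shows "0 \<le> (\<Sum>k. supnorm (fs k) * L1norm (hs k))"
  using A0R_rep_bound[OF rep, of 0] norm_ge_zero order_trans by blast

lemma A0R_rep_diff: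
  assumes F: "A0R_rep F fs hs" and G: "A0R_rep G gs hs"
    and s: "summable (\<lambda>k. supnorm (\<lambda>t. fs k t - gs k t) * L1norm (hs k))"
  shows "A0R_rep (\<lambda>t. F t - G t) (\<lambda>k t. fs k t - gs k t) hs"
  unfolding A0R_rep_def
proof (intro conjI allI s)
  fix k t
  have 0: "C0fun (fs k)" "C0fun (gs k)" "H1fun (hs k)" for k using F G by (auto simp: A0R_rep_def)
  show "C0fun (\<lambda>t. fs k t - gs k t)" by (intro C0fun_diff 0)
  show "H1fun (hs k)" by (rule 0)
  show "(\<lambda>k. conv (\<lambda>t. fs k t - gs k t) (hs k) t) sums (F t - G t)"
    unfolding conv_diff[OF 0] using F G by (intro sums_diff) (auto simp: A0R_rep_def)
qed

text \<open>The tail of the series is dropped at cost e / 2, and the remaining finitely many f are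
  replaced by members of Fourier pairs at cost e / 2. The functions \<open>hs\<close> are kept, so
  that different approximations can be subtracted term by term.\<close>

lemma A0R_rep_nice_approx:
  assumes rep: "A0R_rep F fs hs" and e: "e > 0"
  shows "\<exists>n gs cs. (\<forall>k. fourier_pair (gs k) (cs k)) \<and> (\<forall>k\<ge>n. gs k = (\<lambda>_. 0) \<and> cs k = (\<lambda>_. 0)) \<and>
    summable (\<lambda>k. supnorm (\<lambda>t. fs k t - gs k t) * L1norm (hs k)) \<and>
    (\<Sum>k. supnorm (\<lambda>t. fs k t - gs k t) * L1norm (hs k)) \<le> e"
proof -
  let ?a = "\<lambda>k. supnorm (fs k) * L1norm (hs k)"
  have sm: "summable ?a" and f: "\<And>k. C0fun (fs k)" using rep by (auto simp: A0R_rep_def)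
  have "(\<lambda>n. \<Sum>k. ?a (k + n)) \<longlonglongrightarrow> 0" by (rule suminf_exist_split2[OF sm])
  then have "\<forall>\<^sub>F n in sequentially. (\<Sum>k. ?a (k + n)) < e / 2"
    using e by (intro order_tendstoD(2)[where y = "0::real"]) auto
  then obtain n where n: "(\<Sum>k. ?a (k + n)) < e / 2" by (auto simp: eventually_sequentially)
  \<comment> \<open>Each of the first n terms then costs at most e / (2 (n + 1)); the two summands 1
    guard against n = 0 and against a vanishing norm.\<close>
  define r where "r k = e / (2 * (real n + 1) * (L1norm (hs k) + 1))" for k
  have r: "r k > 0" for k
    using e L1norm_nonneg[of "hs k"] by (auto simp: r_def intro!: divide_pos_pos mult_pos_pos add_nonneg_pos)
  have "\<exists>g c. fourier_pair g c \<and> (\<forall>t. norm (fs k t - g t) \<le> r k)" for k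
    using C0fun_nice_approx[OF f r] by blast
  then obtain g c where gc: "\<And>k. fourier_pair (g k) (c k)" "\<And>k t. norm (fs k t - g k t) \<le> r k" by metis
  define gs where "gs k = (if k < n then g k else (\<lambda>_. 0))" for k
  define cs where "cs k = (if k < n then c k else (\<lambda>_. 0))" for k
  let ?d = "\<lambda>k. supnorm (\<lambda>t. fs k t - gs k t) * L1norm (hs k)"
  have shift: "?d (k + n) = ?a (k + n)" for k by (simp add: gs_def)
  have sd: "summable ?d"
    using sm unfolding summable_iff_shift[of ?d n, symmetric] shift summable_iff_shift[of ?a n] .
  have "(\<Sum>k. ?d k) = (\<Sum>k. ?d (k + n)) + (\<Sum>k<n. ?d k)"
    by (rule suminf_split_initial_segment[OF sd])
  also have "\<dots> \<le> e / 2 + (\<Sum>k<n. e / (2 * (real n + 1)))"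
  proof (intro add_mono sum_mono)
    show "(\<Sum>k. ?d (k + n)) \<le> e / 2" unfolding shift using n by simp
    fix k assume k: "k \<in> {..<n}"
    have "?d k \<le> r k * L1norm (hs k)"
      using k gc(2) by (intro mult_right_mono supnorm_le L1norm_nonneg) (auto simp: gs_def)
    also have "\<dots> \<le> r k * (L1norm (hs k) + 1)" using r[of k] by (intro mult_left_mono) auto
    also have "\<dots> = e / (2 * (real n + 1))"
      using L1norm_nonneg[of "hs k"] by (simp add: r_def)
    finally show "?d k \<le> e / (2 * (real n + 1))" .
  qed
  also have "(\<Sum>k<n. e / (2 * (real n + 1))) = (e / 2) * (real n / (real n + 1))" by simp
  also have "\<dots> \<le> (e / 2) * 1" using e by (intro mult_left_mono) auto
  finally have "(\<Sum>k. ?d k) \<le> e" by simp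
  moreover have "fourier_pair (gs k) (cs k)" for k using gc fourier_pair_zero by (simp add: gs_def cs_def)
  moreover have "\<forall>k\<ge>n. gs k = (\<lambda>_. 0) \<and> cs k = (\<lambda>_. 0)" by (simp add: gs_def cs_def)
  ultimately show ?thesis using sd by blast
qed

text \<open>One Borel representative is fixed for each k, shared by all approximations of the same
  function.\<close>

definition H1rep :: "(nat \<Rightarrow> real \<Rightarrow> complex) \<Rightarrow> (nat \<Rightarrow> real \<Rightarrow> complex) \<Rightarrow> bool" where
  "H1rep hs h \<longleftrightarrow> (\<forall>k. integrable lborel (h k) \<and> (\<forall>u\<le>0. hft (h k) u = 0) \<and>
     (LINT t|lborel. norm (h k t)) = L1norm (hs k) \<and> (\<forall>f. conv f (hs k) = conv f (h k)))"

lemma H1rep_exists: "(\<And>k. H1fun (hs k)) \<Longrightarrow> \<exists>h. H1rep hs h"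
  unfolding H1rep_def by (rule choice) (use H1fun_representative in blast)

definition nice_symbol :: "(nat \<Rightarrow> real \<Rightarrow> complex) \<Rightarrow> (nat \<Rightarrow> real \<Rightarrow> complex) \<Rightarrow> nat \<Rightarrow> real \<Rightarrow> complex" where
  "nice_symbol cs h n r = (\<Sum>k<n. cs k r * hft (h k) r)"

text \<open>Zero padding brings two approximations to a common length before they are
  subtracted.\<close>

lemma nice_symbol_mono:
  assumes "\<forall>k\<ge>n. cs k = (\<lambda>_. 0)" "n \<le> m"
  shows "nice_symbol cs h n = nice_symbol cs h m"
  unfolding nice_symbol_def fun_eq_iff
  by (intro allI sum.mono_neutral_left) (use assms in auto)

lemma nice_symbol_L1p:
  assumes "\<And>k. fourier_pair (gs k) (cs k)" and h: "H1rep hs h"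
  shows "nice_symbol cs h n \<in> L1p"
proof -
  have "(\<lambda>r. cs k r * hft (h k) r) \<in> L1p" for k
    by (rule fourier_pair_hft_L1p[OF assms(1)]) (use h in \<open>auto simp: H1rep_def\<close>)
  then show ?thesis
    unfolding nice_symbol_def[abs_def] L1p_def by (auto intro!: sum.neutral)
qed

text \<open>A finite sum of this kind lies in both worlds: it carries a representation in A_0 and
  has an L^1 density. Approximation in A_0 thereby becomes approximation by Laplace
  transforms.\<close>

lemma nice_rep:
  assumes nice: "\<And>k. fourier_pair (gs k) (cs k)" and z: "\<forall>k\<ge>n. gs k = (\<lambda>_. 0)"
    and h: "H1rep hs h" and H1: "\<And>k. H1fun (hs k)"
  shows "A0R_rep (\<lambda>t. \<Sum>k<n. conv (gs k) (hs k) t) gs hs"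
    and "tildeF (\<lambda>t. \<Sum>k<n. conv (gs k) (hs k) t) = laplace (nice_symbol cs h n)"
proof -
  show "A0R_rep (\<lambda>t. \<Sum>k<n. conv (gs k) (hs k) t) gs hs"
    unfolding A0R_rep_def
  proof (intro conjI allI)
    show "summable (\<lambda>k. supnorm (gs k) * L1norm (hs k))"
      by (rule summable_finite[of "{..<n}"]) (use z in \<open>auto simp: supnorm_zero\<close>)
    show "(\<lambda>k. conv (gs k) (hs k) t) sums (\<Sum>k<n. conv (gs k) (hs k) t)" for t
      by (rule sums_finite) (use z in \<open>auto simp: conv_zero\<close>)
  qed (use nice H1 fourier_pair_C0fun in auto)
  have i: "integrable lborel (\<lambda>r. cs k r * hft (h k) r * cis (t * r))" for k t
  proof (rule integrable_mult_bounded[where B = 1])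
    show "integrable lborel (\<lambda>r. cs k r * hft (h k) r)"
      using fourier_pair_hft_L1p[OF nice, of "h k" k] h by (auto simp: H1rep_def L1p_def)
  qed auto
  have "(\<Sum>k<n. conv (gs k) (hs k) t) = (LINT r|lborel. nice_symbol cs h n r * cis (t * r))" for t
  proof -
    have "(LINT r|lborel. nice_symbol cs h n r * cis (t * r)) = (LINT r|lborel. (\<Sum>k<n. cs k r * hft (h k) r * cis (t * r)))"
      by (simp add: nice_symbol_def sum_distrib_right)
    also have "\<dots> = (\<Sum>k<n. LINT r|lborel. cs k r * hft (h k) r * cis (t * r))"
      by (rule Bochner_Integration.integral_sum[OF i])
    also have "\<dots> = (\<Sum>k<n. conv (gs k) (hs k) t)"
      using h by (intro sum.cong refl) (simp add: H1rep_def conv_fourier_pair[OF nice])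
    finally show ?thesis by simp
  qed
  then show "tildeF (\<lambda>t. \<Sum>k<n. conv (gs k) (hs k) t) = laplace (nice_symbol cs h n)"
    using tildeF_fourier[OF nice_symbol_L1p[of gs cs hs h n, OF nice h]] by simp
qed

lemma (in bdd_semigroup) norm_hp_nice_symbol:
  assumes nice: "\<And>k. fourier_pair (gs k) (cs k)" and h: "H1rep hs h" and d: "\<delta> \<ge> 0"
  shows "norm (hp (damp \<delta> (nice_symbol cs h n))) \<le> C\<^sup>2 * (\<Sum>k<n. supnorm (gs k) * L1norm (hs k))"
proof -
  have hk: "integrable lborel (h k)" "\<And>u. u \<le> 0 \<Longrightarrow> hft (h k) u = 0" "(LINT t|lborel. norm (h k t)) = L1norm (hs k)" for k
    using h by (auto simp: H1rep_def)
  have i: "integrable lborel (\<lambda>r. cs k r * hft (h k) r)" for k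
    using fourier_pair_hft_L1p[OF nice hk(1,2)] by (simp add: L1p_def)
  have "hp (damp \<delta> (nice_symbol cs h n)) = (\<Sum>k<n. hp (damp \<delta> (\<lambda>r. cs k r * hft (h k) r)))"
    unfolding nice_symbol_def[abs_def] damp_linear by (intro hp_sum integrable_damp i d) simp
  also have "norm \<dots> \<le> (\<Sum>k<n. C\<^sup>2 * (supnorm (gs k) * L1norm (hs k)))"
    using key_estimate_damped[OF nice hk(1,2) d] hk(3) by (intro sum_norm_le) simp
  finally show ?thesis by (simp add: sum_distrib_left)
qed

text \<open>Along better and better approximations of one representation, the operators form a
  Cauchy sequence for every \<delta> \<ge> 0, with rate independent of \<delta>; the limits form the
  family required by \<open>calc\<close>. The norm bound refers to this representation and passes to
  the infimum later.\<close>

lemma (in bdd_semigroup) calc_A0R: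
  assumes rep: "A0R_rep F fs hs"
  shows "\<exists>\<beta>. calc (tildeF F) \<beta> \<and> norm (\<beta> 0) \<le> C\<^sup>2 * (\<Sum>k. supnorm (fs k) * L1norm (hs k))"
proof -
  let ?a = "\<lambda>k. supnorm (fs k) * L1norm (hs k)"
  have H1: "\<And>k. H1fun (hs k)" and f: "\<And>k. C0fun (fs k)" and sm: "summable ?a"
    using rep by (auto simp: A0R_rep_def)
  obtain h where h: "H1rep hs h" using H1rep_exists[of hs] H1 by blast
  define e where "e j = 1 / real (Suc j)" for j
  have e: "e j > 0" for j by (simp add: e_def)
  have edec: "e i \<le> e j" if "j \<le> i" for i j using that by (simp add: e_def frac_le)
  have e0: "e \<longlonglongrightarrow> 0" using LIMSEQ_inverse_real_of_nat by (simp add: e_def[abs_def] inverse_eq_divide)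
  define Q where "Q j n gs cs \<longleftrightarrow> (\<forall>k. fourier_pair (gs k) (cs k)) \<and> (\<forall>k\<ge>n. gs k = (\<lambda>_. 0) \<and> cs k = (\<lambda>_. 0)) \<and>
    summable (\<lambda>k. supnorm (\<lambda>t. fs k t - gs k t) * L1norm (hs k)) \<and>
    (\<Sum>k. supnorm (\<lambda>t. fs k t - gs k t) * L1norm (hs k)) \<le> e j" for j and n :: nat and gs cs
  have "\<forall>j. \<exists>n gs cs. Q j n gs cs"
    unfolding Q_def by (intro allI A0R_rep_nice_approx[OF rep e])
  then obtain n gs cs where "\<And>j. Q j (n j) (gs j) (cs j)" by metis
  then have nice: "\<And>j k. fourier_pair (gs j k) (cs j k)"
    and z: "\<And>j. \<forall>k\<ge>n j. gs j k = (\<lambda>_. 0)" "\<And>j. \<forall>k\<ge>n j. cs j k = (\<lambda>_. 0)"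
    and sd: "\<And>j. summable (\<lambda>k. supnorm (\<lambda>t. fs k t - gs j k t) * L1norm (hs k))"
    and de: "\<And>j. (\<Sum>k. supnorm (\<lambda>t. fs k t - gs j k t) * L1norm (hs k)) \<le> e j"
    unfolding Q_def by blast+
  note gC0 = fourier_pair_C0fun[OF nice]
  let ?d = "\<lambda>j k. supnorm (\<lambda>t. fs k t - gs j k t) * L1norm (hs k)"
  have d0: "0 \<le> ?d j k" for j k by (intro mult_nonneg_nonneg supnorm_nonneg C0fun_diff f gC0 L1norm_nonneg)
  have nd: "norm (fs k t - gs j k t) \<le> supnorm (\<lambda>t. fs k t - gs j k t)" for j k t
    by (rule norm_le_supnorm[OF C0fun_diff[OF f gC0]])
  have partial: "(\<Sum>k<m. ?d j k) \<le> e j" for j m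
    by (rule order_trans[OF sum_le_suminf[OF sd] de]) (use d0 in auto)
  define b where "b j = nice_symbol (cs j) h (n j)" for j
  have bL: "b j \<in> L1p" for j unfolding b_def by (rule nice_symbol_L1p[OF nice h])
  have bi: "integrable lborel (b j)" for j using bL[of j] by (simp add: L1p_def)
  have lap: "norm (tildeF F w - laplace (b j) w) \<le> e j" for j w
  proof -
    let ?G = "\<lambda>t. \<Sum>k<n j. conv (gs j k) (hs k) t"
    have G: "A0R_rep ?G (gs j) hs" "tildeF ?G = laplace (b j)"
      unfolding b_def by (rule nice_rep[OF nice z(1) h H1])+
    have FG: "A0R_rep (\<lambda>t. F t - ?G t) (\<lambda>k t. fs k t - gs j k t) hs"
      by (rule A0R_rep_diff[OF rep G(1) sd])
    have "tildeF F w - laplace (b j) w = tildeF (\<lambda>t. F t - ?G t) w"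
      unfolding G(2)[symmetric]
      by (rule tildeF_diff[OF A0R_rep_measurable[OF rep] A0R_rep_bound[OF rep]
            A0R_rep_measurable[OF G(1)] A0R_rep_bound[OF G(1)], symmetric])
    also have "norm \<dots> \<le> (\<Sum>k. ?d j k)"
      by (rule norm_tildeF_le[OF A0R_rep_measurable[OF FG] A0R_rep_bound[OF FG]])
    finally show ?thesis using de[of j] by linarith
  qed
  \<comment> \<open>The difference of two densities is again a nice symbol over the same
    \<open>h\<close>, with the differences of the Fourier pairs as data, so the key estimate applies
    to it term by term.\<close>
  have hpd: "norm (hp (damp \<delta> (b i)) - hp (damp \<delta> (b j))) \<le> C\<^sup>2 * (e i + e j)" if d: "\<delta> \<ge> 0" for \<delta> i j
  proof -
    define m where "m = max (n i) (n j)"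
    have bm: "b i = nice_symbol (cs i) h m" "b j = nice_symbol (cs j) h m"
      unfolding b_def m_def by (rule nice_symbol_mono[OF z(2)], simp)+
    have "(\<lambda>t. b i t - b j t) = nice_symbol (\<lambda>k t. cs i k t - cs j k t) h m"
      unfolding bm nice_symbol_def by (simp add: sum_subtractf left_diff_distrib fun_eq_iff)
    then have "damp \<delta> (nice_symbol (\<lambda>k t. cs i k t - cs j k t) h m) = (\<lambda>t. damp \<delta> (b i) t - damp \<delta> (b j) t)"
      using damp_linear(2)[of \<delta> "b i" "b j"] by simp
    then have "hp (damp \<delta> (b i)) - hp (damp \<delta> (b j)) = hp (damp \<delta> (nice_symbol (\<lambda>k t. cs i k t - cs j k t) h m))"
      using hp_diff[OF integrable_damp[OF bi d] integrable_damp[OF bi d], of i j] by simp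
    also have "norm \<dots> \<le> C\<^sup>2 * (\<Sum>k<m. supnorm (\<lambda>t. gs i k t - gs j k t) * L1norm (hs k))"
      by (rule norm_hp_nice_symbol[OF fourier_pair_diff[OF nice nice] h d])
    also have "\<dots> \<le> C\<^sup>2 * (\<Sum>k<m. ?d i k + ?d j k)"
    proof (intro mult_left_mono sum_mono)
      fix k
      have "supnorm (\<lambda>t. gs i k t - gs j k t) \<le> supnorm (\<lambda>t. fs k t - gs i k t) + supnorm (\<lambda>t. fs k t - gs j k t)"
      proof (rule supnorm_le)
        fix t
        have "norm (gs i k t - gs j k t) \<le> norm (fs k t - gs i k t) + norm (fs k t - gs j k t)"
          using norm_triangle_ineq4[of "fs k t - gs j k t" "fs k t - gs i k t"] by simp
        also have "\<dots> \<le> supnorm (\<lambda>t. fs k t - gs i k t) + supnorm (\<lambda>t. fs k t - gs j k t)"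
          by (intro add_mono nd)
        finally show "norm (gs i k t - gs j k t) \<le> supnorm (\<lambda>t. fs k t - gs i k t) + supnorm (\<lambda>t. fs k t - gs j k t)" .
      qed
      then show "supnorm (\<lambda>t. gs i k t - gs j k t) * L1norm (hs k) \<le> ?d i k + ?d j k"
        unfolding distrib_right[symmetric] by (intro mult_right_mono L1norm_nonneg)
    qed simp
    also have "\<dots> \<le> C\<^sup>2 * (e i + e j)"
      unfolding sum.distrib by (intro mult_left_mono add_mono partial) simp
    finally show ?thesis .
  qed
  have "\<exists>L. \<forall>i. norm (hp (damp \<delta> (b i)) - L) \<le> C\<^sup>2 * (2 * e i)" if d: "\<delta> \<ge> 0" for \<delta>
  proof (rule blinfun_Cauchy_limit)
    show "(\<lambda>i. C\<^sup>2 * (2 * e i)) \<longlonglongrightarrow> 0"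
      using tendsto_mult_left[OF tendsto_mult_left[OF e0, of 2], of "C\<^sup>2"] by simp
    fix i j :: nat assume "i \<le> j"
    then have "C\<^sup>2 * (e i + e j) \<le> C\<^sup>2 * (2 * e i)" using edec[of i j] by (intro mult_left_mono) auto
    then show "norm (hp (damp \<delta> (b i)) - hp (damp \<delta> (b j))) \<le> C\<^sup>2 * (2 * e i)"
      using hpd[OF d, of i j] by linarith
  qed
  then have "\<forall>\<delta>. \<exists>L. \<delta> \<ge> 0 \<longrightarrow> (\<forall>i. norm (hp (damp \<delta> (b i)) - L) \<le> C\<^sup>2 * (2 * e i))" by blast
  from choice[OF this] obtain \<beta> where
    \<beta>: "\<And>\<delta> i. \<delta> \<ge> 0 \<Longrightarrow> norm (hp (damp \<delta> (b i)) - \<beta> \<delta>) \<le> C\<^sup>2 * (2 * e i)" by blast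
  have "calc (tildeF F) \<beta>"
    unfolding calc_def
  proof (intro allI impI)
    fix r :: real assume r: "r > 0"
    have "(\<lambda>i. C\<^sup>2 * (2 * e i)) \<longlonglongrightarrow> 0"
      using tendsto_mult_left[OF tendsto_mult_left[OF e0, of 2], of "C\<^sup>2"] by simp
    then have "\<forall>\<^sub>F i in sequentially. C\<^sup>2 * (2 * e i) < r \<and> e i < r"
      using r e0 by (intro eventually_conj order_tendstoD(2)[where y = "0::real"]) auto
    then obtain i where i: "C\<^sup>2 * (2 * e i) < r" "e i < r" by (auto simp: eventually_sequentially)
    show "\<exists>b\<in>L1p. (\<forall>w. 0 < Re w \<longrightarrow> norm (tildeF F w - laplace b w) \<le> r) \<and> (\<forall>\<delta>\<ge>0. norm (\<beta> \<delta> - hp (damp \<delta> b)) \<le> r)"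
    proof (intro bexI[OF _ bL[of i]] conjI allI impI)
      show "norm (tildeF F w - laplace (b i) w) \<le> r" for w using lap[of w i] i by linarith
      show "norm (\<beta> \<delta> - hp (damp \<delta> (b i))) \<le> r" if "\<delta> \<ge> 0" for \<delta>
        using \<beta>[OF that, of i] i by (simp add: norm_minus_commute)
    qed
  qed
  moreover have "norm (\<beta> 0) \<le> C\<^sup>2 * (\<Sum>k. ?a k)"
  proof -
    \<comment> \<open>One e i comes from replacing \<open>fs\<close> by the approximating functions,
      the other two from the distance between \<open>hp (b i)\<close> and its limit.\<close>
    have "norm (\<beta> 0) \<le> C\<^sup>2 * (\<Sum>k. ?a k) + C\<^sup>2 * (3 * e i)" for i
    proof -
      have "norm (hp (b i)) \<le> C\<^sup>2 * (\<Sum>k<n i. supnorm (gs i k) * L1norm (hs k))"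
        using norm_hp_nice_symbol[of "gs i" "cs i" hs h 0 "n i", OF nice h] by (simp add: b_def)
      also have "\<dots> \<le> C\<^sup>2 * (\<Sum>k<n i. ?a k + ?d i k)"
      proof (intro mult_left_mono sum_mono)
        fix k
        have "supnorm (gs i k) \<le> supnorm (fs k) + supnorm (\<lambda>t. fs k t - gs i k t)"
        proof (rule supnorm_le)
          fix t
          have "norm (gs i k t) \<le> norm (fs k t) + norm (fs k t - gs i k t)"
            using norm_triangle_ineq4[of "fs k t" "fs k t - gs i k t"] by simp
          also have "\<dots> \<le> supnorm (fs k) + supnorm (\<lambda>t. fs k t - gs i k t)"
            by (intro add_mono nd norm_le_supnorm[OF f])
          finally show "norm (gs i k t) \<le> supnorm (fs k) + supnorm (\<lambda>t. fs k t - gs i k t)" .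
        qed
        then show "supnorm (gs i k) * L1norm (hs k) \<le> ?a k + ?d i k"
          unfolding distrib_right[symmetric] by (intro mult_right_mono L1norm_nonneg)
      qed simp
      also have "\<dots> \<le> C\<^sup>2 * ((\<Sum>k. ?a k) + e i)"
        unfolding sum.distrib
        by (intro mult_left_mono add_mono partial sum_le_suminf sm mult_nonneg_nonneg supnorm_nonneg f L1norm_nonneg) auto
      finally have "norm (hp (b i)) \<le> C\<^sup>2 * (\<Sum>k. ?a k) + C\<^sup>2 * e i" by (simp add: distrib_left)
      moreover have "norm (\<beta> 0) \<le> norm (hp (b i)) + C\<^sup>2 * (2 * e i)"
        using \<beta>[of 0 i] norm_triangle_ineq2[of "\<beta> 0" "hp (b i)"] by (simp add: norm_minus_commute)
      ultimately show ?thesis by (simp add: algebra_simps)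
    qed
    moreover have "(\<lambda>i. C\<^sup>2 * (\<Sum>k. ?a k) + C\<^sup>2 * (3 * e i)) \<longlonglongrightarrow> C\<^sup>2 * (\<Sum>k. ?a k) + C\<^sup>2 * (3 * 0)"
      by (intro tendsto_intros e0)
    ultimately have "norm (\<beta> 0) \<le> C\<^sup>2 * (\<Sum>k. ?a k) + C\<^sup>2 * (3 * 0)"
      by (intro LIMSEQ_le_const) auto
    then show ?thesis by simp
  qed
  ultimately show ?thesis by blast
qed

section \<open>The norms of A_0 and the homomorphism\<close>

lemma A0R_norm_le:
  assumes "A0R_rep F fs hs"
  shows "A0R_norm F \<le> (\<Sum>k. supnorm (fs k) * L1norm (hs k))"
  unfolding A0R_norm_def
proof (rule cInf_lower)
  show "bdd_below {(\<Sum>k. supnorm (fs k) * L1norm (hs k)) |fs hs. A0R_rep F fs hs}"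
    by (rule bdd_belowI[of _ 0]) (auto intro: A0R_rep_nonneg)
qed (use assms in blast)

lemma A0R_norm_nonneg:
  assumes "F \<in> A0R"
  shows "0 \<le> A0R_norm F"
  unfolding A0R_norm_def
  by (rule cInf_greatest) (use assms in \<open>auto simp: A0R_def intro: A0R_rep_nonneg\<close>)

lemma A0C_norm_le:
  assumes "F \<in> A0R"
  shows "A0C_norm (tildeF F) \<le> A0R_norm F"
  unfolding A0C_norm_def
proof (rule cInf_lower)
  show "bdd_below {A0R_norm G |G. G \<in> A0R \<and> tildeF G = tildeF F}"
    by (rule bdd_belowI[of _ 0]) (auto intro: A0R_norm_nonneg)
qed (use assms in blast)

lemma A0C_norm_nonneg:
  assumes "\<phi> \<in> A0C"
  shows "0 \<le> A0C_norm \<phi>"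
  unfolding A0C_norm_def
  by (rule cInf_greatest) (use assms in \<open>auto simp: A0C_def intro: A0R_norm_nonneg\<close>)

lemma le_mult_Inf:
  fixes a K :: real
  assumes "S \<noteq> {}" "K \<ge> 0" "\<And>s. s \<in> S \<Longrightarrow> a \<le> K * s"
  shows "a \<le> K * Inf S"
proof (cases "K = 0")
  case True
  then show ?thesis using assms by auto
next
  case False
  then have K: "K > 0" using assms by simp
  have "a / K \<le> Inf S"
    using assms K by (intro cInf_greatest) (auto simp: divide_le_eq mult.commute)
  then show ?thesis using K by (simp add: divide_le_eq mult.commute)
qed

lemma L1p_absolutely_integrable:
  assumes "b \<in> L1p" shows "b absolutely_integrable_on {0..}"
proof -
  have b: "integrable lborel b" using assms by (simp add: L1p_def)
  have "integrable lebesgue b"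
    using integrable_completion[of b lborel] b borel_measurable_integrable[OF b] by simp
  then show ?thesis unfolding set_integrable_def by (intro integrable_mult_indicator) auto
qed

context bdd_semigroup
begin

text \<open>The value does not depend on the family chosen, by \<open>calc_unique\<close>; off the
  domain of \<open>calc\<close> it is arbitrary.\<close>

definition fcalc :: "(complex \<Rightarrow> complex) \<Rightarrow> 'h \<Rightarrow>\<^sub>L 'h" where
  "fcalc \<phi> = (SOME S. \<exists>\<beta>. calc \<phi> \<beta> \<and> S = \<beta> 0)"

lemma fcalc_eq:
  assumes "calc \<phi> \<beta>" shows "fcalc \<phi> = \<beta> 0"
proof -
  have "\<exists>\<gamma>. calc \<phi> \<gamma> \<and> fcalc \<phi> = \<gamma> 0"
    unfolding fcalc_def by (rule someI[of _ "\<beta> 0"]) (use assms in blast)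
  then show ?thesis using calc_unique[OF assms] by auto
qed

lemma A0C_calc:
  assumes "\<phi> \<in> A0C" obtains \<beta> where "calc \<phi> \<beta>"
  using assms calc_A0R unfolding A0C_def A0R_def by blast

text \<open>Two nested infima: over the functions F with transform \<phi>, and over the
  representations of each F. Every representation brings its own family from
  \<open>calc_A0R\<close>, and single-valuedness makes all the bounds apply to the same
  operator.\<close>

lemma norm_fcalc_le:
  assumes "\<phi> \<in> A0C"
  shows "norm (fcalc \<phi>) \<le> C\<^sup>2 * A0C_norm \<phi>"
  unfolding A0C_norm_def
proof (rule le_mult_Inf)
  show "{A0R_norm F |F. F \<in> A0R \<and> tildeF F = \<phi>} \<noteq> {}" using assms by (auto simp: A0C_def)
  fix s assume "s \<in> {A0R_norm F |F. F \<in> A0R \<and> tildeF F = \<phi>}"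
  then obtain F where F: "F \<in> A0R" "tildeF F = \<phi>" and s: "s = A0R_norm F" by blast
  show "norm (fcalc \<phi>) \<le> C\<^sup>2 * s"
    unfolding s A0R_norm_def
  proof (rule le_mult_Inf)
    show "{(\<Sum>k. supnorm (fs k) * L1norm (hs k)) |fs hs. A0R_rep F fs hs} \<noteq> {}"
      using F by (auto simp: A0R_def)
    fix s assume "s \<in> {(\<Sum>k. supnorm (fs k) * L1norm (hs k)) |fs hs. A0R_rep F fs hs}"
    then obtain fs hs where rep: "A0R_rep F fs hs" and s: "s = (\<Sum>k. supnorm (fs k) * L1norm (hs k))" by blast
    show "norm (fcalc \<phi>) \<le> C\<^sup>2 * s"
      using calc_A0R[OF rep] fcalc_eq F(2) s by auto
  qed simp
qed simp

lemma fcalc_hom: "A0C_bounded_hom J fcalc"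
  unfolding A0C_bounded_hom_def
proof (intro conjI ballI allI)
  fix \<phi> assume "\<phi> \<in> A0C"
  then obtain \<beta> where \<beta>: "calc \<phi> \<beta>" by (rule A0C_calc)
  show "fcalc \<phi> \<in> BH J" using calc_BH[OF \<beta>] fcalc_eq[OF \<beta>] by simp
  show "blinfun_apply (fcalc (\<lambda>z. c * \<phi> z)) x = cscale J c (blinfun_apply (fcalc \<phi>) x)" for c x
    using fcalc_eq[OF calc_cmult[OF \<beta>, of c]] fcalc_eq[OF \<beta>]
    by (simp add: bounded_linear_Blinfun_apply[OF bounded_linear_cscale])
  fix \<psi> assume "\<psi> \<in> A0C"
  then obtain \<gamma> where \<gamma>: "calc \<psi> \<gamma>" by (rule A0C_calc)
  show "fcalc (\<lambda>z. \<phi> z + \<psi> z) = fcalc \<phi> + fcalc \<psi>"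
    using fcalc_eq[OF calc_add[OF \<beta> \<gamma>]] fcalc_eq[OF \<beta>] fcalc_eq[OF \<gamma>] by simp
  show "fcalc (\<lambda>z. \<phi> z * \<psi> z) = fcalc \<phi> o\<^sub>L fcalc \<psi>"
    using fcalc_eq[OF calc_mult[OF \<beta> \<gamma>]] fcalc_eq[OF \<beta>] fcalc_eq[OF \<gamma>] by simp
next
  show "\<exists>K. \<forall>\<phi>\<in>A0C. norm (fcalc \<phi>) \<le> K * A0C_norm \<phi>" using norm_fcalc_le by blast
qed

lemma fcalc_laplace:
  assumes "b absolutely_integrable_on {0..}"
  shows "((\<lambda>t. cscale J (b t) (T t x)) has_integral fcalc (laplace b) x) {0..}"
proof -
  obtain b' where b': "b' \<in> L1p" "laplace b = laplace b'" "negligible {t \<in> {0..}. b t \<noteq> b' t}"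
    using L1p_representative[OF assms] by blast
  have "fcalc (laplace b) = hp b'"
    using fcalc_eq[OF calc_laplace[OF b'(1)]] b'(2) by simp
  then have "((\<lambda>t. cscale J (b' t) (T t x)) has_integral fcalc (laplace b) x) {0..}"
    using hp_has_integral[OF b'(1)] by simp
  then show ?thesis by (rule has_integral_spike[OF b'(3), rotated]) auto
qed

text \<open>Laplace transforms are dense in A_0 for its norm. On them the integral formula
  determines the operator, and additivity together with boundedness carries the equality to the
  limit.\<close>

lemma fcalc_unique:
  assumes hom: "A0C_bounded_hom J \<rho>"
    and int: "\<And>b x. b absolutely_integrable_on {0..} \<Longrightarrow>
      ((\<lambda>t. cscale J (b t) (T t x)) has_integral \<rho> (laplace b) x) {0..}"
    and \<phi>: "\<phi> \<in> A0C"
  shows "\<rho> \<phi> = fcalc \<phi>"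
proof -
  obtain F fs hs where F: "\<phi> = tildeF F" and rep: "A0R_rep F fs hs"
    using \<phi> by (auto simp: A0C_def A0R_def)
  have H1: "\<And>k. H1fun (hs k)" using rep by (simp add: A0R_rep_def)
  obtain h where h: "H1rep hs h" using H1rep_exists[of hs] H1 by blast
  obtain K where K: "\<And>\<psi>. \<psi> \<in> A0C \<Longrightarrow> norm (\<rho> \<psi>) \<le> K * A0C_norm \<psi>"
    using hom unfolding A0C_bounded_hom_def by blast
  have add: "\<rho>' (\<lambda>z. \<psi>1 z + \<psi>2 z) = \<rho>' \<psi>1 + \<rho>' \<psi>2"
    if "A0C_bounded_hom J \<rho>'" "\<psi>1 \<in> A0C" "\<psi>2 \<in> A0C" for \<rho>' \<psi>1 \<psi>2
    using that unfolding A0C_bounded_hom_def by blast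
  have "norm (\<rho> \<phi> - fcalc \<phi>) \<le> e * (\<bar>K\<bar> + C\<^sup>2)" if e: "e > 0" for e
  proof -
    obtain n gs cs where nice: "\<And>k. fourier_pair (gs k) (cs k)" and z: "\<forall>k\<ge>n. gs k = (\<lambda>_. 0)"
      and sd: "summable (\<lambda>k. supnorm (\<lambda>t. fs k t - gs k t) * L1norm (hs k))"
      and de: "(\<Sum>k. supnorm (\<lambda>t. fs k t - gs k t) * L1norm (hs k)) \<le> e"
      using A0R_rep_nice_approx[OF rep e] by blast
    define b where "b = nice_symbol cs h n"
    have bL: "b \<in> L1p" unfolding b_def by (rule nice_symbol_L1p[OF nice h])
    let ?G = "\<lambda>t. \<Sum>k<n. conv (gs k) (hs k) t"
    have G: "A0R_rep ?G gs hs" "tildeF ?G = laplace b"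
      unfolding b_def by (rule nice_rep[OF nice z h H1])+
    define \<psi> where "\<psi> = tildeF (\<lambda>t. F t - ?G t)"
    have FG: "A0R_rep (\<lambda>t. F t - ?G t) (\<lambda>k t. fs k t - gs k t) hs"
      by (rule A0R_rep_diff[OF rep G(1) sd])
    then have FGA: "(\<lambda>t. F t - ?G t) \<in> A0R" by (auto simp: A0R_def)
    have "\<psi> z = tildeF F z - tildeF ?G z" for z
      unfolding \<psi>_def
      by (rule tildeF_diff[OF A0R_rep_measurable[OF rep] A0R_rep_bound[OF rep]
            A0R_rep_measurable[OF G(1)] A0R_rep_bound[OF G(1)]])
    then have split: "\<phi> = (\<lambda>z. laplace b z + \<psi> z)" by (simp add: F G(2))
    have mem: "laplace b \<in> A0C" "\<psi> \<in> A0C"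
      using G FGA by (auto simp: A0C_def A0R_def \<psi>_def simp flip: G(2))
    have N: "A0C_norm \<psi> \<le> e" "0 \<le> A0C_norm \<psi>"
      using A0C_norm_le[OF FGA] A0R_norm_le[OF FG] de A0C_norm_nonneg[OF mem(2)]
      unfolding \<psi>_def by auto
    have "\<rho> (laplace b) = fcalc (laplace b)"
      \<comment> \<open>Two values of the same strong integral agree at every vector.\<close>
      by (rule blinfun_eqI)
         (rule has_integral_unique[OF int fcalc_laplace], (rule L1p_absolutely_integrable[OF bL])+)
    then have "\<rho> \<phi> - fcalc \<phi> = \<rho> \<psi> - fcalc \<psi>"
      unfolding split add[OF hom mem] add[OF fcalc_hom mem] by simp
    also have "norm \<dots> \<le> norm (\<rho> \<psi>) + norm (fcalc \<psi>)" by (rule norm_triangle_ineq4)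
    also have "\<dots> \<le> \<bar>K\<bar> * A0C_norm \<psi> + C\<^sup>2 * A0C_norm \<psi>"
    proof (rule add_mono)
      have "K * A0C_norm \<psi> \<le> \<bar>K\<bar> * A0C_norm \<psi>" using N by (intro mult_right_mono) auto
      then show "norm (\<rho> \<psi>) \<le> \<bar>K\<bar> * A0C_norm \<psi>" using K[OF mem(2)] by linarith
    qed (rule norm_fcalc_le[OF mem(2)])
    also have "\<dots> \<le> \<bar>K\<bar> * e + C\<^sup>2 * e" using N by (intro add_mono mult_left_mono) auto
    finally show ?thesis by (simp add: algebra_simps)
  qed
  then have "norm (\<rho> \<phi> - fcalc \<phi>) \<le> 0" by (rule nonpos_of_le_epsilon_mult)
  then show ?thesis by simp
qed

end

text \<open>A homomorphism is a total map on functions of z, with arbitrary values off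
  \<open>A0C\<close>; uniqueness is therefore agreement on \<open>A0C\<close>.\<close>

theorem mainTheorem10:
  fixes J :: "'h::{real_inner,complete_space} \<Rightarrow> 'h"
    and T :: "real \<Rightarrow> 'h \<Rightarrow>\<^sub>L 'h"
  assumes "cplx_struct J"
    and "bounded_C0_semigroup J T"
  shows "\<exists>\<rho>. A0C_bounded_hom J \<rho> \<and>
           (\<forall>b. b absolutely_integrable_on {0..} \<longrightarrow>
              (\<forall>x. ((\<lambda>t. cscale J (b t) (blinfun_apply (T t) x)) has_integral
                       blinfun_apply (\<rho> (laplace b)) x) {0..})) \<and>
           (\<forall>\<rho>'. A0C_bounded_hom J \<rho>' \<and>
              (\<forall>b. b absolutely_integrable_on {0..} \<longrightarrow>
                 (\<forall>x. ((\<lambda>t. cscale J (b t) (blinfun_apply (T t) x)) has_integral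
                          blinfun_apply (\<rho>' (laplace b)) x) {0..}))
              \<longrightarrow> (\<forall>\<phi>\<in>A0C. \<rho>' \<phi> = \<rho> \<phi>)) \<and>
           (\<forall>\<phi>\<in>A0C. norm (\<rho> \<phi>) \<le> (SUP t\<in>{0..}. norm (T t))\<^sup>2 * A0C_norm \<phi>)"
proof -
  obtain M where M: "\<And>t. t \<ge> 0 \<Longrightarrow> norm (T t) \<le> M"
    using assms(2) unfolding bounded_C0_semigroup_def by blast
  \<comment> \<open>Boundedness makes the supremum a genuine upper bound, so it can serve as the
    constant \<open>C\<close> of the locale and appears squared in the final norm estimate.\<close>
  have "norm (T t) \<le> (SUP t\<in>{0..}. norm (T t))" if "t \<ge> 0" for t
    using that M by (intro cSUP_upper bdd_aboveI2[of _ _ M]) auto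
  then interpret bdd_semigroup J T "SUP t\<in>{0..}. norm (T t)"
    using assms by unfold_locales auto
  show ?thesis
    by (intro exI[of _ fcalc] conjI allI impI ballI fcalc_hom fcalc_laplace norm_fcalc_le)
       (auto intro: fcalc_unique)
qed

end
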